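(* Let $\alpha$ be a transcendental number with $0<\alpha\leq 1$, let $\mathfrak{B}=\{b_m: m\in\mathbb{N}_0\}$ be a periodic sequence of complex numbers, not all zero, and let $\varphi(s)$ belong to the class $\widetilde S$. Let $N\in\mathbb{N}$, $n\in\mathbb{N}_0$, and for each $j=0,1,\ldots,n$ let $F_j:\mathbb{C}^{2N}\to\mathbb{C}$ be a continuous function. If the function $$\sum_{j=0}^{n}s^j\cdot F_j\big(\varphi(s),\varphi'(s),\ldots,\varphi^{(N-1)}(s),\zeta(s,\alpha;\mathfrak{B}),\zeta'(s,\alpha;\mathfrak{B}),\ldots,\zeta^{(N-1)}(s,\alpha;\mathfrak{B})\big)$$ is identically zero (in $s$), then $F_j\equiv 0$ for all $j=0,1,\ldots,n$.
   Context: Write $s=\sigma+it$. For a periodic sequence $\mathfrak{B}=\{b_m: m\in\mathbb{N}_0\}$ of complex numbers (not all zero) with minimal period $k$ and $0<\alpha\leq 1$, the periodic Hurwitz zeta-function is $\zeta(s,\alpha;\mathfrak{B})=\sum_{m=0}^\infty b_m (m+\alpha)^{-s}$ for $\sigma>1$; since $\zeta(s,\alpha;\mathfrak{B})=k^{-s}\sum_{l=0}^{k-1}b_l\zeta(s,\frac{l+\alpha}{k})$ with $\zeta(s,\cdot)$ the Hurwitz zeta-function, it extends meromorphically to $\mathbb{C}$ with at most a simple pole at $s=1$. The class $\widetilde S$ consists of functions $\varphi(s)$ satisfying: (i) $\varphi(s)=\sum_{m=1}^\infty a(m)m^{-s}$ with $a(m)=O(m^{\varepsilon})$ for every $\varepsilon>0$;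 (ii) there is $\sigma_\varphi<1$ such that $\varphi$ continues meromorphically to $\sigma>\sigma_\varphi$; (iii) there is $c\geq 0$ with $\varphi(\sigma+it)=O(|t|^{c+\varepsilon})$ for every fixed $\sigma>\sigma_\varphi$ and every $\varepsilon>0$; (iv) there are $l\in\mathbb{N}$ and complex numbers $a_j(p)$ such that $\varphi(s)=\prod_{p}\prod_{j=1}^{l}(1-a_j(p)p^{-s})^{-1}$, the product over primes; (v) there is $\kappa>0$ with $\lim_{x\to\infty}\frac{1}{\pi(x)}\sum_{p\leq x}|a(p)|^2=\kappa$, where $\pi(x)$ is the number of primes $\leq x$. *)

theory Defs
  imports "HOL-Complex_Analysis.Complex_Analysis" "HOL-Library.Landau_Symbols"
begin

subsection \<open>Continuation of the Hurwitz zeta-function\<close>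

lemma summable_shifted_powr:
  fixes a p :: real
  assumes "a > 0" "p < -1"
  shows "summable (\<lambda>n. (real n + a) powr p)"
proof -
  have "summable (\<lambda>n. real n powr p)"
    using assms by (simp add: summable_real_powr_iff)
  hence "summable (\<lambda>n. norm ((real (Suc n) + a) powr p))"
  proof (rule summable_comparison_test[rotated, OF summable_Suc_iff[THEN iffD2]], intro exI allI impI)
    fix n :: nat
    have "(real (Suc n) + a) powr p \<le> real (Suc n) powr p"
      using assms by (intro powr_mono2') auto
    thus "norm (norm ((real (Suc n) + a) powr p)) \<le> real (Suc n) powr p" by simp
  qed
  thus ?thesis by (subst (asm) summable_Suc_iff) simp
qed

lemma series_holomorphic_halfplane:
  fixes f :: "nat \<Rightarrow> complex \<Rightarrow> complex" and a c :: real
  assumes a: "a > 0"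
  assumes hol: "\<And>n. f n holomorphic_on {s. Re s > c}"
  assumes cont: "continuous_on {s. Re s > c} C"
  assumes bd: "\<And>n s. Re s > c \<Longrightarrow> norm (f n s) \<le> C s * (real n + a) powr (c - 1 - Re s)"
  shows "(\<lambda>s. \<Sum>n. f n s) holomorphic_on {s. Re s > c}"
    and "\<And>s. Re s > c \<Longrightarrow> summable (\<lambda>n. f n s)"
proof -
  show "summable (\<lambda>n. f n s)" if "Re s > c" for s
  proof (rule summable_comparison_test[OF exI])
    show "\<forall>n\<ge>0. norm (f n s) \<le> C s * (real n + a) powr (c - 1 - Re s)" using bd[OF that] by simp
    show "summable (\<lambda>n. C s * (real n + a) powr (c - 1 - Re s))"
      using that a by (intro summable_mult summable_shifted_powr) auto
  qed
next
  show "(\<lambda>s. \<Sum>n. f n s) holomorphic_on {s. Re s > c}"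
  proof (rule holomorphic_uniform_sequence[where f = "\<lambda>N s. \<Sum>n<N. f n s"])
    show "open {s. Re s > c}" by (simp add: open_halfspace_Re_gt)
    show "(\<lambda>s. \<Sum>n<N. f n s) holomorphic_on {s. Re s > c}" for N
      by (intro holomorphic_intros hol)
    fix z assume z: "z \<in> {s. Re s > c}"
    define d where "d = (Re z - c) / 2"
    have d: "d > 0" using z by (simp add: d_def)
    have re: "Re s \<ge> c + d" if "s \<in> cball z d" for s
    proof -
      have "\<bar>Re (z - s)\<bar> \<le> d"
        using that abs_Re_le_cmod[of "z - s"] by (simp add: dist_norm)
      thus ?thesis by (simp add: d_def field_simps abs_if split: if_splits)
    qed
    have sub: "cball z d \<subseteq> {s. Re s > c}" using re d by force
    have "compact (C ` cball z d)"
      by (intro compact_continuous_image continuous_on_subset[OF cont] sub) auto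
    hence "bounded (C ` cball z d)" by (rule compact_imp_bounded)
    then obtain B where B: "\<And>s. s \<in> cball z d \<Longrightarrow> norm (C s) \<le> B"
      unfolding bounded_iff by blast
    have "uniform_limit (cball z d) (\<lambda>N s. \<Sum>n<N. f n s) (\<lambda>s. \<Sum>n. f n s) sequentially"
    proof (rule Weierstrass_m_test_ev)
      show "\<forall>\<^sub>F n in sequentially. \<forall>s\<in>cball z d. norm (f n s) \<le> B * (real n + a) powr (-1 - d)"
        using eventually_ge_at_top[of 1]
      proof eventually_elim
        case (elim n)
        show ?case
        proof
          fix s assume s: "s \<in> cball z d"
          have "norm (f n s) \<le> C s * (real n + a) powr (c - 1 - Re s)"
            using s sub by (intro bd) auto
          also have "\<dots> \<le> B * (real n + a) powr (-1 - d)"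
            using B[OF s] elim a re[OF s] by (intro mult_mono powr_mono) (auto intro: order.trans[OF norm_ge_zero])
          finally show "norm (f n s) \<le> B * (real n + a) powr (-1 - d)" .
        qed
      qed
      show "summable (\<lambda>n. B * (real n + a) powr (-1 - d))"
        using d a by (intro summable_mult summable_shifted_powr) auto
    qed
    thus "\<exists>d>0. cball z d \<subseteq> {s. Re s > c} \<and>
       uniform_limit (cball z d) (\<lambda>N s. \<Sum>n<N. f n s) (\<lambda>s. \<Sum>n. f n s) sequentially"
      using d sub by blast
  qed
qed

text \<open>
  Expanding \<open>(x + 1) powr (1 - s)\<close> around \<open>x = n + a\<close> to order \<open>K\<close> with remainder \<open>trem K x s\<close> and
  summing over \<open>n\<close> expresses \<open>\<zeta>(s, a)\<close> through \<open>\<zeta>(s + 1, a), \<dots>, \<zeta>(s + K - 1, a)\<close>, which continues it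
  one unit further to the left.
\<close>

definition ffac :: "complex \<Rightarrow> nat \<Rightarrow> complex"
  where "ffac s j = (\<Prod>i<j. 1 - s - of_nat i)"

definition trem :: "nat \<Rightarrow> real \<Rightarrow> complex \<Rightarrow> complex"
  where "trem K x s = of_real (x + 1) powr (1 - s) -
           (\<Sum>j\<le>K. ffac s j / fact j * of_real x powr (1 - s - of_nat j))"

lemma trem_bound:
  assumes x: "x > 0" and K: "Re s + real K \<ge> 0"
  shows "norm (trem K x s) \<le> norm (ffac s (Suc K)) / fact K * x powr (- Re s - real K)"
proof -
  define S where "S = closed_segment (complex_of_real x) (complex_of_real (x+1))"
  have S: "\<exists>y. z = of_real y \<and> y \<ge> x" if "z \<in> S" for z
  proof -
    have "z \<in> of_real ` closed_segment x (x + 1)"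
      using that by (simp only: S_def closed_segment_of_real)
    thus ?thesis by (auto simp: closed_segment_eq_real_ivl)
  qed
  have "norm (of_real (x+1) powr (1 - s) - 
      (\<Sum>j\<le>K. ffac s j * of_real x powr (1 - s - of_nat j) * (of_real (x+1) - of_real x) ^ j / fact j))
     \<le> (norm (ffac s (Suc K)) * x powr (- Re s - real K)) * norm (of_real (x+1) - complex_of_real x) ^ Suc K / fact K"
  proof (rule order.trans[OF _ complex_Taylor[where S = S and f = "\<lambda>j z. ffac s j * z powr (1 - s - of_nat j)"]])
    show "convex S" by (simp add: S_def)
    show "complex_of_real x \<in> S" "complex_of_real (x+1) \<in> S" by (simp_all add: S_def)
    fix z assume z: "z \<in> S"
    then obtain y where y: "z = of_real y" "y \<ge> x" using S by blast
    have nz: "z \<notin> \<real>\<^sub>\<le>\<^sub>0" using y x by (auto simp: complex_nonpos_Reals_iff)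
    show "((\<lambda>z. ffac s i * z powr (1 - s - of_nat i)) has_field_derivative
            ffac s (Suc i) * z powr (1 - s - of_nat (Suc i))) (at z within S)" for i
      using nz by (auto intro!: derivative_eq_intros simp: ffac_def algebra_simps)
    have "norm (ffac s (Suc K) * z powr (1 - s - of_nat (Suc K))) = norm (ffac s (Suc K)) * y powr (- Re s - real K)"
      using y x by (simp add: norm_mult norm_powr_real_powr algebra_simps)
    also have "\<dots> \<le> norm (ffac s (Suc K)) * x powr (- Re s - real K)"
      using y x K by (intro mult_left_mono powr_mono2') auto
    finally show "norm (ffac s (Suc K) * z powr (1 - s - of_nat (Suc K))) \<le> norm (ffac s (Suc K)) * x powr (- Re s - real K)" .
  qed (auto simp: ffac_def)
  thus ?thesis by (simp add: trem_def field_simps)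
qed

lemma hurwitz_base:
  fixes a s
  assumes "a > 0" "Re s > 1"
  shows "summable (\<lambda>n. complex_of_real (real n + a) powr (-s))"
proof (rule series_holomorphic_halfplane(2)[where c = 1 and a = a and f = "\<lambda>n s. complex_of_real (real n + a) powr (-s)" and C = "\<lambda>_. 1"])
  show "(\<lambda>s. complex_of_real (real n + a) powr (-s)) holomorphic_on {s. Re s > 1}" for n
    by (intro holomorphic_intros)
  show "norm (complex_of_real (real n + a) powr (-s)) \<le> 1 * (real n + a) powr (1 - 1 - Re s)" for n s
    using assms by (subst norm_powr_real_powr) auto
qed (use assms in \<open>auto intro: continuous_intros\<close>)

lemma hurwitz_base_holo:
  assumes "a > 0"
  shows "(\<lambda>s. \<Sum>n. complex_of_real (real n + a) powr (-s)) holomorphic_on {s. Re s > 1}"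
proof (rule series_holomorphic_halfplane(1)[where c = 1 and a = a and f = "\<lambda>n s. complex_of_real (real n + a) powr (-s)" and C = "\<lambda>_. 1"])
  show "(\<lambda>s. complex_of_real (real n + a) powr (-s)) holomorphic_on {s. Re s > 1}" for n
    by (intro holomorphic_intros)
  show "norm (complex_of_real (real n + a) powr (-s)) \<le> 1 * (real n + a) powr (1 - 1 - Re s)" for n s
    using assms by (subst norm_powr_real_powr) auto
qed (use assms in \<open>auto intro: continuous_intros\<close>)

lemma hurwitz_halfplane:
  fixes a :: real
  assumes a: "a > 0"
  shows "\<exists>G. G holomorphic_on {s. Re s > 1 - real k} \<and>
           (\<forall>s. Re s > 1 \<longrightarrow> (\<lambda>n. complex_of_real (real n + a) powr (-s)) sums (G s / (s - 1)))"
proof (induction k)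
  case 0
  show ?case
  proof (intro exI conjI allI impI)
    show "(\<lambda>s. (s - 1) * (\<Sum>n. complex_of_real (real n + a) powr (-s))) holomorphic_on {s. Re s > 1 - real 0}"
      using hurwitz_base_holo[OF a] by (intro holomorphic_intros) auto
    fix s :: complex assume s: "Re s > 1"
    hence "s \<noteq> 1" by auto
    thus "(\<lambda>n. complex_of_real (real n + a) powr (-s)) sums
       ((s - 1) * (\<Sum>n. complex_of_real (real n + a) powr (-s)) / (s - 1))"
      using hurwitz_base[OF a s] by (simp add: summable_sums)
  qed
next
  case (Suc k)
  then obtain G where G: "G holomorphic_on {s. Re s > 1 - real k}"
     "\<And>s. Re s > 1 \<Longrightarrow> (\<lambda>n. complex_of_real (real n + a) powr (-s)) sums (G s / (s - 1))"
    by blast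
  define K where "K = Suc k"
  define c where "c = 1 - real K"
  define R where "R = (\<lambda>s. \<Sum>n. trem K (real n + a) s)"
  have tr_hol: "trem K (real n + a) holomorphic_on A" for n A
    using a unfolding trem_def ffac_def by (intro holomorphic_intros) auto
  have tr_bd: "norm (trem K (real n + a) s) \<le> norm (ffac s (Suc K)) / fact K * (real n + a) powr (c - 1 - Re s)"
    if "Re s > c" for n s
    using trem_bound[of "real n + a" s K] that a by (simp add: c_def add_ac minus_diff_commute)
  have tr_cont: "continuous_on {s. Re s > c} (\<lambda>s. norm (ffac s (Suc K)) / fact K)"
    unfolding ffac_def by (intro continuous_intros) auto
  have R_hol: "R holomorphic_on {s. Re s > c}"
    unfolding R_def by (rule series_holomorphic_halfplane(1)[OF a tr_hol tr_cont tr_bd])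
  have R_sum: "(\<lambda>n. trem K (real n + a) s) sums R s" if "Re s > c" for s
    unfolding R_def using series_holomorphic_halfplane(2)[OF a tr_hol tr_cont tr_bd that] by (rule summable_sums)
  define G' where "G' = (\<lambda>s. of_real a powr (1 - s) - (\<Sum>j\<in>{2..K}. ffac s (j-1) / fact j * G (s + of_nat (j-1))) + R s)"
  show ?case
  proof (intro exI conjI allI impI)
    have "(\<lambda>s. G (s + of_nat (j-1))) holomorphic_on {s. Re s > c}" if "j \<in> {2..K}" for j
    proof (rule holomorphic_on_compose_gen[where g = G, unfolded o_def])
      show "G holomorphic_on {s. Re s > 1 - real k}" by fact
      show "(\<lambda>s. s + of_nat (j-1)) holomorphic_on {s. Re s > c}" by (intro holomorphic_intros)
      show "(\<lambda>s. s + of_nat (j-1)) ` {s. Re s > c} \<subseteq> {s. Re s > 1 - real k}"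
        using that by (auto simp: c_def K_def)
    qed
    thus "G' holomorphic_on {s. Re s > 1 - real (Suc k)}"
      using a R_hol unfolding G'_def ffac_def K_def[symmetric] c_def[symmetric]
      by (intro holomorphic_intros) auto
  next
    fix s :: complex assume s: "Re s > 1"
    have "(\<lambda>n. complex_of_real (real n + a) powr (1 - s)) \<longlonglongrightarrow> 0"
    proof (rule tendsto_norm_zero_cancel)
      have "(\<lambda>n. (real n + a) powr (1 - Re s)) \<longlonglongrightarrow> 0"
      proof (rule tendsto_neg_powr)
        show "filterlim (\<lambda>n. real n + a) at_top sequentially"
          by (rule filterlim_tendsto_add_at_top[OF tendsto_const filterlim_real_sequentially, THEN filterlim_cong[OF refl refl, THEN iffD1, rotated]])
             (auto simp: add.commute)
      qed (use s in auto)
      thus "(\<lambda>n. norm (complex_of_real (real n + a) powr (1 - s))) \<longlonglongrightarrow> 0"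
        using a by (subst norm_powr_real_powr) auto
    qed
    from telescope_sums[OF this]
    have tel: "(\<lambda>n. complex_of_real (real (Suc n) + a) powr (1 - s) - complex_of_real (real n + a) powr (1 - s)) sums
        (- (complex_of_real a powr (1 - s)))" by simp
    have Gj: "(\<lambda>n. complex_of_real (real n + a) powr (1 - s - of_nat j)) sums (G (s + of_nat (j-1)) / (s + of_nat j - 2))"
      if "j \<in> {1..K}" for j
    proof -
      have "Re (s + of_nat (j-1)) > 1" using s by simp
      from G(2)[OF this] show ?thesis using that by (simp add: of_nat_diff algebra_simps)
    qed
    have trm: "(\<lambda>n. ffac s j / fact j * complex_of_real (real n + a) powr (1 - s - of_nat j)) sums
        - (ffac s (j-1) / fact j * G (s + of_nat (j-1)))" if j: "j \<in> {1..K}" for j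
    proof -
      have "Re (s + of_nat j - 2) > 0" using s j by auto
      hence nz: "s + of_nat j - 2 \<noteq> 0" by fastforce
      obtain i where i: "j = Suc i" using j by (cases j) auto
      have "ffac s j = - ffac s (j-1) * (s + of_nat j - 2)"
        by (simp add: ffac_def i algebra_simps)
      hence "ffac s j / fact j * (G (s + of_nat (j-1)) / (s + of_nat j - 2)) = - (ffac s (j-1) / fact j * G (s + of_nat (j-1)))"
        using nz by simp
      thus ?thesis using sums_mult[OF Gj[OF j], of "ffac s j / fact j"] by simp
    qed
    have "(\<lambda>n. (\<Sum>j\<in>{1..K}. ffac s j / fact j * complex_of_real (real n + a) powr (1 - s - of_nat j)) + trem K (real n + a) s)
       sums ((\<Sum>j\<in>{1..K}. - (ffac s (j-1) / fact j * G (s + of_nat (j-1)))) + R s)"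
      using s by (intro sums_add sums_sum trm R_sum) (auto simp: c_def K_def)
    also have "(\<lambda>n. (\<Sum>j\<in>{1..K}. ffac s j / fact j * complex_of_real (real n + a) powr (1 - s - of_nat j)) + trem K (real n + a) s) = 
      (\<lambda>n. complex_of_real (real (Suc n) + a) powr (1 - s) - complex_of_real (real n + a) powr (1 - s))"
    proof
      fix n
      have "{..K} = insert 0 {1..K}" by auto
      thus "(\<Sum>j\<in>{1..K}. ffac s j / fact j * complex_of_real (real n + a) powr (1 - s - of_nat j)) + trem K (real n + a) s = 
        complex_of_real (real (Suc n) + a) powr (1 - s) - complex_of_real (real n + a) powr (1 - s)"
        by (simp add: trem_def ffac_def add_ac)
    qed
    finally have "(\<Sum>j\<in>{1..K}. - (ffac s (j-1) / fact j * G (s + of_nat (j-1)))) + R s = - (complex_of_real a powr (1 - s))"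
      using tel sums_unique2 by blast
    moreover have "{1..K} = insert 1 {2..K}" by (auto simp: K_def)
    ultimately have "G s = G' s"
      by (simp add: G'_def sum_negf ffac_def[of s 0]) (simp add: algebra_simps eq_neg_iff_add_eq_0)
    thus "(\<lambda>n. complex_of_real (real n + a) powr (-s)) sums (G' s / (s - 1))"
      using G(2)[OF s] by simp
  qed
qed

lemma hurwitz_entire:
  fixes a :: real
  assumes a: "a > 0"
  shows "\<exists>G. G holomorphic_on UNIV \<and>
           (\<forall>s. Re s > 1 \<longrightarrow> (\<lambda>n. complex_of_real (real n + a) powr (-s)) sums (G s / (s - 1)))"
proof -
  obtain G where G: "\<And>k. G k holomorphic_on {s. Re s > 1 - real k}"
    "\<And>k s. Re s > 1 \<Longrightarrow> (\<lambda>n. complex_of_real (real n + a) powr (-s)) sums (G k s / (s - 1))"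
    using hurwitz_halfplane[OF a] by metis
  have eq: "G k s = G l s" if "k \<le> l" "Re s > 1 - real k" for k l s
  proof (rule analytic_continuation_open[of "{s. Re s > 1}" "{s. Re s > 1 - real k}" "G k" "G l"])
    show "open {s. Re s > 1}" "open {s. Re s > 1 - real k}" by (simp_all add: open_halfspace_Re_gt)
    show "{s. Re s > 1} \<noteq> {}" by (auto intro!: exI[of _ 2])
    show "connected {s. Re s > 1 - real k}"
      by (intro convex_connected) (simp add: convex_halfspace_Re_gt)
    show "G k holomorphic_on {s. Re s > 1 - real k}" by fact
    show "G l holomorphic_on {s. Re s > 1 - real k}"
      using that by (intro holomorphic_on_subset[OF G(1)[of l]]) auto
    fix z assume z: "z \<in> {s. Re s > 1}"
    hence "G k z / (z - 1) = G l z / (z - 1)" using G(2) sums_unique2 by blast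
    moreover have "z \<noteq> 1" using z by auto
    ultimately show "G k z = G l z" by simp
  qed (use that in auto)
  define H where "H = (\<lambda>s. G (nat \<lceil>2 - Re s\<rceil>) s)"
  have HG: "H s = G k s" if "Re s > 1 - real k" for s k
  proof -
    define l where "l = nat \<lceil>2 - Re s\<rceil>"
    have "Re s > 1 - real l" unfolding l_def by linarith
    hence "G l s = G k s"
      using that by (cases "k \<le> l") (metis eq, metis eq nat_le_linear)
    thus ?thesis by (simp only: H_def l_def)
  qed
  have "H holomorphic_on (\<Union>k. {s. Re s > 1 - real k})"
  proof (rule holomorphic_on_UN_open)
    show "H holomorphic_on {s. Re s > 1 - real k}" for k
      using G(1)[of k] by (rule holomorphic_transform) (simp add: HG)
  qed (simp add: open_halfspace_Re_gt)
  moreover have "(\<Union>k. {s. Re s > 1 - real k}) = UNIV"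
  proof -
    have "\<exists>k. Re s > 1 - real k" for s :: complex using reals_Archimedean2[of "1 - Re s"] by (auto simp: algebra_simps)
    thus ?thesis by auto
  qed
  ultimately show ?thesis using G(2) HG[of 0] by (intro exI[of _ H]) auto
qed

subsection \<open>The periodic Hurwitz zeta-function\<close>

text \<open>
  Meromorphic functions are represented by total functions that are nicely meromorphic: removable
  singularities are removed, and the value at a pole is 0. The continuation of the series is then
  unique as a total function; see \<open>periodic_hurwitz_zeta_ex1\<close> for its existence.
\<close>

definition periodic_hurwitz_zeta :: "real \<Rightarrow> (nat \<Rightarrow> complex) \<Rightarrow> complex \<Rightarrow> complex" where
  "periodic_hurwitz_zeta \<alpha> b = (THE Z. Z nicely_meromorphic_on UNIV \<and>
     (\<forall>s. Re s > 1 \<longrightarrow> (\<lambda>m. b m * complex_of_real (real m + \<alpha>) powr (-s)) sums Z s))"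

definition periodic_seq :: "(nat \<Rightarrow> 'a) \<Rightarrow> bool" where
  "periodic_seq b \<longleftrightarrow> (\<exists>k>0. \<forall>m. b (m + k) = b m)"

lemma periodic_mod:
  assumes "\<And>m. b (m + k) = b m"
  shows "b (m mod k) = b (m :: nat)"
proof -
  have "b (i + q * k) = b i" for i q
  proof (induction q)
    case (Suc q)
    show ?case using assms[of "i + q * k"] Suc by (simp add: algebra_simps)
  qed simp
  from this[of "m mod k" "m div k"] show ?thesis by simp
qed

lemma nicely_meromorphic_halfplane_unique:
  assumes f: "f nicely_meromorphic_on UNIV" and g: "g nicely_meromorphic_on UNIV"
  assumes eq: "\<And>s. Re s > c \<Longrightarrow> f s = g s"
  shows "f = g"
proof
  fix z
  define D where "D = remove_sings (\<lambda>s. f s - g s)"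
  have mero: "(\<lambda>s. f s - g s) meromorphic_on UNIV"
    using f g by (intro meromorphic_intros) (auto simp: nicely_meromorphic_on_def)
  have D: "D nicely_meromorphic_on UNIV"
    unfolding D_def by (rule remove_sings_nicely_meromorphic) fact
  have op: "open {s. Re s > c}" by (rule open_halfspace_Re_gt)
  have D0: "D s = 0" if "Re s > c" for s
  proof -
    have "eventually (\<lambda>w. w \<in> {s. Re s > c}) (nhds s)"
      using that op by (intro eventually_nhds_in_open) auto
    hence "eventually (\<lambda>w. f w - g w = 0) (at s)"
      by (intro eventually_nhds_conv_at[THEN iffD1, THEN conjunct1]) (auto elim!: eventually_mono simp: eq)
    hence "(\<lambda>s. f s - g s) \<midarrow>s\<rightarrow> 0" by (rule tendsto_eventually)
    thus ?thesis unfolding D_def by (rule remove_sings_eqI)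
  qed
  have ne: "complex_of_real (c + 1) \<in> {s. Re s > c}" by simp
  have "D constant_on UNIV"
  proof (rule constant_on_extend_nicely_meromorphic_on[OF D, where A = "{s. Re s > c}"])
    show "D constant_on {s. Re s > c}" using D0 by (auto simp: constant_on_def)
    show "{s. Re s > c} \<noteq> {}" using ne by blast
  qed (use op in auto)
  hence D00: "D s = 0" for s
    using D0[of "complex_of_real (c + 1)"] ne by (auto simp: constant_on_def)
  have "eventually (\<lambda>s. D s = f s - g s) (at z)"
    using eventually_remove_sings_eq[OF mero] 
    unfolding D_def by (simp add: eventually_cosparse_open_eq)
  hence ev: "eventually (\<lambda>s. f s = g s) (at z)"
    by eventually_elim (simp add: D00)
  show "f z = g z"
  proof (cases "is_pole f z")
    case True
    hence "is_pole g z" using is_pole_cong[OF ev refl] by simp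
    have *: "h z = 0" if "h nicely_meromorphic_on UNIV" "is_pole h z" for h
      using that not_tendsto_and_filterlim_at_infinity[of "at z" h "h z"]
      unfolding nicely_meromorphic_on_def is_pole_def by auto
    show ?thesis using *[OF f True] *[OF g \<open>is_pole g z\<close>] by simp
  next
    case False
    hence "\<not> is_pole g z" using is_pole_cong[OF ev refl] by simp
    hence "g \<midarrow>z\<rightarrow> g z" "f \<midarrow>z\<rightarrow> f z" using f g False by (auto simp: nicely_meromorphic_on_def)
    hence "f \<midarrow>z\<rightarrow> g z" using tendsto_cong[OF ev] by blast
    thus ?thesis using \<open>f \<midarrow>z\<rightarrow> f z\<close> LIM_unique by blast
  qed
qed

lemma periodic_hurwitz_zeta_ex:
  fixes \<alpha> :: real and b :: "nat \<Rightarrow> complex"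
  assumes \<alpha>: "\<alpha> > 0" and b: "periodic_seq b"
  shows "\<exists>Z. Z nicely_meromorphic_on UNIV \<and> Z analytic_on -{1} \<and>
     (\<forall>s. Re s > 1 \<longrightarrow> (\<lambda>m. b m * complex_of_real (real m + \<alpha>) powr (-s)) sums Z s)"
proof -
  obtain k where k: "k > 0" "\<And>m. b (m + k) = b m" using b by (auto simp: periodic_seq_def)
  have "\<exists>G. G holomorphic_on UNIV \<and> (\<forall>s. Re s > 1 \<longrightarrow> 
         (\<lambda>n. complex_of_real (real n + (real l + \<alpha>) / real k) powr (-s)) sums (G s / (s - 1)))" for l :: nat
    using \<alpha> k by (intro hurwitz_entire) auto
  then obtain G where G: "\<And>l. G l holomorphic_on UNIV"
    "\<And>l s. Re s > 1 \<Longrightarrow> (\<lambda>n. complex_of_real (real n + (real l + \<alpha>) / real k) powr (-s)) sums (G l s / (s - 1))"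
    by metis
  define Z where "Z = (\<lambda>s. complex_of_real (real k) powr (-s) * (\<Sum>l<k. b l * (G l s / (s - 1))))"
  have an: "Z analytic_on -{1}"
  proof -
    have "Z holomorphic_on -{1}"
      unfolding Z_def using k by (intro holomorphic_intros holomorphic_on_subset[OF G(1)]) auto
    thus ?thesis by (subst analytic_on_open) auto
  qed
  have mero: "Z meromorphic_on UNIV"
  proof -
    have "G l meromorphic_on UNIV" for l
      using G(1)[of l] by (intro analytic_on_imp_meromorphic_on) (simp add: analytic_on_open)
    moreover have "(\<lambda>s. complex_of_real (real k) powr (-s)) meromorphic_on UNIV"
    proof (intro analytic_on_imp_meromorphic_on)
      have "(\<lambda>s. complex_of_real (real k) powr (-s)) holomorphic_on UNIV"
        using k by (intro holomorphic_intros) auto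
      thus "(\<lambda>s. complex_of_real (real k) powr (-s)) analytic_on UNIV" by (simp add: analytic_on_open)
    qed
    ultimately show ?thesis unfolding Z_def by (intro meromorphic_intros) auto
  qed
  have sums: "(\<lambda>m. b m * complex_of_real (real m + \<alpha>) powr (-s)) sums Z s" if s: "Re s > 1" for s
  proof -
    define f where "f = (\<lambda>m. b m * complex_of_real (real m + \<alpha>) powr (-s))"
    define B where "B = (\<Sum>l<k. norm (b l))"
    have B: "norm (b m) \<le> B" for m
    proof -
      have "norm (b (m mod k)) \<le> B"
        unfolding B_def using k by (intro member_le_sum) auto
      thus ?thesis using periodic_mod[of b k m] k by simp
    qed
    have "summable f"
    proof (rule summable_comparison_test[OF exI])
      show "\<forall>m\<ge>0. norm (f m) \<le> B * (real m + \<alpha>) powr (- Re s)"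
        unfolding f_def norm_mult using \<alpha> B
        by (auto simp: norm_powr_real_powr intro!: mult_right_mono simp del: of_real_add)
      show "summable (\<lambda>m. B * (real m + \<alpha>) powr (- Re s))"
        using s \<alpha> by (intro summable_mult summable_shifted_powr) auto
    qed
    hence f: "f sums suminf f" by (rule summable_sums)
    have "(\<lambda>n. sum f {n*k..<n*k+k}) sums suminf f" using f k by (intro sums_group) auto
    moreover have "(\<lambda>n. sum f {n*k..<n*k+k}) sums Z s"
    proof -
      have "sum f {n*k..<n*k+k} = complex_of_real (real k) powr (-s) *
             (\<Sum>l<k. b l * complex_of_real (real n + (real l + \<alpha>) / real k) powr (-s))" for n
      proof -
        have "sum f {n*k..<n*k+k} = (\<Sum>l<k. f (n*k + l))"
          by (rule sum.reindex_bij_witness[of _ "\<lambda>l. n*k+l" "\<lambda>m. m - n*k"]) auto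
        also have "\<dots> = (\<Sum>l<k. complex_of_real (real k) powr (-s) *
             (b l * complex_of_real (real n + (real l + \<alpha>) / real k) powr (-s)))"
        proof (intro sum.cong refl)
          fix l assume l: "l \<in> {..<k}"
          have "b (n*k+l) = b l" using periodic_mod[of b k "n*k+l"] k l by simp
          moreover have "real (n*k+l) + \<alpha> = real k * (real n + (real l + \<alpha>) / real k)"
            using k by (simp add: field_simps)
          moreover have "complex_of_real (real k * (real n + (real l + \<alpha>) / real k)) powr (-s) =
             complex_of_real (real k) powr (-s) * complex_of_real (real n + (real l + \<alpha>) / real k) powr (-s)"
            using k \<alpha> by (subst of_real_mult, intro powr_times_real) auto
          ultimately show "f (n*k+l) = complex_of_real (real k) powr (-s) *
             (b l * complex_of_real (real n + (real l + \<alpha>) / real k) powr (-s))"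
            by (simp add: f_def del: of_real_add of_real_mult)
        qed
        finally show ?thesis by (simp only: sum_distrib_left)
      qed
      moreover have "(\<lambda>n. complex_of_real (real k) powr (-s) *
             (\<Sum>l<k. b l * complex_of_real (real n + (real l + \<alpha>) / real k) powr (-s))) sums Z s"
        unfolding Z_def by (intro sums_mult sums_sum G(2) s)
      ultimately show ?thesis by simp
    qed
    ultimately have "suminf f = Z s" by (rule sums_unique2)
    thus ?thesis using f by (simp add: f_def)
  qed
  have rs: "remove_sings Z z = Z z" if "z \<noteq> 1" for z
    using that an by (intro remove_sings_at_analytic) (auto intro: analytic_on_subset)
  have "remove_sings Z analytic_on -{1}"
    using remove_sings_analytic_on[OF an] .
  moreover have "(\<lambda>m. b m * complex_of_real (real m + \<alpha>) powr (-s)) sums remove_sings Z s"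
    if "Re s > 1" for s
  proof -
    have "s \<noteq> 1" using that by auto
    thus ?thesis using sums[OF that] rs by simp
  qed
  ultimately show ?thesis
    using remove_sings_nicely_meromorphic[OF mero] by blast
qed

lemma periodic_hurwitz_zeta_ex1:
  assumes "\<alpha> > 0" and "periodic_seq b"
  shows "\<exists>!Z. Z nicely_meromorphic_on UNIV \<and>
     (\<forall>s. Re s > 1 \<longrightarrow> (\<lambda>m. b m * complex_of_real (real m + \<alpha>) powr (-s)) sums Z s)"
proof (rule ex_ex1I)
  show "\<exists>Z. Z nicely_meromorphic_on UNIV \<and>
     (\<forall>s. Re s > 1 \<longrightarrow> (\<lambda>m. b m * complex_of_real (real m + \<alpha>) powr (-s)) sums Z s)"
    using periodic_hurwitz_zeta_ex[OF assms] by blast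
qed (auto intro: nicely_meromorphic_halfplane_unique[where c = 1] sums_unique2)

lemma periodic_hurwitz_zeta:
  assumes "\<alpha> > 0" and "periodic_seq b"
  shows "periodic_hurwitz_zeta \<alpha> b nicely_meromorphic_on UNIV"
    and "Re s > 1 \<Longrightarrow> (\<lambda>m. b m * complex_of_real (real m + \<alpha>) powr (-s)) sums periodic_hurwitz_zeta \<alpha> b s"
    and "periodic_hurwitz_zeta \<alpha> b analytic_on -{1}"
proof -
  note th = theI'[OF periodic_hurwitz_zeta_ex1[OF assms], folded periodic_hurwitz_zeta_def]
  show "periodic_hurwitz_zeta \<alpha> b nicely_meromorphic_on UNIV" using th by blast
  show "Re s > 1 \<Longrightarrow> (\<lambda>m. b m * complex_of_real (real m + \<alpha>) powr (-s)) sums periodic_hurwitz_zeta \<alpha> b s"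
    using th by blast
  obtain Z where "Z nicely_meromorphic_on UNIV" "Z analytic_on -{1}"
     "\<forall>s. Re s > 1 \<longrightarrow> (\<lambda>m. b m * complex_of_real (real m + \<alpha>) powr (-s)) sums Z s"
    using periodic_hurwitz_zeta_ex[OF assms] by blast
  thus "periodic_hurwitz_zeta \<alpha> b analytic_on -{1}"
    using th periodic_hurwitz_zeta_ex1[OF assms] by metis
qed


subsection \<open>The class \<open>S_tilde\<close>\<close>

text \<open>
  The abscissa \<open>\<sigma>0\<close> (that is, \<open>\<sigma>\<^sub>\<phi>\<close>) is a parameter, since it is the half-plane \<open>Re s > \<sigma>0\<close>
  on which the total function \<open>\<phi>\<close> represents the continued Dirichlet series; its values elsewhere
  are irrelevant. The filter \<open>at_infinity\<close> on the reals is \<open>\<bar>t\<bar> \<rightarrow> \<infinity>\<close>.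
\<close>

definition S_tilde :: "real \<Rightarrow> (complex \<Rightarrow> complex) set" where
  "S_tilde \<sigma>0 = {\<phi>. \<sigma>0 < 1 \<and> \<phi> nicely_meromorphic_on {s. Re s > \<sigma>0} \<and>
     (\<exists>a :: nat \<Rightarrow> complex.
        (\<forall>\<epsilon>>0. (\<lambda>m. norm (a m)) \<in> O(\<lambda>m. real m powr \<epsilon>)) \<and>
        (\<forall>s. Re s > 1 \<longrightarrow> (\<lambda>m. a (Suc m) * of_nat (Suc m) powr (-s)) sums \<phi> s) \<and>
        (\<exists>\<kappa>>0. ((\<lambda>x::real. (\<Sum>p | prime p \<and> real p \<le> x. (norm (a p))\<^sup>2)
                  / real (card {p::nat. prime p \<and> real p \<le> x})) \<longlongrightarrow> \<kappa>) at_top)) \<and>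
     (\<exists>c\<ge>0. \<forall>\<sigma>>\<sigma>0. \<forall>\<epsilon>>0.
        (\<lambda>t. norm (\<phi> (Complex \<sigma> t))) \<in> O[at_infinity](\<lambda>t. \<bar>t\<bar> powr (c + \<epsilon>))) \<and>
     (\<exists>l\<ge>1. \<exists>A :: nat \<Rightarrow> nat \<Rightarrow> complex. \<forall>s. Re s > 1 \<longrightarrow>
        (\<lambda>p. if prime p then \<Prod>j=1..l. inverse (1 - A j p * of_nat p powr (-s)) else 1) has_prod \<phi> s)}"


subsection \<open>Vectors of derivatives\<close>

text \<open>
  The space \<open>\<complex>\<^sup>d\<close> is the set of extensional functions on \<open>{..<d}\<close> with the product topology.
\<close>

abbreviation complex_space :: "nat \<Rightarrow> (nat \<Rightarrow> complex) topology" where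
  "complex_space d \<equiv> product_topology (\<lambda>_. euclidean) {..<d}"

definition joint_derivs ::
    "nat \<Rightarrow> (complex \<Rightarrow> complex) \<Rightarrow> (complex \<Rightarrow> complex) \<Rightarrow> complex \<Rightarrow> nat \<Rightarrow> complex" where
  "joint_derivs N f g s =
     (\<lambda>i\<in>{..<2*N}. if i < N then (deriv ^^ i) f s else (deriv ^^ (i - N)) g s)"

end

theory Submission
  imports Defs
    "HOL-Computational_Algebra.Fundamental_Theorem_Algebra"
    "HOL-Analysis.Kronecker_Approximation_Theorem"
    "HOL-Number_Theory.Prime_Powers"
begin

text \<open>
  It suffices to find, for each \<open>x \<in> \<complex>\<^sup>2\<^sup>N\<close> with \<open>x 0 \<noteq> 0\<close>, points \<open>s\<close> with \<open>1 < Re s \<le> 2\<close> and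
  \<open>Im s \<rightarrow> \<infinity>\<close> along which the vectors of derivatives tend to \<open>x\<close>: dividing the relation by \<open>s\<^sup>n\<close> gives
  \<open>F n x = 0\<close>, and one descends on \<open>n\<close>. The critical strip, and with it the continuation of \<open>\<phi>\<close> and its
  growth, can be avoided, because near \<open>Re s = 1\<close> from the right the absolutely convergent series
  come arbitrarily close to every vector of values.

  In this half-plane \<open>\<phi> = exp L\<close>, where \<open>L\<close> is a Dirichlet series over prime powers, so it suffices to
  prescribe the derivatives of \<open>L\<close> and of the periodic Hurwitz zeta-function approximately. As \<open>\<alpha>\<close> is
  transcendental, the numbers \<open>ln p\<close> and \<open>ln (m + \<alpha>)\<close> are independent over the integers, and Kronecker's
  theorem lets \<open>t\<close> realise arbitrary phases of the terms \<open>p\<^sup>-\<^sup>i\<^sup>t\<close> and \<open>(m + \<alpha>)\<^sup>-\<^sup>i\<^sup>t\<close>. For free phases,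
  the terms being square summable, a least squares argument reduces the attainability of a given vector to
  the divergence, for each nonzero polynomial \<open>P\<close>, of
  \<open>\<Sum>\<^sub>p \<bar>a(p)\<bar> \<bar>P(ln p)\<bar> / p\<close> and \<open>\<Sum>\<^sub>m \<bar>b\<^sub>m\<bar> \<bar>P(ln (m + \<alpha>))\<bar> / (m + \<alpha>)\<close>. The former
  follows from the mean value hypothesis on \<open>\<bar>a(p)\<bar>\<^sup>2\<close> and the divergence of \<open>\<Sum>\<^sub>p 1 / p\<close>, since comparing the
  Euler product with the Dirichlet series shows \<open>\<bar>a\<^sub>j(p)\<bar> \<le> 1\<close> and \<open>a(p) = \<Sum>\<^sub>j a\<^sub>j(p)\<close>.
\<close>

subsection \<open>Sums with free phases\<close>

text \<open>Both series have to be steered at one common point \<open>Complex \<sigma> t\<close>,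
  and this dictates how the choices depend on each other. The cut-off \<open>M\<close>, beyond which
  all error terms are small for every \<open>\<sigma> \<ge> 1\<close>, determines how long a block
  of free phases must be to reach every bounded target; the block determines how near to 1
  \<open>\<sigma>\<close> must be for it to lose at most half of its weight; the truncation
  \<open>Y\<close> depends on \<open>\<sigma>\<close>, and \<open>t\<close> on all of these. Hence
  the approximation statements are uniform in \<open>\<sigma>\<close> near 1 and in all large
  \<open>Y\<close>. The series \<open>L\<close> has terms at proper prime powers, whose phases are
  dictated by those at the primes. They converge absolutely at \<open>\<sigma> = 1\<close>, so only
  finitely many matter; these are pinned near phase 1 together with the small primes, and the block
  absorbs the shift of the target. The Euler product converges only in the order of the primes, and
  its roots come without any bound. A crude polynomial bound is extracted so that everything
  converges absolutely at large integers, where coefficients can be compared. An exponential has no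
  zeros, so vectors with \<open>x 0 = 0\<close> are reached through continuity of the
  \<open>F j\<close>.\<close>

lemma compact_Pi_UNIV:
  fixes S :: "nat \<Rightarrow> complex set"
  assumes "\<And>i. compact (S i)"
  shows "compact (PiE UNIV S)"
proof -
  have "compactin (product_topology (\<lambda>i. euclidean) UNIV) (PiE UNIV S)"
    unfolding compactin_PiE using assms by (auto simp: compactin_euclidean_iff)
  thus ?thesis by (simp add: euclidean_product_topology compactin_euclidean_iff)
qed

lemma sum_norm_square_add_mult:
  fixes r v :: "nat \<Rightarrow> complex" and d :: complex
  shows "(\<Sum>k<N. (norm (r k + d * v k))\<^sup>2) = (\<Sum>k<N. (norm (r k))\<^sup>2) + 2 * Re (d * (\<Sum>k<N. v k * cnj (r k)))
            + (norm d)\<^sup>2 * (\<Sum>k<N. (norm (v k))\<^sup>2)"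
proof -
  have "(norm (r k + d * v k))\<^sup>2 = (norm (r k))\<^sup>2 + 2 * Re (d * (v k * cnj (r k))) + (norm d)\<^sup>2 * (norm (v k))\<^sup>2" for k
  proof -
    have "complex_of_real ((norm (r k + d * v k))\<^sup>2) = (r k + d * v k) * cnj (r k + d * v k)"
      by (rule complex_norm_square)
    hence "(norm (r k + d * v k))\<^sup>2 = Re ((r k + d * v k) * cnj (r k + d * v k))"
      by (metis Re_complex_of_real)
    thus ?thesis
      by (simp only: cmod_power2) (simp add: power2_eq_square algebra_simps)
  qed
  hence "(\<Sum>k<N. (norm (r k + d * v k))\<^sup>2) = (\<Sum>k<N. (norm (r k))\<^sup>2) + (\<Sum>k<N. 2 * Re (d * (v k * cnj (r k)))) + (\<Sum>k<N. (norm d)\<^sup>2 * (norm (v k))\<^sup>2)"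
    by (simp only: sum.distrib)
  also have "(\<Sum>k<N. 2 * Re (d * (v k * cnj (r k)))) = 2 * Re (d * (\<Sum>k<N. v k * cnj (r k)))"
    by (simp only: sum_distrib_left Re_sum)
  finally show ?thesis by (simp only: sum_distrib_left)
qed

text \<open>A minimiser of the residual over the torus admits no first-order improvement.\<close>

lemma unimodular_combination:
  fixes v :: "nat \<Rightarrow> nat \<Rightarrow> complex" and z :: "nat \<Rightarrow> complex"
  assumes J: "finite J"
  assumes dual: "\<And>y. (\<Sum>k<N. norm (z k) * norm (y k)) \<le> (\<Sum>n\<in>J. norm (\<Sum>k<N. v n k * y k))"
  obtains \<psi> :: "nat \<Rightarrow> complex" where "\<And>n. norm (\<psi> n) = 1"
    "(\<Sum>k<N. (norm (z k - (\<Sum>n\<in>J. \<psi> n * v n k)))\<^sup>2) \<le> 2 * (\<Sum>n\<in>J. \<Sum>k<N. (norm (v n k))\<^sup>2)"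
proof -
  \<comment> \<open>Phases are indexed by all of \<open>nat\<close>, which makes the torus a compact
    product; coordinates outside \<open>J\<close> do not enter \<open>f\<close>.\<close>
  define T :: "(nat \<Rightarrow> complex) set" where "T = PiE UNIV (\<lambda>_. sphere 0 1)"
  define f :: "(nat \<Rightarrow> complex) \<Rightarrow> real"
    where "f = (\<lambda>\<psi>. \<Sum>k<N. (norm (z k - (\<Sum>n\<in>J. \<psi> n * v n k)))\<^sup>2)"
  have "compact T" unfolding T_def by (intro compact_Pi_UNIV compact_sphere)
  moreover have "(\<lambda>_. 1) \<in> T" by (auto simp: T_def)
  moreover have "continuous_on T f"
    unfolding f_def by (intro continuous_intros continuous_on_subset[OF continuous_on_product_coordinates]) auto
  ultimately obtain \<psi> where \<psi>: "\<psi> \<in> T" "\<And>\<psi>'. \<psi>' \<in> T \<Longrightarrow> f \<psi> \<le> f \<psi>'"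
    using continuous_attains_inf[of T f] by blast
  have n\<psi>: "norm (\<psi> n) = 1" for n using \<psi>(1) by (auto simp: T_def)
  define r where "r = (\<lambda>k. z k - (\<Sum>n\<in>J. \<psi> n * v n k))"
  define q where "q = (\<lambda>n. \<Sum>k<N. v n k * cnj (r k))"
  define V where "V = (\<lambda>n. \<Sum>k<N. (norm (v n k))\<^sup>2)"
  have V0: "V n \<ge> 0" for n unfolding V_def by (intro sum_nonneg) auto
  \<comment> \<open>Turning the single phase \<open>\<psi> n\<close> into the \<open>u\<close> for
    which \<open>u * q n\<close> is real and nonnegative cannot lower \<open>f\<close>. The linear
    gain is \<open>2 * (norm (q n) - Re (\<psi> n * q n))\<close>; the quadratic cost is at most
    \<open>4 * V n\<close>, because two unimodular numbers differ by at most 2.\<close>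
  have key: "norm (q n) - Re (\<psi> n * q n) \<le> 2 * V n" if n: "n \<in> J" for n
  proof -
    define u where "u = (if q n = 0 then 1 else cnj (sgn (q n)))"
    have "cnj (sgn (q n)) * q n = of_real (norm (q n))" if "q n \<noteq> 0"
    proof -
      have "cnj (sgn (q n)) * q n = of_real ((norm (q n))\<^sup>2) / of_real (norm (q n))"
        unfolding complex_norm_square by (simp add: sgn_eq)
      thus ?thesis using that by (simp add: power2_eq_square)
    qed
    hence u: "norm u = 1" "u * q n = of_real (norm (q n))"
      by (auto simp: u_def norm_sgn)
    define \<psi>' where "\<psi>' = \<psi>(n := u)"
    have "\<psi>' \<in> T" using \<psi>(1) u(1) by (auto simp: T_def \<psi>'_def)
    hence le: "f \<psi> \<le> f \<psi>'" by (rule \<psi>(2))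
    have "z k - (\<Sum>m\<in>J. \<psi>' m * v m k) = r k + (\<psi> n - u) * v n k" for k
    proof -
      have "(\<Sum>m\<in>J. \<psi>' m * v m k) = u * v n k + (\<Sum>m\<in>J-{n}. \<psi> m * v m k)"
        using J n by (subst sum.remove[of J n]) (auto simp: \<psi>'_def intro!: sum.cong)
      moreover have "(\<Sum>m\<in>J. \<psi> m * v m k) = \<psi> n * v n k + (\<Sum>m\<in>J-{n}. \<psi> m * v m k)"
        using J n by (subst sum.remove[of J n]) auto
      ultimately show ?thesis by (simp add: r_def algebra_simps)
    qed
    hence "f \<psi>' = (\<Sum>k<N. (norm (r k + (\<psi> n - u) * v n k))\<^sup>2)"
      by (simp only: f_def)
    also have "\<dots> = (\<Sum>k<N. (norm (r k))\<^sup>2) + 2 * Re ((\<psi> n - u) * q n) + (norm (\<psi> n - u))\<^sup>2 * V n"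
      unfolding q_def V_def by (rule sum_norm_square_add_mult)
    also have "(\<Sum>k<N. (norm (r k))\<^sup>2) = f \<psi>" by (simp only: f_def r_def)
    finally have "f \<psi>' = f \<psi> + 2 * Re ((\<psi> n - u) * q n) + (norm (\<psi> n - u))\<^sup>2 * V n" .
    moreover have "(norm (\<psi> n - u))\<^sup>2 \<le> 2\<^sup>2"
      using norm_triangle_ineq4[of "\<psi> n" u] u n\<psi>[of n] by (intro power_mono) auto
    hence "(norm (\<psi> n - u))\<^sup>2 * V n \<le> 4 * V n" using V0 by (intro mult_right_mono) auto
    moreover have "Re ((\<psi> n - u) * q n) = Re (\<psi> n * q n) - norm (q n)"
      using u(2) by (simp add: left_diff_distrib)
    ultimately show ?thesis using le by simp
  qed
  \<comment> \<open>The residual is paired with itself. Taking \<open>y = cnj r\<close> in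
    \<open>dual\<close> bounds the pairing with \<open>z\<close> by the sum of the
    \<open>norm (q n)\<close>, so \<open>f \<psi>\<close> is at most the sum of the defects
    estimated in \<open>key\<close>.\<close>
  have "complex_of_real (f \<psi>) = (\<Sum>k<N. r k * cnj (r k))"
    unfolding f_def r_def by (simp only: of_real_sum complex_norm_square)
  also have "\<dots> = (\<Sum>k<N. z k * cnj (r k)) - (\<Sum>k<N. (\<Sum>n\<in>J. \<psi> n * v n k) * cnj (r k))"
    by (subst r_def) (simp add: left_diff_distrib sum_subtractf)
  also have "(\<Sum>k<N. (\<Sum>n\<in>J. \<psi> n * v n k) * cnj (r k)) = (\<Sum>n\<in>J. \<psi> n * q n)"
    by (simp add: sum_distrib_right sum_distrib_left q_def mult_ac) (rule sum.swap)
  finally have eq: "complex_of_real (f \<psi>) = (\<Sum>k<N. z k * cnj (r k)) - (\<Sum>n\<in>J. \<psi> n * q n)" .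
  have "f \<psi> = Re (complex_of_real (f \<psi>))" by simp
  also have "\<dots> = Re (\<Sum>k<N. z k * cnj (r k)) - (\<Sum>n\<in>J. Re (\<psi> n * q n))"
    unfolding eq by simp
  also have "Re (\<Sum>k<N. z k * cnj (r k)) \<le> (\<Sum>k<N. norm (z k) * norm (r k))"
    by (rule order.trans[OF complex_Re_le_cmod], rule order.trans[OF norm_sum]) (simp add: norm_mult)
  also have "\<dots> \<le> (\<Sum>n\<in>J. norm (q n))"
    using dual[of "\<lambda>k. cnj (r k)"] by (simp add: q_def)
  also have "(\<Sum>n\<in>J. norm (q n)) - (\<Sum>n\<in>J. Re (\<psi> n * q n)) \<le> (\<Sum>n\<in>J. 2 * V n)"
    unfolding sum_subtractf[symmetric] by (intro sum_mono key)
  finally have "f \<psi> \<le> 2 * (\<Sum>n\<in>J. V n)" by (simp add: sum_distrib_left)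
  thus ?thesis using that[of \<psi>] n\<psi> by (simp add: f_def V_def)
qed

text \<open>A power of \<open>x n\<close> costs an arbitrarily small part \<open>\<eta>\<close> of
  the exponent, since \<open>(\<eta> * x n) ^ j\<close> is eventually below
  \<open>exp (\<eta> * x n)\<close>; the factor \<open>(1 / \<eta>) ^ j\<close> undoes the
  rescaling.\<close>

lemma eventually_power_exp_le:
  fixes x :: "nat \<Rightarrow> real"
  assumes lim: "filterlim x at_top sequentially" and \<eta>: "\<eta> > 0"
  shows "eventually (\<lambda>n. \<bar>x n\<bar> ^ j * exp (- \<sigma> * x n) \<le> (1 / \<eta>) ^ j * exp (- (\<sigma> - \<eta>) * x n)) sequentially"
proof -
  have "filterlim (\<lambda>n. \<eta> * x n) at_top sequentially"
    using \<eta> lim by (intro filterlim_tendsto_pos_mult_at_top[OF tendsto_const]) auto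
  from filterlim_compose[OF tendsto_power_div_exp_0[of j] this]
  have "(\<lambda>n. (\<eta> * x n) ^ j / exp (\<eta> * x n)) \<longlonglongrightarrow> 0" .
  hence "eventually (\<lambda>n. (\<eta> * x n) ^ j / exp (\<eta> * x n) < 1) sequentially"
    by (rule order_tendstoD) simp
  moreover have "eventually (\<lambda>n. x n \<ge> 0) sequentially"
    using lim by (auto simp: filterlim_at_top)
  ultimately show ?thesis
  proof eventually_elim
    case (elim n)
    have "x n ^ j \<le> (1 / \<eta>) ^ j * exp (\<eta> * x n)"
      using elim \<eta> by (simp add: field_simps power_mult_distrib)
    hence "x n ^ j * exp (- \<sigma> * x n) \<le> (1 / \<eta>) ^ j * exp (\<eta> * x n) * exp (- \<sigma> * x n)"
      by (intro mult_right_mono) auto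
    thus ?case using elim by (simp add: mult.assoc flip: exp_add) (simp add: algebra_simps)
  qed
qed

lemma summable_power_exp:
  fixes x :: "nat \<Rightarrow> real"
  assumes lim: "filterlim x at_top sequentially"
  assumes summ: "\<And>\<sigma>. \<sigma> > 1 \<Longrightarrow> summable (\<lambda>n. exp (- \<sigma> * x n))"
  assumes "\<sigma> > 1"
  shows "summable (\<lambda>n. \<bar>x n\<bar> ^ j * exp (- \<sigma> * x n))"
proof (rule summable_comparison_test_ev)
  define \<eta> where "\<eta> = (\<sigma> - 1) / 2"
  have \<eta>: "\<eta> > 0" "\<sigma> - \<eta> > 1" using assms by (auto simp: \<eta>_def field_simps)
  show "summable (\<lambda>n. (1 / \<eta>) ^ j * exp (- (\<sigma> - \<eta>) * x n))"
    using \<eta> by (intro summable_mult summ)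
  show "eventually (\<lambda>n. norm (\<bar>x n\<bar> ^ j * exp (- \<sigma> * x n)) \<le> (1 / \<eta>) ^ j * exp (- (\<sigma> - \<eta>) * x n)) sequentially"
    using eventually_power_exp_le[OF lim \<eta>(1), of j \<sigma>] by simp
qed

text \<open>A nonzero polynomial is constant or tends to infinity in absolute value. This carries
  the divergence of a plain series over to the series weighted by the polynomial.\<close>

lemma polynomial_eventually_bounded_below:
  fixes y :: "nat \<Rightarrow> complex"
  assumes "k < N" "y k \<noteq> 0"
  shows "\<exists>c>0. \<exists>X. \<forall>x\<ge>X. c \<le> norm (\<Sum>k<N. y k * of_real (- x) ^ k)"
proof -
  define p where "p = (\<Sum>k<N. monom (y k) k)"
  have pz: "poly p z = (\<Sum>k<N. y k * z ^ k)" for z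
    by (simp add: p_def poly_sum poly_monom)
  have "coeff p k = y k"
    using assms by (simp add: p_def coeff_sum coeff_monom if_distrib cong: if_cong)
  hence p0: "p \<noteq> 0" using assms by auto
  obtain a q where p: "p = pCons a q" by (cases p)
  show ?thesis
  proof (cases "q = 0")
    case True
    hence "a \<noteq> 0" using p0 p by auto
    moreover have "norm (\<Sum>k<N. y k * of_real (- x) ^ k) = norm a" for x :: real
      using pz[of "of_real (- x)"] True p by simp
    ultimately show ?thesis by (intro exI[of _ "norm a"]) auto
  next
    case False
    then obtain r where r: "\<And>z. r \<le> norm z \<Longrightarrow> 1 \<le> norm (poly p z)"
      using poly_infinity[of q 1 a] p by auto
    have "1 \<le> norm (\<Sum>k<N. y k * of_real (- x) ^ k)" if "x \<ge> r" for x :: real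
      using r[of "of_real (- x)"] that pz[of "of_real (- x)"] by simp
    thus ?thesis by (intro exI[of _ 1]) auto
  qed
qed

lemma unbounded_tail_sums:
  fixes f :: "nat \<Rightarrow> real"
  assumes "\<And>n. f n \<ge> 0" "\<not> summable f"
  shows "\<exists>m. (\<Sum>n=M..<m. f n) > B"
proof (rule ccontr)
  assume "\<not> ?thesis"
  hence le: "(\<Sum>n=M..<m. f n) \<le> B" for m by (simp add: not_less)
  have "summable f"
  proof (rule bounded_imp_summable)
    show "(\<Sum>k\<le>n. f k) \<le> (\<Sum>k<M. f k) + B" for n
    proof -
      have "(\<Sum>k\<le>n. f k) \<le> (\<Sum>k\<in>{..<M} \<union> {M..<Suc n}. f k)"
        by (rule sum_mono2) (auto intro: assms)
      also have "\<dots> = (\<Sum>k<M. f k) + (\<Sum>n=M..<Suc n. f n)"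
        by (rule sum.union_disjoint) auto
      finally show ?thesis using le[of "Suc n"] by linarith
    qed
  qed (rule assms)
  thus False using assms by blast
qed

text \<open>For each single \<open>y\<close> of norm 1 the weighted series diverges, so its partial
  sums pass \<open>R\<close>. The sets where they have done so are open and grow with the endpoint,
  hence by compactness one \<open>M'\<close> serves all \<open>y\<close> of norm 1, and homogeneity
  gives the rest.\<close>

lemma uniform_divergence:
  fixes w :: "nat \<Rightarrow> complex" and x :: "nat \<Rightarrow> real"
  assumes lim: "filterlim x at_top sequentially"
  assumes div: "\<not> summable (\<lambda>n. norm (w n) * exp (- x n))"
  shows "\<exists>M'\<ge>M. \<forall>y :: nat \<Rightarrow> complex. R * (\<Sum>k<N. norm (y k)) \<le>
           (\<Sum>n=M..<M'. norm (w n) * exp (- x n) * norm (\<Sum>k<N. y k * of_real (- x n) ^ k))"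
proof -
  define G where "G = (\<lambda>m (y :: nat \<Rightarrow> complex). \<Sum>n=M..<m. norm (w n) * exp (- x n) * norm (\<Sum>k<N. y k * of_real (- x n) ^ k))"
  \<comment> \<open>Only the coordinates below \<open>N\<close> matter; the others are confined to
    the unit disc to keep \<open>K\<close> compact in the space of all sequences.\<close>
  define K :: "(nat \<Rightarrow> complex) set"
    where "K = PiE UNIV (\<lambda>_. cball 0 1) \<inter> {y. (\<Sum>k<N. norm (y k)) = 1}"
  have cont: "continuous_on UNIV (G m)" for m
  proof -
    have "continuous_on UNIV (\<lambda>y :: nat \<Rightarrow> complex. y k * c)" for k c
      by (rule continuous_on_mult[OF continuous_on_product_coordinates continuous_on_const])
    thus ?thesis unfolding G_def
      by (intro continuous_on_sum continuous_on_mult_left continuous_on_norm)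
  qed
  have "closed {y :: nat \<Rightarrow> complex. (\<Sum>k<N. norm (y k)) = 1}"
    by (intro closed_Collect_eq continuous_on_sum continuous_on_norm continuous_on_product_coordinates continuous_on_const)
  hence "compact K"
    unfolding K_def by (intro compact_Int_closed compact_Pi_UNIV) auto
  moreover have "K \<subseteq> (\<Union>m\<in>{M..}. {y. G m y > R})"
  proof
    fix y assume y: "y \<in> K"
    then obtain k where k: "k < N" "y k \<noteq> 0"
      by (auto simp: K_def) (metis (no_types, lifting) lessThan_iff norm_zero sum.neutral zero_neq_one)
    obtain c X where cX: "c > 0" "\<And>x. x \<ge> X \<Longrightarrow> c \<le> norm (\<Sum>k<N. y k * of_real (- x) ^ k)"
      using polynomial_eventually_bounded_below[of k N y] k by blast
    have "\<not> summable (\<lambda>n. norm (w n) * exp (- x n) * norm (\<Sum>k<N. y k * of_real (- x n) ^ k))" (is "\<not> summable ?g")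
    proof
      assume "summable ?g"
      hence sm: "summable (\<lambda>n. inverse c * ?g n)" by (rule summable_mult)
      have "eventually (\<lambda>n. x n \<ge> X) sequentially"
        using lim by (auto simp: filterlim_at_top)
      hence "eventually (\<lambda>n. norm (norm (w n) * exp (- x n)) \<le> inverse c * ?g n) sequentially"
      proof eventually_elim
        case (elim n)
        have "norm (w n) * exp (- x n) * c \<le> ?g n"
          using cX elim by (intro mult_left_mono) auto
        thus ?case using cX(1) by (simp add: field_simps)
      qed
      from summable_comparison_test_ev[OF this sm] show False using div by blast
    qed
    from unbounded_tail_sums[OF _ this, of R M] obtain m where "G m y > R"
      by (auto simp: G_def)
    moreover have "G m y \<le> G (max m M) y"
      unfolding G_def by (rule sum_mono2) auto
    ultimately show "y \<in> (\<Union>m\<in>{M..}. {y. G m y > R})"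
      by (auto intro!: bexI[of _ "max m M"])
  qed
  moreover have "open {y. G m y > R}" for m
    by (intro open_Collect_less continuous_on_const cont)
  ultimately obtain C where C: "C \<subseteq> {M..}" "finite C" "K \<subseteq> (\<Union>m\<in>C. {y. G m y > R})"
    by (meson compactE_image)
  define M' where "M' = Max (insert M C)"
  have M': "M' \<ge> M" unfolding M'_def using C by auto
  have GK: "G M' y \<ge> R" if "y \<in> K" for y
  proof -
    have "y \<in> (\<Union>m\<in>C. {y. G m y > R})" using C(3) that by (rule subsetD)
    then obtain m where m: "m \<in> C" "G m y > R" by blast
    have "m \<le> M'" unfolding M'_def using C m by auto
    hence "G m y \<le> G M' y" unfolding G_def by (intro sum_mono2) auto
    thus ?thesis using m by simp
  qed
  have "R * (\<Sum>k<N. norm (y k)) \<le> G M' y" for y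
  proof (cases "(\<Sum>k<N. norm (y k)) = 0")
    case True
    have "G M' y \<ge> 0" unfolding G_def by (intro sum_nonneg) auto
    thus ?thesis using True by simp
  next
    case False
    define S where "S = (\<Sum>k<N. norm (y k))"
    have S: "S > 0" using False unfolding S_def
      by (metis less_eq_real_def norm_ge_zero sum_nonneg)
    define y' where "y' = (\<lambda>k. if k < N then y k / of_real S else 0)"
    have "(\<Sum>k<N. norm (y' k)) = 1"
      using S by (simp add: y'_def norm_divide flip: sum_divide_distrib) (simp add: S_def)
    moreover from this have "norm (y' k) \<le> 1" for k
      using member_le_sum[of k "{..<N}" "\<lambda>k. norm (y' k)"] by (cases "k < N") (auto simp: y'_def)
    ultimately have "y' \<in> K" by (auto simp: K_def)
    hence "R \<le> G M' y'" by (rule GK)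
    also have "G M' y' = G M' y / S"
    proof -
      have "(\<Sum>k<N. y' k * of_real (- x n) ^ k) = (\<Sum>k<N. y k * of_real (- x n) ^ k) / of_real S" for n
        by (simp add: y'_def sum_divide_distrib)
      hence "norm (\<Sum>k<N. y' k * of_real (- x n) ^ k) = norm (\<Sum>k<N. y k * of_real (- x n) ^ k) / S" for n
        using S by (simp only: norm_divide norm_of_real abs_of_pos)
      thus ?thesis by (simp only: G_def sum_divide_distrib times_divide_eq_right)
    qed
    finally show ?thesis using S by (simp add: S_def field_simps)
  qed
  thus ?thesis using M' unfolding G_def by blast
qed

text \<open>This is \<open>unimodular_combination\<close> for the block from \<open>M\<close> to
  \<open>M''\<close>. Its error is a tail of a series of squares, small for
  \<open>M \<ge> M0\<close> whatever \<open>\<sigma> \<ge> 1\<close> is; its hypothesis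
  \<open>dual\<close> comes from divergence along \<open>M..<M'\<close>, and further terms only
  enlarge the right-hand side. Therefore \<open>M'\<close> and \<open>\<delta>\<close> depend on
  \<open>R\<close> but not on the target.\<close>

lemma twisted_sums_dense:
  fixes w :: "nat \<Rightarrow> complex" and x :: "nat \<Rightarrow> real"
  assumes B: "\<And>n. norm (w n) \<le> B"
  assumes lim: "filterlim x at_top sequentially"
  assumes summ: "\<And>\<sigma>. \<sigma> > 1 \<Longrightarrow> summable (\<lambda>n. exp (- \<sigma> * x n))"
  assumes div: "\<not> summable (\<lambda>n. norm (w n) * exp (- x n))"
  assumes \<epsilon>: "\<epsilon> > 0"
  shows "\<exists>M0. \<forall>M\<ge>M0. \<forall>R. \<exists>M' \<delta>. \<delta> > 0 \<and> (\<forall>\<sigma> M'' z. 1 \<le> \<sigma> \<longrightarrow> \<sigma> \<le> 1 + \<delta> \<longrightarrow> M' \<le> M'' \<longrightarrow>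
           (\<forall>k<N. norm (z k) \<le> R) \<longrightarrow> (\<exists>\<psi>. (\<forall>n. norm (\<psi> n) = 1) \<and>
             (\<forall>k<N. norm (z k - (\<Sum>n=M..<M''. \<psi> n * (w n * of_real (- x n) ^ k * of_real (exp (- \<sigma> * x n))))) \<le> \<epsilon>)))"
proof -
  have B0: "B \<ge> 0" using B[of 0] norm_ge_zero order.trans by blast
  define V where "V = (\<lambda>n. \<Sum>k<N. B\<^sup>2 * (\<bar>x n\<bar> ^ (2 * k) * exp (- 2 * x n)))"
  have V0: "V n \<ge> 0" for n unfolding V_def by (intro sum_nonneg) auto
  have "summable V"
    unfolding V_def by (intro summable_sum summable_mult summable_power_exp lim summ) auto
  then obtain M1 where M1: "\<And>m n. m \<ge> M1 \<Longrightarrow> norm (\<Sum>i=m..<n. V i) < \<epsilon>\<^sup>2 / 2"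
    unfolding summable_Cauchy using \<epsilon> by (meson half_gt_zero zero_less_power)
  have "eventually (\<lambda>n. x n \<ge> 0) sequentially"
    using lim by (auto simp: filterlim_at_top)
  then obtain M2 where M2: "\<And>n. n \<ge> M2 \<Longrightarrow> x n \<ge> 0" by (auto simp: eventually_at_top_linorder)
  show ?thesis
  proof (rule exI[of _ "max M1 M2"], intro allI impI)
    fix M R assume M: "M \<ge> max M1 M2"
    \<comment> \<open>The factor 2 compensates the half of the weight that may be lost when
      \<open>\<sigma>\<close> exceeds 1.\<close>
    obtain M' where M': "M' \<ge> M" "\<And>y :: nat \<Rightarrow> complex. (2 * R) * (\<Sum>k<N. norm (y k)) \<le>
           (\<Sum>n=M..<M'. norm (w n) * exp (- x n) * norm (\<Sum>k<N. y k * of_real (- x n) ^ k))"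
      using uniform_divergence[OF lim div, of M "2 * R"] by blast
    define X where "X = (\<Sum>n<M'. \<bar>x n\<bar>)"
    have X0: "X \<ge> 0" unfolding X_def by (intro sum_nonneg) auto
    \<comment> \<open>For \<open>\<sigma> \<le> 1 + \<delta>\<close> this gives
      \<open>(\<sigma> - 1) * x n \<le> ln 2\<close> on the block up to \<open>M'\<close>, that is,
      a loss of at most one half; the added 1 avoids division by zero.\<close>
    define \<delta> where "\<delta> = ln 2 / (1 + X)"
    have \<delta>: "\<delta> > 0" using X0 by (simp add: \<delta>_def)
    show "\<exists>M' \<delta>. \<delta> > 0 \<and> (\<forall>\<sigma> M'' z. 1 \<le> \<sigma> \<longrightarrow> \<sigma> \<le> 1 + \<delta> \<longrightarrow> M' \<le> M'' \<longrightarrow>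
           (\<forall>k<N. norm (z k) \<le> R) \<longrightarrow> (\<exists>\<psi>. (\<forall>n. norm (\<psi> n) = 1) \<and>
             (\<forall>k<N. norm (z k - (\<Sum>n=M..<M''. \<psi> n * (w n * of_real (- x n) ^ k * of_real (exp (- \<sigma> * x n))))) \<le> \<epsilon>)))"
    proof (intro exI[of _ M'] exI[of _ \<delta>] conjI allI impI \<delta>)
      fix \<sigma> M'' and z :: "nat \<Rightarrow> complex"
      assume \<sigma>: "1 \<le> \<sigma>" "\<sigma> \<le> 1 + \<delta>" and M'': "M' \<le> M''" and z: "\<forall>k<N. norm (z k) \<le> R"
      define v where "v = (\<lambda>n k. w n * of_real (- x n) ^ k * complex_of_real (exp (- \<sigma> * x n)))"
      have half: "exp (- x n) / 2 \<le> exp (- \<sigma> * x n)" if n: "n \<in> {M..<M'}" for n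
      proof -
        have "x n \<le> X" unfolding X_def using n
          by (rule_tac order.trans[OF abs_ge_self member_le_sum[of n _ "\<lambda>n. \<bar>x n\<bar>"]]) auto
        hence "(\<sigma> - 1) * x n \<le> \<delta> * (1 + X)"
          using \<sigma> X0 M2[of n] n M by (intro mult_mono) auto
        also have "\<dots> = ln 2" using X0 by (simp add: \<delta>_def)
        finally have "exp (- ln 2) * exp (- x n) \<le> exp (- \<sigma> * x n)"
          unfolding exp_add[symmetric] by (simp add: algebra_simps)
        thus ?thesis by (simp add: exp_minus)
      qed
      have dual: "(\<Sum>k<N. norm (z k) * norm (y k)) \<le> (\<Sum>n\<in>{M..<M''}. norm (\<Sum>k<N. v n k * y k))" for y
      proof -
        have "(\<Sum>k<N. norm (z k) * norm (y k)) \<le> (\<Sum>k<N. R * norm (y k))"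
          using z by (intro sum_mono mult_right_mono) auto
        also have "\<dots> = (2 * R) * (\<Sum>k<N. norm (y k)) / 2" by (simp flip: sum_distrib_left)
        also have "\<dots> \<le> (\<Sum>n=M..<M'. norm (w n) * exp (- x n) * norm (\<Sum>k<N. y k * of_real (- x n) ^ k)) / 2"
          by (intro divide_right_mono M'(2)) auto
        also have "\<dots> = (\<Sum>n=M..<M'. norm (w n) * (exp (- x n) / 2) * norm (\<Sum>k<N. y k * of_real (- x n) ^ k))"
          by (simp add: sum_divide_distrib)
        also have "\<dots> \<le> (\<Sum>n=M..<M'. norm (w n) * exp (- \<sigma> * x n) * norm (\<Sum>k<N. y k * of_real (- x n) ^ k))"
          by (intro sum_mono mult_right_mono mult_left_mono half) auto
        also have "\<dots> = (\<Sum>n=M..<M'. norm (\<Sum>k<N. v n k * y k))"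
        proof (intro sum.cong refl)
          fix n
          have "(\<Sum>k<N. v n k * y k) = w n * of_real (exp (- \<sigma> * x n)) * (\<Sum>k<N. y k * of_real (- x n) ^ k)"
            by (simp add: v_def sum_distrib_left mult_ac)
          thus "norm (w n) * exp (- \<sigma> * x n) * norm (\<Sum>k<N. y k * of_real (- x n) ^ k) = norm (\<Sum>k<N. v n k * y k)"
            by (simp only: norm_mult norm_of_real abs_exp_cancel)
        qed
        also have "\<dots> \<le> (\<Sum>n\<in>{M..<M''}. norm (\<Sum>k<N. v n k * y k))"
          using M'' by (intro sum_mono2) auto
        finally show ?thesis .
      qed
      obtain \<psi> where \<psi>: "\<And>n. norm (\<psi> n) = 1"
        "(\<Sum>k<N. (norm (z k - (\<Sum>n\<in>{M..<M''}. \<psi> n * v n k)))\<^sup>2) \<le> 2 * (\<Sum>n\<in>{M..<M''}. \<Sum>k<N. (norm (v n k))\<^sup>2)"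
        using unimodular_combination[of "{M..<M''}" z N v] dual by auto
      have "(\<Sum>k<N. (norm (v n k))\<^sup>2) \<le> V n" if n: "n \<in> {M..<M''}" for n
        unfolding V_def
      proof (rule sum_mono)
        fix k
        have x: "x n \<ge> 0" using M2[of n] n M by auto
        have "(norm (v n k))\<^sup>2 = (norm (w n))\<^sup>2 * (\<bar>x n\<bar> ^ (2 * k) * exp (- 2 * (\<sigma> * x n)))"
          by (simp add: v_def norm_mult norm_power power_mult_distrib power2_eq_square mult_ac flip: exp_add power_add mult_2)
        also have "\<dots> \<le> B\<^sup>2 * (\<bar>x n\<bar> ^ (2 * k) * exp (- 2 * x n))"
          using x \<sigma> B[of n] B0 mult_right_mono[OF \<sigma>(1) x] by (intro mult_mono mult_left_mono power_mono) auto
        finally show "(norm (v n k))\<^sup>2 \<le> B\<^sup>2 * (\<bar>x n\<bar> ^ (2 * k) * exp (- 2 * x n))" .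
      qed
      hence "(\<Sum>n\<in>{M..<M''}. \<Sum>k<N. (norm (v n k))\<^sup>2) \<le> (\<Sum>n\<in>{M..<M''}. V n)"
        by (rule sum_mono)
      also have "\<dots> < \<epsilon>\<^sup>2 / 2" using M1[of M M''] M by simp
      finally have le: "(\<Sum>k<N. (norm (z k - (\<Sum>n\<in>{M..<M''}. \<psi> n * v n k)))\<^sup>2) \<le> \<epsilon>\<^sup>2" using \<psi>(2) by simp
      have "norm (z k - (\<Sum>n\<in>{M..<M''}. \<psi> n * v n k)) \<le> \<epsilon>" if "k < N" for k
      proof (rule power2_le_imp_le)
        have "(norm (z k - (\<Sum>n\<in>{M..<M''}. \<psi> n * v n k)))\<^sup>2 \<le> (\<Sum>k<N. (norm (z k - (\<Sum>n\<in>{M..<M''}. \<psi> n * v n k)))\<^sup>2)"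
          using that by (intro member_le_sum) auto
        thus "(norm (z k - (\<Sum>n\<in>{M..<M''}. \<psi> n * v n k)))\<^sup>2 \<le> \<epsilon>\<^sup>2" using le by simp
      qed (use \<epsilon> in auto)
      thus "\<exists>\<psi>. (\<forall>n. norm (\<psi> n) = 1) \<and>
             (\<forall>k<N. norm (z k - (\<Sum>n=M..<M''. \<psi> n * (w n * of_real (- x n) ^ k * of_real (exp (- \<sigma> * x n))))) \<le> \<epsilon>)"
        using \<psi>(1) unfolding v_def by blast
    qed
  qed
qed

subsection \<open>General Dirichlet series\<close>

text \<open>The termwise \<open>k\<close>-th derivative of the series with frequencies
  \<open>x\<close>. Having \<open>k\<close> as a parameter lets summability, truncation and
  approximation be treated for all derivatives at once. For \<open>x n = ln (real n)\<close> the
  index 0 has frequency \<open>ln 0 = 0\<close>, so it is harmless only because the coefficients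
  used there vanish at 0.\<close>

definition gen_dirichlet :: "(nat \<Rightarrow> complex) \<Rightarrow> (nat \<Rightarrow> real) \<Rightarrow> nat \<Rightarrow> complex \<Rightarrow> complex" where
  "gen_dirichlet c x k s = (\<Sum>n. c n * of_real (- x n) ^ k * exp (- of_real (x n) * s))"

lemma
  fixes c :: "nat \<Rightarrow> complex" and x :: "nat \<Rightarrow> real"
  assumes B: "\<And>n. norm (c n) \<le> B"
  assumes lim: "filterlim x at_top sequentially"
  assumes summ: "\<And>\<sigma>. \<sigma> > 1 \<Longrightarrow> summable (\<lambda>n. exp (- \<sigma> * x n))"
  assumes s: "Re s > 1"
  shows summable_gen_dirichlet: "summable (\<lambda>n. norm (c n * of_real (- x n) ^ k * exp (- of_real (x n) * s)))"
    and has_field_derivative_gen_dirichlet: "(gen_dirichlet c x k has_field_derivative gen_dirichlet c x (Suc k) s) (at s)"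
proof -
  have B0: "B \<ge> 0" using B[of 0] norm_ge_zero order.trans by blast
  define f where "f = (\<lambda>k n s. c n * of_real (- x n) ^ k * exp (- of_real (x n) * s))"
  have nf: "norm (f k n s) = norm (c n) * (\<bar>x n\<bar> ^ k * exp (- Re s * x n))" for k n s
    by (simp add: f_def norm_mult norm_power mult_ac)
  have sm: "summable (\<lambda>n. norm (f k n s))" if "Re s > 1" for k s
  proof (rule summable_comparison_test)
    show "summable (\<lambda>n. B * (\<bar>x n\<bar> ^ k * exp (- Re s * x n)))"
      by (intro summable_mult summable_power_exp lim summ that)
    show "\<exists>N. \<forall>n\<ge>N. norm (norm (f k n s)) \<le> B * (\<bar>x n\<bar> ^ k * exp (- Re s * x n))"
      unfolding nf by (auto intro!: mult_right_mono B)
  qed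
  from sm[OF s] show "summable (\<lambda>n. norm (c n * of_real (- x n) ^ k * exp (- of_real (x n) * s)))"
    by (simp add: f_def)
  define S where "S = {s. Re s > 1}"
  have S: "open S" unfolding S_def by (rule open_halfspace_Re_gt)
  have "\<exists>g g'. \<forall>s\<in>S. ((\<lambda>n. f k n s) sums g s) \<and> ((\<lambda>n. f (Suc k) n s) sums g' s) \<and> (g has_field_derivative g' s) (at s)"
  proof (rule series_and_derivative_comparison_complex[OF S])
    fix n s
    show "(f k n has_field_derivative f (Suc k) n s) (at s)"
      unfolding f_def by (auto intro!: derivative_eq_intros simp: mult_ac)
  next
    fix s assume "s \<in> S"
    hence s: "Re s > 1" by (simp add: S_def)
    define d where "d = (Re s - 1) / 2"
    have d: "d > 0" "Re s - d > 1" using s by (auto simp: d_def field_simps)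
    define h where "h = (\<lambda>n. complex_of_real (B * (\<bar>x n\<bar> ^ k * exp (- (Re s - d) * x n))))"
    show "\<exists>d (h :: nat \<Rightarrow> complex). 0 < d \<and> summable h \<and> range h \<subseteq> \<real>\<^sub>\<ge>\<^sub>0 \<and> (\<forall>\<^sub>F n in sequentially. \<forall>y\<in>ball s d \<inter> S. norm (f k n y) \<le> norm (h n))"
    proof -
      have 1: "summable h"
        unfolding h_def using d by (intro summable_of_real summable_mult summable_power_exp lim summ)
      have 2: "range h \<subseteq> \<real>\<^sub>\<ge>\<^sub>0" using B0 by (auto simp: h_def)
      have "eventually (\<lambda>n. x n \<ge> 0) sequentially"
        using lim by (auto simp: filterlim_at_top)
      hence 3: "\<forall>\<^sub>F n in sequentially. \<forall>y\<in>ball s d \<inter> S. norm (f k n y) \<le> norm (h n)"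
      proof eventually_elim
        case (elim n)
        show ?case
        proof
          fix y assume "y \<in> ball s d \<inter> S"
          hence "\<bar>Re (s - y)\<bar> < d" using abs_Re_le_cmod[of "s - y"] by (simp add: dist_norm)
          hence "Re s - d \<le> Re y" by auto
          hence "(Re s - d) * x n \<le> Re y * x n" using elim by (rule mult_right_mono)
          hence "norm (c n) * (\<bar>x n\<bar> ^ k * exp (- Re y * x n)) \<le> B * (\<bar>x n\<bar> ^ k * exp (- (Re s - d) * x n))"
            using B[of n] B0 by (intro mult_mono mult_left_mono) (auto simp: algebra_simps)
          also have "\<dots> = norm (h n)" using B0 unfolding h_def norm_of_real by simp
          finally show "norm (f k n y) \<le> norm (h n)" unfolding nf .
        qed
      qed
      show ?thesis by (intro exI[of _ d] exI[of _ h] conjI d(1) 1 2 3)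
    qed
  qed
  then obtain g g' where *: "\<forall>s\<in>S. ((\<lambda>n. f k n s) sums g s) \<and> ((\<lambda>n. f (Suc k) n s) sums g' s) \<and> (g has_field_derivative g' s) (at s)"
    by (elim exE)
  note g = *[THEN bspec, THEN conjunct1] *[THEN bspec, THEN conjunct2, THEN conjunct1] *[THEN bspec, THEN conjunct2, THEN conjunct2]
  have g1: "g s = gen_dirichlet c x k s" if "s \<in> S" for s
    using g(1)[OF that] by (simp add: gen_dirichlet_def f_def sums_iff)
  have g2: "g' s = gen_dirichlet c x (Suc k) s" if "s \<in> S" for s
    using g(2)[OF that] by (simp add: gen_dirichlet_def f_def sums_iff)
  have sS: "s \<in> S" using s by (simp add: S_def)
  show "(gen_dirichlet c x k has_field_derivative gen_dirichlet c x (Suc k) s) (at s)"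
    using has_field_derivative_transform_within_open[OF g(3)[OF sS] S sS g1] g2[OF sS] by simp
qed

lemma higher_deriv_gen_dirichlet:
  fixes c :: "nat \<Rightarrow> complex" and x :: "nat \<Rightarrow> real"
  assumes B: "\<And>n. norm (c n) \<le> B"
  assumes lim: "filterlim x at_top sequentially"
  assumes summ: "\<And>\<sigma>. \<sigma> > 1 \<Longrightarrow> summable (\<lambda>n. exp (- \<sigma> * x n))"
  assumes eq: "\<And>s. Re s > 1 \<Longrightarrow> f s = gen_dirichlet c x 0 s"
  assumes s: "Re s > 1"
  shows "(deriv ^^ k) f s = gen_dirichlet c x k s"
  using s
proof (induction k arbitrary: s)
  case (Suc k)
  have "eventually (\<lambda>w. w \<in> {w. Re w > 1}) (nhds s)"
    using Suc.prems by (intro eventually_nhds_in_open open_halfspace_Re_gt) auto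
  hence "eventually (\<lambda>w. (deriv ^^ k) f w = gen_dirichlet c x k w) (nhds s)"
    by eventually_elim (simp add: Suc.IH)
  hence "deriv ((deriv ^^ k) f) s = deriv (gen_dirichlet c x k) s"
    by (rule deriv_cong_ev) simp
  also have "\<dots> = gen_dirichlet c x (Suc k) s"
    by (rule DERIV_imp_deriv[OF has_field_derivative_gen_dirichlet[OF B lim summ Suc.prems]])
  finally show ?case by simp
qed (simp add: eq)

text \<open>The majorant \<open>h\<close> does not involve \<open>t\<close> and sums over all
  \<open>k < N\<close>, so one \<open>Y0\<close> works for every height and every derivative. This
  allows the number of phases to be fixed before \<open>t\<close> is chosen.\<close>

lemma gen_dirichlet_truncation:
  fixes c :: "nat \<Rightarrow> complex" and x :: "nat \<Rightarrow> real"
  assumes B: "\<And>n. norm (c n) \<le> B"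
  assumes lim: "filterlim x at_top sequentially"
  assumes summ: "\<And>\<sigma>. \<sigma> > 1 \<Longrightarrow> summable (\<lambda>n. exp (- \<sigma> * x n))"
  assumes \<sigma>: "\<sigma> > 1" and \<epsilon>: "\<epsilon> > 0"
  shows "\<exists>Y0. \<forall>Y\<ge>Y0. \<forall>t. \<forall>k<N. norm (gen_dirichlet c x k (Complex \<sigma> t) -
           (\<Sum>n<Y. c n * of_real (- x n) ^ k * of_real (exp (- \<sigma> * x n)) * cis (- t * x n))) < \<epsilon>"
proof -
  define h where "h = (\<lambda>n. \<Sum>k<N. B * (\<bar>x n\<bar> ^ k * exp (- \<sigma> * x n)))"
  have B0: "B \<ge> 0" using B[of 0] norm_ge_zero order.trans by blast
  have "summable h"
    unfolding h_def by (intro summable_sum summable_mult summable_power_exp lim summ \<sigma>)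
  then obtain Y0 where Y0: "\<And>Y. Y \<ge> Y0 \<Longrightarrow> norm (\<Sum>i. h (i + Y)) < \<epsilon>"
    using suminf_exist_split[OF \<epsilon>, of h] by blast
  show ?thesis
  proof (intro exI[of _ Y0] allI impI)
    fix Y t k assume Y: "Y \<ge> Y0" and k: "k < N"
    define f where "f = (\<lambda>n. c n * of_real (- x n) ^ k * exp (- of_real (x n) * Complex \<sigma> t))"
    have fe: "f n = c n * of_real (- x n) ^ k * of_real (exp (- \<sigma> * x n)) * cis (- t * x n)" for n
      by (simp add: f_def exp_eq_polar mult_ac)
    have sf: "summable (\<lambda>n. norm (f n))"
      unfolding f_def using \<sigma> by (intro summable_gen_dirichlet[OF B lim summ]) auto
    have "gen_dirichlet c x k (Complex \<sigma> t) = (\<Sum>n. f n)" by (simp add: gen_dirichlet_def f_def)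
    also have "\<dots> = (\<Sum>n. f (n + Y)) + (\<Sum>n<Y. f n)"
      by (rule suminf_split_initial_segment[OF summable_norm_cancel[OF sf]])
    finally have "norm (gen_dirichlet c x k (Complex \<sigma> t) - (\<Sum>n<Y. f n)) = norm (\<Sum>n. f (n + Y))"
      by simp
    also have "\<dots> \<le> (\<Sum>n. norm (f (n + Y)))"
      using sf by (intro summable_norm) (simp add: summable_iff_shift[of "\<lambda>n. norm (f n)"])
    also have "\<dots> \<le> (\<Sum>n. h (n + Y))"
    proof (rule suminf_le)
      fix n
      have "norm (f n) \<le> B * (\<bar>x n\<bar> ^ k * exp (- \<sigma> * x n))" for n
        unfolding fe using B[of n] by (simp add: norm_mult norm_power mult.assoc mult_right_mono)
      also have "B * (\<bar>x n\<bar> ^ k * exp (- \<sigma> * x n)) \<le> h n" for n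
        unfolding h_def using k B0 
        by (intro member_le_sum[of k "{..<N}" "\<lambda>k. B * (\<bar>x n\<bar> ^ k * exp (- \<sigma> * x n))"]) auto
      finally show "norm (f (n + Y)) \<le> h (n + Y)" .
    qed (use sf \<open>summable h\<close> in \<open>simp_all add: summable_iff_shift[of h] summable_iff_shift[of "\<lambda>n. norm (f n)"]\<close>)
    also have "\<dots> \<le> norm (\<Sum>n. h (n + Y))" by simp
    also have "\<dots> < \<epsilon>" by (rule Y0[OF Y])
    finally show "norm (gen_dirichlet c x k (Complex \<sigma> t) -
           (\<Sum>n<Y. c n * of_real (- x n) ^ k * of_real (exp (- \<sigma> * x n)) * cis (- t * x n))) < \<epsilon>"
      unfolding fe .
  qed
qed

subsection \<open>Kronecker approximation\<close>

lemma norm_cis_diff_le: "norm (cis a - cis b) \<le> \<bar>a - b\<bar>"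
proof -
  have "norm (cis a - cis b) = norm (cis b * (exp (\<i> * of_real (a - b)) - 1))"
    by (simp add: cis_conv_exp right_diff_distrib algebra_simps flip: exp_add)
  also have "\<dots> = 2 * \<bar>sin ((a - b) / 2)\<bar>"
    by (simp only: norm_mult norm_cis dist_exp_i_1)
  also have "\<dots> \<le> \<bar>a - b\<bar>" using abs_sin_x_le_abs_x[of "(a - b) / 2"] by simp
  finally show ?thesis .
qed

text \<open>Kronecker's theorem gives some \<open>t0\<close> without control of its size.
  Simultaneous Dirichlet approximation supplies a large shift that is nearly an integer at every
  frequency, which moves the point beyond \<open>T\<close> and hardly changes the phases.\<close>

lemma Kronecker_phases:
  fixes f :: "'i \<Rightarrow> real" and u :: "'i \<Rightarrow> complex"
  assumes I: "finite I"
  assumes indep: "\<And>c :: 'i \<Rightarrow> int. (\<Sum>i\<in>I. of_int (c i) * f i) = 0 \<Longrightarrow> \<forall>i\<in>I. c i = 0"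
  assumes u: "\<And>i. i \<in> I \<Longrightarrow> norm (u i) = 1" and \<epsilon>: "\<epsilon> > 0"
  shows "\<exists>t\<ge>T. \<forall>i\<in>I. norm (cis (- t * f i) - u i) < \<epsilon>"
proof -
  define n where "n = card I"
  obtain e where e: "bij_betw e {..<n} I"
    using ex_bij_betw_nat_finite[OF I] by (auto simp: n_def atLeast0LessThan)
  \<comment> \<open>Linear independence is a notion for sets of reals, so equal values at different
    indices have to be excluded; they would satisfy the relation with coefficients 1 and -1.\<close>
  have inj: "inj_on f I"
  proof (rule inj_onI, rule ccontr)
    fix i j assume ij: "i \<in> I" "j \<in> I" "f i = f j" "i \<noteq> j"
    define c :: "'i \<Rightarrow> int" where "c = (\<lambda>k. if k = i then 1 else if k = j then -1 else 0)"
    have "(\<Sum>k\<in>I. of_int (c k) * f k) = (\<Sum>k\<in>{i,j}. of_int (c k) * f k)"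
      using ij I by (intro sum.mono_neutral_right) (auto simp: c_def)
    also have "\<dots> = 0" using ij by (simp add: c_def)
    finally have "c i = 0" using indep ij by blast
    thus False by (simp add: c_def)
  qed
  define \<theta> where "\<theta> = (\<lambda>k. f (e k))"
  \<comment> \<open>Target phases are measured in full turns; the sign matches
    \<open>cis (- t * f i)\<close>. The tolerance \<open>\<epsilon> / (4 * pi)\<close> is the share
    of two errors that are each multiplied by \<open>2 * pi\<close>.\<close>
  define \<alpha> where "\<alpha> = (\<lambda>k. - Arg (u (e k)) / (2 * pi))"
  define \<epsilon>' where "\<epsilon>' = \<epsilon> / (4 * pi)"
  have \<epsilon>': "\<epsilon>' > 0" using \<epsilon> by (simp add: \<epsilon>'_def)
  have im: "\<theta> ` {..<n} = f ` I" using e by (auto simp: \<theta>_def bij_betw_def image_image[symmetric])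
  have mod: "module (\<lambda>r. (*) (real_of_int r))"
    by standard (auto simp: algebra_simps)
  have "module.independent (\<lambda>r. (*) (real_of_int r)) (\<theta> ` {..<n})"
    unfolding module.independent_explicit_module[OF mod] im
  proof (intro allI impI)
    fix t and v :: "real \<Rightarrow> int" and x
    assume t: "finite t" "t \<subseteq> f ` I" "(\<Sum>x\<in>t. real_of_int (v x) * x) = 0" "x \<in> t"
    define c where "c = (\<lambda>i. if f i \<in> t then v (f i) else 0)"
    have "(\<Sum>i\<in>I. of_int (c i) * f i) = (\<Sum>x\<in>f ` I. (if x \<in> t then of_int (v x) * x else 0))"
      using inj by (subst sum.reindex) (auto simp: c_def intro!: sum.cong)
    also have "\<dots> = (\<Sum>x\<in>t. real_of_int (v x) * x)"
      using t I by (intro sum.mono_neutral_cong_right) auto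
    finally have "\<forall>i\<in>I. c i = 0" using t indep by simp
    moreover obtain i where "i \<in> I" "x = f i" using t by blast
    ultimately show "v x = 0" using t(4) by (auto simp: c_def)
  qed
  moreover have "inj_on \<theta> {..<n}"
    unfolding \<theta>_def using e inj by (auto simp: bij_betw_def inj_on_def)
  ultimately obtain t0 h where t0: "\<And>k. k < n \<Longrightarrow> \<bar>t0 * \<theta> k - of_int (h k) - \<alpha> k\<bar> < \<epsilon>'"
    using Kronecker_thm_1[OF _ _ \<epsilon>', of \<theta> n \<alpha>] by blast
  \<comment> \<open>Every positive integer multiple of \<open>S\<close> added to \<open>t0\<close>
    gives at least \<open>\<bar>T\<bar>\<close>, so the unknown multiplier \<open>q\<close> from
    Dirichlet's theorem can be used.\<close>
  define S where "S = \<bar>T\<bar> + \<bar>t0\<bar>"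
  obtain K where K: "inverse (real (Suc K)) < \<epsilon>'" using reals_Archimedean[OF \<epsilon>'] by blast
  obtain q p where qp: "0 < q" "\<And>k. k < n \<Longrightarrow> \<bar>of_int q * (S * \<theta> k) - of_int (p k)\<bar> < 1 / Suc K"
    by (rule Dirichlet_approx_simult[of "Suc K" n "\<lambda>k. S * \<theta> k"]) auto
  define t where "t = 2 * pi * (t0 + q * S)"
  have "1 * S \<le> q * S" using qp(1) by (intro mult_right_mono) (auto simp: S_def)
  hence *: "\<bar>T\<bar> \<le> t0 + q * S" by (simp add: S_def)
  also have "1 * \<dots> \<le> t"
    unfolding t_def using pi_gt3 * by (intro mult_right_mono) auto
  finally have tT: "t \<ge> T" by simp
  have "norm (cis (- t * f i) - u i) < \<epsilon>" if i: "i \<in> I" for i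
  proof -
    obtain k where k: "k < n" "i = e k" using e i by (auto simp: bij_betw_def)
    have ui: "u i = cis (2 * pi * (- \<alpha> k))"
    proof -
      have "u i \<noteq> 0" using u[OF i] by auto
      thus ?thesis using u[OF i] cis_Arg[of "u i"] k by (simp add: \<alpha>_def sgn_eq)
    qed
    have "cis (- t * f i) = cis (- t * f i + 2 * pi * of_int (h k + p k))"
      by (simp only: cis_mult[symmetric] cis_multiple_2pi Ints_of_int mult_1_right)
    hence "norm (cis (- t * f i) - u i) \<le> \<bar>(- t * f i + 2 * pi * of_int (h k + p k)) - 2 * pi * (- \<alpha> k)\<bar>"
      unfolding ui by (simp only: norm_cis_diff_le)
    also have "(- t * f i + 2 * pi * of_int (h k + p k)) - 2 * pi * (- \<alpha> k) =
        - (2 * pi) * ((t0 * \<theta> k - of_int (h k) - \<alpha> k) + (of_int q * (S * \<theta> k) - of_int (p k)))"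
      using k by (simp add: t_def \<theta>_def algebra_simps)
    also have "\<bar>\<dots>\<bar> = 2 * pi * \<bar>(t0 * \<theta> k - of_int (h k) - \<alpha> k) + (of_int q * (S * \<theta> k) - of_int (p k))\<bar>"
      by (simp only: abs_mult) simp
    also have "\<dots> < 2 * pi * (\<epsilon>' + \<epsilon>')"
      using t0[OF k(1)] qp(2)[OF k(1)] K by (intro mult_strict_left_mono) (auto simp: inverse_eq_divide)
    also have "\<dots> = \<epsilon>" by (simp add: \<epsilon>'_def)
    finally show ?thesis .
  qed
  thus ?thesis using tT by blast
qed

section \<open>Integer polynomials at a transcendental point and independence of logarithms\<close>

lemma int_coeffs_mult:
  fixes p q :: "real poly"
  assumes "\<And>i. coeff p i \<in> \<int>" "\<And>i. coeff q i \<in> \<int>"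
  shows "coeff (p * q) i \<in> \<int>"
  unfolding coeff_mult using assms by (intro Ints_sum Ints_mult) auto

lemma int_coeffs_power:
  fixes p :: "real poly"
  assumes "\<And>i. coeff p i \<in> \<int>"
  shows "coeff (p ^ n) i \<in> \<int>"
proof (induction n arbitrary: i)
  case (Suc n)
  thus ?case using assms int_coeffs_mult[of p "p ^ n"] by simp
qed (auto simp: coeff_1)

lemma int_coeffs_prod:
  fixes p :: "'i \<Rightarrow> real poly"
  assumes "\<And>x i. x \<in> A \<Longrightarrow> coeff (p x) i \<in> \<int>"
  shows "coeff (prod p A) i \<in> \<int>"
  using assms
proof (induction A arbitrary: i rule: infinite_finite_induct)
  case (insert x A)
  thus ?case using int_coeffs_mult[of "p x" "prod p A"] by simp
qed (auto simp: coeff_1)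

lemma int_coeffs_eq_of_transcendental:
  fixes \<alpha> :: real
  assumes "\<not> algebraic \<alpha>" "\<And>i. coeff p i \<in> \<int>" "\<And>i. coeff q i \<in> \<int>" "poly p \<alpha> = poly q \<alpha>"
  shows "p = q"
proof (rule ccontr)
  assume "p \<noteq> q"
  hence "algebraic \<alpha>" using assms by (intro algebraicI[of "p - q"]) auto
  thus False using assms by blast
qed

text \<open>Exponents are split into positive and negative parts, so that only natural powers, and
  hence polynomials, occur after exponentiation.\<close>

lemma ln_prod_powers:
  assumes "finite A" "\<And>x. x \<in> A \<Longrightarrow> g x > (0::real)"
  shows "(\<Sum>x\<in>A. of_int (c x) * ln (g x)) = ln (\<Prod>x\<in>A. g x ^ nat (c x)) - ln (\<Prod>x\<in>A. g x ^ nat (- c x))"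
proof -
  have "of_int (c x) * ln (g x) = ln (g x ^ nat (c x)) - ln (g x ^ nat (- c x))" if "x \<in> A" for x
  proof -
    have "real_of_int (c x) = real (nat (c x)) - real (nat (- c x))" by auto
    thus ?thesis using assms(2)[OF that] by (simp add: ln_realpow left_diff_distrib)
  qed
  moreover have "ln (\<Prod>x\<in>A. g x ^ nat (e x)) = (\<Sum>x\<in>A. ln (g x ^ nat (e x)))" for e
  proof (rule ln_prod)
    show "g x ^ nat (e x) \<noteq> 0" if "x \<in> A" for x using assms(2)[OF that] by simp
  qed fact
  ultimately show ?thesis by (simp add: sum_subtractf)
qed

text \<open>Exponentiating a relation gives an identity between integer polynomials evaluated at \<open>\<alpha>\<close>,
  hence an identity of polynomials, and the exponents are read off from their zeros.\<close>

lemma logs_independent: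
  fixes \<alpha> :: real and c d :: "nat \<Rightarrow> int"
  assumes \<alpha>: "\<alpha> > 0" "\<not> algebraic \<alpha>" and P: "finite P" "\<And>p. p \<in> P \<Longrightarrow> prime p"
  assumes rel: "(\<Sum>p\<in>P. of_int (c p) * ln (real p)) + (\<Sum>m<Y. of_int (d m) * ln (real m + \<alpha>)) = 0"
  shows "(\<forall>p\<in>P. c p = 0) \<and> (\<forall>m<Y. d m = 0)"
proof -
  define A where "A = (\<lambda>c :: nat \<Rightarrow> int. \<Prod>p\<in>P. p ^ nat (c p))"
  define Q where "Q = (\<lambda>d :: nat \<Rightarrow> int. \<Prod>m<Y. [:real m, 1:] ^ nat (d m))"
  have A: "A c > 0" for c unfolding A_def using P by (intro prod_pos) (auto simp: prime_gt_0_nat)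
  have Qp: "poly (Q d) x = (\<Prod>m<Y. (real m + x) ^ nat (d m))" for d x
    by (simp add: Q_def poly_prod)
  have Qpos: "poly (Q d) \<alpha> > 0" for d
    unfolding Qp using \<alpha> by (intro prod_pos) auto
  have int: "coeff (smult (real (A c)) (Q d)) i \<in> \<int>" for c d i
  proof -
    have "coeff (Q d) i \<in> \<int>"
      unfolding Q_def by (intro int_coeffs_prod int_coeffs_power) (auto simp: coeff_pCons split: nat.splits)
    thus ?thesis by simp
  qed
  have "ln (real (A c)) - ln (real (A (\<lambda>p. - c p))) + (ln (poly (Q d) \<alpha>) - ln (poly (Q (\<lambda>m. - d m)) \<alpha>)) = 0"
    using rel ln_prod_powers[of P "real" c] ln_prod_powers[of "{..<Y}" "\<lambda>m. real m + \<alpha>" d] P \<alpha>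
    by (simp add: A_def Qp prime_gt_0_nat add_pos_nonneg add_nonneg_pos)
  hence "ln (real (A c) * poly (Q d) \<alpha>) = ln (real (A (\<lambda>p. - c p)) * poly (Q (\<lambda>m. - d m)) \<alpha>)"
    using A[of c] A[of "\<lambda>p. - c p"] Qpos[of d] Qpos[of "\<lambda>m. - d m"] by (simp add: ln_mult)
  hence "real (A c) * poly (Q d) \<alpha> = real (A (\<lambda>p. - c p)) * poly (Q (\<lambda>m. - d m)) \<alpha>"
    by (subst (asm) ln_inj_iff) (auto intro!: mult_pos_pos simp: A Qpos)
  hence eq: "smult (real (A c)) (Q d) = smult (real (A (\<lambda>p. - c p))) (Q (\<lambda>m. - d m))"
    by (intro int_coeffs_eq_of_transcendental[OF \<alpha>(2) int int]) simp
  have root: "poly (Q d) (- real m) = 0 \<longleftrightarrow> d m > 0" if "m < Y" for d m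
    unfolding Qp using that by (auto intro!: bexI[of _ m])
  have d0: "d m = 0" if m: "m < Y" for m
  proof -
    \<comment> \<open>The zero \<open>- m\<close> occurs on one side exactly if
      \<open>d m > 0\<close> and on the other exactly if \<open>d m < 0\<close>. Equality of the
      polynomials leaves only \<open>d m = 0\<close>; multiplicities are not compared.\<close>
    have "poly (Q d) (- real m) = 0 \<longleftrightarrow> poly (Q (\<lambda>m. - d m)) (- real m) = 0"
      using arg_cong[OF eq, of "\<lambda>q. poly q (- real m)"] A[of c] A[of "\<lambda>p. - c p"] by auto
    thus ?thesis using root[OF m, of d] root[OF m, of "\<lambda>m. - d m"] by auto
  qed
  hence "Q d = 1" "Q (\<lambda>m. - d m) = 1" by (simp_all add: Q_def)
  \<comment> \<open>With all shifts gone the identity is one between integers, and unique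
    factorisation compares the exponents of the primes.\<close>
  hence "A c = A (\<lambda>p. - c p)" using arg_cong[OF eq, of "\<lambda>q. poly q 0"] by simp
  hence "multiplicity p (A c) = multiplicity p (A (\<lambda>p. - c p))" for p by simp
  moreover have "multiplicity p (A c) = nat (c p)" if "p \<in> P" for p c
    unfolding A_def using P that by (subst multiplicity_prod_prime_powers) auto
  ultimately have "nat (c p) = nat (- c p)" if "p \<in> P" for p using that by metis
  hence "c p = 0" if "p \<in> P" for p using that by (cases "c p \<ge> 0") (force)+
  thus ?thesis using d0 by blast
qed

text \<open>A sum type indexes the primes and the shifts together, so that a single application of
  \<open>Kronecker_phases\<close> yields the same \<open>t\<close> for both families.\<close>

lemma joint_phases:
  fixes \<alpha> :: real and u v :: "nat \<Rightarrow> complex"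
  assumes \<alpha>: "\<alpha> > 0" "\<not> algebraic \<alpha>"
  assumes u: "\<And>n. norm (u n) = 1" and v: "\<And>n. norm (v n) = 1" and \<epsilon>: "\<epsilon> > 0"
  shows "\<exists>t\<ge>T. (\<forall>p<Y. prime p \<longrightarrow> norm (cis (- t * ln (real p)) - u p) < \<epsilon>) \<and>
                 (\<forall>m<Y. norm (cis (- t * ln (real m + \<alpha>)) - v m) < \<epsilon>)"
proof -
  define P where "P = {p. p < Y \<and> prime p}"
  have P: "finite P" "\<And>p. p \<in> P \<Longrightarrow> prime p" by (auto simp: P_def)
  define f :: "nat + nat \<Rightarrow> real" where "f = case_sum (\<lambda>p. ln (real p)) (\<lambda>m. ln (real m + \<alpha>))"
  have "\<exists>t\<ge>T. \<forall>i\<in>P <+> {..<Y}. norm (cis (- t * f i) - case_sum u v i) < \<epsilon>"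
  proof (rule Kronecker_phases)
    fix c :: "nat + nat \<Rightarrow> int"
    assume "(\<Sum>i\<in>P <+> {..<Y}. of_int (c i) * f i) = 0"
    hence "(\<Sum>p\<in>P. of_int (c (Inl p)) * ln (real p)) + (\<Sum>m<Y. of_int (c (Inr m)) * ln (real m + \<alpha>)) = 0"
      using P by (simp add: sum.Plus f_def)
    from logs_independent[OF \<alpha> P this] show "\<forall>i\<in>P <+> {..<Y}. c i = 0" by auto
  qed (use P u v \<epsilon> in auto)
  then obtain t where t: "t \<ge> T" "\<And>i. i \<in> P <+> {..<Y} \<Longrightarrow> norm (cis (- t * f i) - case_sum u v i) < \<epsilon>"
    by blast
  show ?thesis
  proof (intro exI[of _ t] conjI t allI impI)
    show "norm (cis (- t * ln (real p)) - u p) < \<epsilon>" if "p < Y" "prime p" for p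
      using t(2)[of "Inl p"] that by (auto simp: f_def P_def)
    show "norm (cis (- t * ln (real m + \<alpha>)) - v m) < \<epsilon>" if "m < Y" for m
      using t(2)[of "Inr m"] that by (auto simp: f_def)
  qed
qed

subsection \<open>Euler products\<close>

text \<open>Multiply by the \<open>n\<close>-th power of the index of the first nonzero coefficient and let \<open>n \<rightarrow> \<infinity>\<close>.\<close>

lemma dirichlet_coeffs_zero:
  fixes a :: "nat \<Rightarrow> complex"
  assumes bd: "\<And>m. m > 0 \<Longrightarrow> norm (a m) \<le> C * real m ^ \<kappa>"
  assumes zero: "\<And>n. n \<ge> n0 \<Longrightarrow> (\<lambda>m. a (Suc m) / of_nat (Suc m) ^ n) sums 0"
  assumes "m > 0"
  shows "a m = 0"
  using \<open>m > 0\<close>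
proof (induction m rule: less_induct)
  case (less m)
  \<comment> \<open>The largest of the ratios \<open>m / j\<close> with
    \<open>j > m\<close>.\<close>
  define \<rho> where "\<rho> = real m / real (Suc m)"
  have \<rho>: "0 \<le> \<rho>" "\<rho> < 1" by (auto simp: \<rho>_def)
  define f where "f = (\<lambda>j. inverse (real (Suc j)) ^ 2)"
  have f: "summable f" unfolding f_def using inverse_power_summable[of 2, where 'a = real] by (subst summable_Suc_iff) (simp add: power_inverse)
  define K where "K = C * real m ^ (\<kappa> + 2) * suminf f"
  have C: "C \<ge> 0" using order.trans[OF norm_ge_zero bd[of 1]] by simp
  have le: "norm (a m) \<le> K * \<rho> ^ k" if n: "k + \<kappa> + 2 \<ge> n0" for k
  proof -
    \<comment> \<open>The part \<open>\<kappa> + 2\<close> of the exponent beats the growth of the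
      coefficients and leaves the summable \<open>1 / j ^ 2\<close>; the remaining \<open>k\<close>
      powers give the decay \<open>\<rho> ^ k\<close>.\<close>
    define n where "n = k + \<kappa> + 2"
    define h where "h = (\<lambda>j. a (Suc j) * (of_nat m / of_nat (Suc j)) ^ n)"
    have "(\<lambda>j. of_nat m ^ n * (a (Suc j) / of_nat (Suc j) ^ n)) sums (of_nat m ^ n * 0)"
      using zero[of n] n by (intro sums_mult) (simp add: n_def)
    hence h: "h sums 0" by (simp add: h_def power_divide mult_ac)
    \<comment> \<open>Position \<open>j\<close> carries the coefficient of \<open>Suc j\<close>, so
      the part cut off ends with the coefficient \<open>a m\<close> itself.\<close>
    define h' where "h' = (\<lambda>j. if j \<le> m - 1 then 0 else h j)"
    have "h j = 0" if "j < m - 1" for j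
      using less.IH[of "Suc j"] that by (simp add: h_def)
    moreover have "h (m - 1) = a m" using less.prems by (simp add: h_def)
    ultimately have "(\<Sum>j<m. h j) = a m"
      using less.prems by (cases m) (auto simp: sum.neutral)
    moreover have "h' = (\<lambda>j. h j - (if j \<in> {..<m} then h j else 0))"
      using less.prems by (auto simp: h'_def fun_eq_iff)
    ultimately have "h' sums (0 - a m)"
      using sums_diff[OF h sums_If_finite_set[of "{..<m}" h]] by simp
    hence am: "a m = - suminf h'" and sm: "summable h'" by (auto simp: sums_iff)
    have bnd: "norm (h' j) \<le> (C * real m ^ (\<kappa> + 2) * \<rho> ^ k) * f j" for j
    proof (cases "j \<le> m - 1")
      case False
      hence j: "Suc j \<ge> Suc m" using less.prems by simp
      have "norm (h' j) = norm (a (Suc j)) * (real m / real (Suc j)) ^ n"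
        using False by (simp add: h'_def h_def norm_mult norm_power norm_divide del: of_nat_Suc)
      also have "\<dots> \<le> (C * real (Suc j) ^ \<kappa>) * (real m / real (Suc j)) ^ n"
        by (intro mult_right_mono bd) auto
      also have "\<dots> = C * real (Suc j) ^ \<kappa> * (real m / real (Suc j)) ^ (\<kappa> + 2) * (real m / real (Suc j)) ^ k"
        by (simp add: n_def power_add mult_ac)
      also have "C * real (Suc j) ^ \<kappa> * (real m / real (Suc j)) ^ (\<kappa> + 2) = C * real m ^ (\<kappa> + 2) * f j"
        by (simp add: f_def power_divide power_add divide_simps power2_eq_square del: of_nat_Suc)
      also have "\<dots> * (real m / real (Suc j)) ^ k \<le> C * real m ^ (\<kappa> + 2) * f j * \<rho> ^ k"
        unfolding \<rho>_def using j C by (intro mult_left_mono power_mono divide_left_mono) (auto simp: f_def)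
      finally show ?thesis by (simp add: mult_ac)
    qed (use C \<rho> in \<open>auto simp: h'_def f_def\<close>)
    have "summable (\<lambda>j. norm (h' j))"
      by (rule summable_comparison_test[OF _ summable_mult[OF f]]) (use bnd in auto)
    hence "norm (suminf h') \<le> (\<Sum>j. norm (h' j))" by (rule summable_norm)
    also have "\<dots> \<le> (\<Sum>j. (C * real m ^ (\<kappa> + 2) * \<rho> ^ k) * f j)"
      by (intro suminf_le bnd summable_mult f) fact
    also have "\<dots> = K * \<rho> ^ k" using suminf_mult[OF f] by (simp add: K_def)
    finally show ?thesis by (simp add: am)
  qed
  have "(\<lambda>k. K * \<rho> ^ k) \<longlonglongrightarrow> K * 0"
    using \<rho> by (intro tendsto_mult tendsto_const LIMSEQ_realpow_zero) auto
  moreover have "eventually (\<lambda>k. norm (a m) \<le> K * \<rho> ^ k) sequentially"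
    using eventually_ge_at_top[of n0] by eventually_elim (auto intro: le)
  ultimately have "norm (a m) \<le> K * 0"
    by (intro tendsto_lowerbound[of "\<lambda>k. K * \<rho> ^ k"]) auto
  thus ?case by simp
qed

text \<open>The multiplicative arithmetic function with value \<open>G p k\<close> at
  \<open>p ^ k\<close>, provided \<open>G p 0 = 1\<close>. The value 0 at 0 lets series over all of
  \<open>nat\<close> be used without a shift.\<close>

definition mult_ext :: "(nat \<Rightarrow> nat \<Rightarrow> complex) \<Rightarrow> nat \<Rightarrow> complex" where
  "mult_ext G m = (if m = 0 then 0 else \<Prod>p\<in>prime_factors m. G p (multiplicity p m))"

lemma mult_ext_superset:
  assumes "finite S" "prime_factors m \<subseteq> S" "\<And>p. p \<in> S \<Longrightarrow> prime p" "m > 0" "\<And>p. G p 0 = 1"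
  shows "mult_ext G m = (\<Prod>p\<in>S. G p (multiplicity p m))"
proof -
  have "G p (multiplicity p m) = 1" if "p \<in> S - prime_factors m" for p
  proof -
    have "multiplicity p m = 0"
      using that assms(3)[of p] by (simp add: prime_factors_multiplicity)
    thus ?thesis using assms by simp
  qed
  thus ?thesis unfolding mult_ext_def using assms by (auto intro!: prod.mono_neutral_left)
qed

lemma prime_factors_power_subset: "prime p \<Longrightarrow> prime_factors (p ^ k) \<subseteq> {p :: nat}"
  by (auto simp: prime_factors_dvd dest: prime_dvd_power primes_dvd_imp_eq)

lemma mult_ext_prime_power:
  assumes "prime p" "\<And>p. G p 0 = 1"
  shows "mult_ext G (p ^ k) = G p k"
proof -
  have "mult_ext G (p ^ k) = (\<Prod>p'\<in>{p}. G p' (multiplicity p' (p ^ k)))"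
    using assms prime_factors_power_subset[of p k] by (intro mult_ext_superset) (auto simp: prime_gt_0_nat)
  thus ?thesis using assms by (simp add: multiplicity_same_power)
qed

text \<open>Positivity is demanded separately because \<open>prime_factors 0\<close> is
  empty.\<close>

definition smooth :: "nat set \<Rightarrow> nat set" where
  "smooth S = {m. m > 0 \<and> prime_factors m \<subseteq> S}"

text \<open>Unique factorisation: the power of \<open>q\<close> is split off by
  \<open>multiplicity q\<close>.\<close>

lemma bij_betw_smooth_insert:
  assumes q: "prime q" "q \<notin> S" and S: "\<And>p. p \<in> S \<Longrightarrow> prime p"
  shows "bij_betw (\<lambda>(m, k). m * q ^ k) (smooth S \<times> UNIV) (smooth (insert q S))"
proof (rule bij_betwI[where g = "\<lambda>n. (n div q ^ multiplicity q n, multiplicity q n)"])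
  have mq: "multiplicity q (m * q ^ k) = k" if "m \<in> smooth S" for m k
  proof -
    have "\<not> q dvd m" using that q by (auto simp: smooth_def prime_factors_dvd)
    hence "multiplicity q m = 0" by (rule not_dvd_imp_multiplicity_0)
    thus ?thesis using that q
      by (subst prime_elem_multiplicity_mult_distrib) (auto simp: smooth_def prime_gt_0_nat)
  qed
  show "(\<lambda>(m, k). m * q ^ k) \<in> smooth S \<times> UNIV \<rightarrow> smooth (insert q S)"
  proof safe
    fix m k assume m: "m \<in> smooth S"
    have "prime_factors (m * q ^ k) = prime_factors m \<union> prime_factors (q ^ k)"
      using m q by (intro prime_factors_product) (auto simp: smooth_def prime_gt_0_nat)
    thus "m * q ^ k \<in> smooth (insert q S)"
      using m q prime_factors_power_subset[of q k] by (auto simp: smooth_def prime_gt_0_nat)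
  qed
  show "(\<lambda>n. (n div q ^ multiplicity q n, multiplicity q n)) \<in> smooth (insert q S) \<rightarrow> smooth S \<times> UNIV"
  proof safe
    fix n assume n: "n \<in> smooth (insert q S)"
    hence n0: "n > 0" by (auto simp: smooth_def)
    obtain m where m: "n = q ^ multiplicity q n * m" "\<not> q dvd m"
      using multiplicity_decompose'[of n q] q n0 by (metis not_prime_unit neq0_conv)
    have "q ^ multiplicity q n > 0" using q by (simp add: prime_gt_0_nat)
    hence mdef: "n div q ^ multiplicity q n = m" by (subst m(1)) simp
    have m0: "m > 0" using m n0 by (cases m) auto
    have "p \<in> S" if "p \<in> prime_factors m" for p
    proof -
      have "p dvd n" using that m(1) by (metis dvd_mult in_prime_factors_iff)
      hence "p \<in> insert q S" using n that n0 by (auto simp: smooth_def prime_factors_dvd)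
      thus ?thesis using m(2) that by auto
    qed
    thus "n div q ^ multiplicity q n \<in> smooth S" using m0 unfolding mdef by (auto simp: smooth_def)
  qed auto
  show "(\<lambda>n. (n div q ^ multiplicity q n, multiplicity q n)) ((\<lambda>(m, k). m * q ^ k) x) = x"
    if "x \<in> smooth S \<times> UNIV" for x
    using that mq q by (auto simp: prime_gt_0_nat)
  show "(\<lambda>(m, k). m * q ^ k) ((\<lambda>n. (n div q ^ multiplicity q n, multiplicity q n)) n) = n" for n
    by (simp add: multiplicity_dvd)
qed

lemma abs_summable_on_times:
  fixes f :: "'i \<Rightarrow> 'c :: {real_normed_div_algebra, banach}" and g :: "'j \<Rightarrow> 'c"
  assumes f: "(\<lambda>x. norm (f x)) summable_on A" and g: "(\<lambda>y. norm (g y)) summable_on B"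
  shows "(\<lambda>z. norm (case z of (x, y) \<Rightarrow> f x * g y)) summable_on A \<times> B"
proof (rule Infinite_Sum.abs_summable_on_Sigma_iff[THEN iffD2], intro conjI ballI)
  show "(\<lambda>y. norm (case (x, y) of (x, y) \<Rightarrow> f x * g y)) summable_on B" for x
    unfolding prod.case norm_mult by (intro summable_on_cmult_right g)
  have "(\<lambda>x. norm (\<Sum>\<^sub>\<infinity>y\<in>B. norm (case (x, y) of (x, y) \<Rightarrow> f x * g y))) =
        (\<lambda>x. norm (f x) * norm (\<Sum>\<^sub>\<infinity>y\<in>B. norm (g y)))"
    unfolding prod.case norm_mult infsum_cmult_right' by simp
  thus "(\<lambda>x. norm (\<Sum>\<^sub>\<infinity>y\<in>B. norm (case (x, y) of (x, y) \<Rightarrow> f x * g y))) summable_on A"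
    using f by (simp add: summable_on_cmult_left)
qed

text \<open>Each new prime multiplies two absolutely summable families. Their product family is
  carried over to the larger set of smooth numbers by \<open>bij_betw_smooth_insert\<close>, along
  which \<open>mult_ext G\<close> is multiplicative.\<close>

lemma has_sum_smooth:
  fixes G :: "nat \<Rightarrow> nat \<Rightarrow> complex"
  assumes G0: "\<And>p. G p 0 = 1" and S: "finite S" "\<And>p. p \<in> S \<Longrightarrow> prime p"
  assumes sm: "\<And>p. p \<in> S \<Longrightarrow> summable (\<lambda>k. norm (G p k))"
  shows "(\<lambda>m. norm (mult_ext G m)) summable_on smooth S \<and> (mult_ext G has_sum (\<Prod>p\<in>S. \<Sum>k. G p k)) (smooth S)"
  using S sm
proof (induction S rule: finite_induct)
  case empty
  have "m = 1" if "m > 0" "prime_factors m = {}" for m :: nat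
  proof (rule ccontr)
    assume "m \<noteq> 1"
    then obtain p where "prime p" "p dvd m" using prime_factor_nat by blast
    hence "p \<in> prime_factors m" using that(1) by (simp add: prime_factors_dvd)
    thus False using that(2) by simp
  qed
  hence s: "smooth {} = {1}" unfolding smooth_def by (intro equalityI subsetI) auto
  show ?case unfolding s by (simp add: mult_ext_def has_sum_finiteI)
next
  case (insert q S)
  have q: "prime q" "q \<notin> S" and S: "\<And>p. p \<in> S \<Longrightarrow> prime p" using insert by auto
  have IH: "(\<lambda>m. norm (mult_ext G m)) summable_on smooth S" "(mult_ext G has_sum (\<Prod>p\<in>S. \<Sum>k. G p k)) (smooth S)"
    using insert by auto
  have sq: "summable (\<lambda>k. norm (G q k))" using insert by auto
  have eq: "mult_ext G (m * q ^ k) = mult_ext G m * G q k" if m: "m \<in> smooth S" for m k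
  proof -
    have "(\<lambda>(m, k). m * q ^ k) (m, k) \<in> smooth (insert q S)"
      using bij_betw_smooth_insert[OF q S] m unfolding bij_betw_def by (metis SigmaI UNIV_I image_eqI)
    hence mk: "m * q ^ k \<in> smooth (insert q S)" by simp
    have "\<not> q dvd m" using m q by (auto simp: smooth_def prime_factors_dvd)
    hence "multiplicity q m = 0" by (rule not_dvd_imp_multiplicity_0)
    hence mq: "multiplicity q (m * q ^ k) = k"
      using m q by (subst prime_elem_multiplicity_mult_distrib) (auto simp: smooth_def prime_gt_0_nat)
    have mp: "multiplicity p (m * q ^ k) = multiplicity p m" if "p \<in> S" for p
    proof -
      have "multiplicity p q = 0" using q S[OF that] that by (intro prime_multiplicity_other) auto
      thus ?thesis using m q S[OF that]
        by (subst prime_elem_multiplicity_mult_distrib) (auto simp: smooth_def prime_gt_0_nat prime_elem_multiplicity_power_distrib)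
    qed
    have "mult_ext G (m * q ^ k) = (\<Prod>p\<in>insert q S. G p (multiplicity p (m * q ^ k)))"
      using mk insert.hyps q S G0 by (intro mult_ext_superset) (auto simp: smooth_def)
    also have "\<dots> = G q k * (\<Prod>p\<in>S. G p (multiplicity p m))"
      using insert.hyps by (simp add: mq mp)
    also have "(\<Prod>p\<in>S. G p (multiplicity p m)) = mult_ext G m"
      using m insert.hyps S G0 by (intro mult_ext_superset[symmetric]) (auto simp: smooth_def)
    finally show ?thesis by (simp add: mult.commute)
  qed
  define F where "F = (\<lambda>(m, k). mult_ext G m * G q k)"
  have hq: "(G q has_sum (\<Sum>k. G q k)) UNIV"
    by (rule norm_summable_imp_has_sum[OF sq summable_sums[OF summable_norm_cancel[OF sq]]])
  have nq: "(\<lambda>k. norm (G q k)) summable_on UNIV"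
    using sq by (intro norm_summable_imp_summable_on) simp
  have aF: "(\<lambda>x. norm (F x)) summable_on smooth S \<times> UNIV"
    unfolding F_def by (intro abs_summable_on_times IH nq)
  then obtain T where T: "(F has_sum T) (smooth S \<times> UNIV)"
    using abs_summable_summable summable_on_def by blast
  have "((\<lambda>m. mult_ext G m * (\<Sum>k. G q k)) has_sum T) (smooth S)"
    using T by (rule has_sum_SigmaD) (auto simp: F_def intro!: has_sum_cmult_right hq)
  moreover have "((\<lambda>m. mult_ext G m * (\<Sum>k. G q k)) has_sum ((\<Prod>p\<in>S. \<Sum>k. G p k) * (\<Sum>k. G q k))) (smooth S)"
    by (intro has_sum_cmult_left IH)
  ultimately have T': "T = (\<Prod>p\<in>insert q S. \<Sum>k. G p k)"
    using insert.hyps by (simp add: has_sum_unique mult.commute)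
  note bij = bij_betw_smooth_insert[OF q S]
  have Feq: "F x = mult_ext G ((\<lambda>(m, k). m * q ^ k) x)" if "x \<in> smooth S \<times> UNIV" for x
    using that eq by (auto simp: F_def)
  have "((\<lambda>x. mult_ext G ((\<lambda>(m, k). m * q ^ k) x)) has_sum T) (smooth S \<times> UNIV)"
    using T by (subst has_sum_cong[OF Feq, symmetric])
  hence "(mult_ext G has_sum T) (smooth (insert q S))"
    by (subst (asm) has_sum_reindex_bij_betw[OF bij])
  moreover have "(\<lambda>x. norm (mult_ext G ((\<lambda>(m, k). m * q ^ k) x))) summable_on (smooth S \<times> UNIV)"
    using aF by (subst summable_on_cong[of _ _ "\<lambda>x. norm (F x)"]) (auto simp: Feq)
  hence "(\<lambda>m. norm (mult_ext G m)) summable_on smooth (insert q S)"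
    by (subst (asm) summable_on_reindex_bij_betw[OF bij, of "\<lambda>m. norm (mult_ext G m)"])
  ultimately show ?case unfolding T' by blast
qed

text \<open>At most one of the points \<open>p ^ 2, p ^ 4, \<dots>, p ^ (2 * l)\<close> is within a factor \<open>p\<close> of a given
  \<open>\<bar>A j p\<bar>\<close>. If one of the \<open>\<bar>A j p\<bar>\<close> exceeds all of them, the remaining \<open>l - 1\<close> leave one of these
  points free, and there the Euler factor is too small.\<close>

lemma euler_roots_polynomially_bounded:
  fixes A :: "nat \<Rightarrow> nat \<Rightarrow> complex"
  assumes conv: "\<And>i. i \<in> {1..l} \<Longrightarrow>
     convergent_prod (\<lambda>p. if prime p then \<Prod>j=1..l. inverse (1 - A j p / of_nat p ^ (2 * i)) else 1)"
  shows "\<exists>\<kappa>. \<forall>p j. prime p \<longrightarrow> j \<in> {1..l} \<longrightarrow> norm (A j p) \<le> real p ^ \<kappa>"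
proof -
  define f where "f = (\<lambda>i p. if prime p then \<Prod>j=1..l. inverse (1 - A j p / of_nat p ^ (2 * i)) else 1)"
  have "eventually (\<lambda>p. norm (f i p) > 1 / 2) sequentially" if "i \<in> {1..l}" for i
  proof -
    \<comment> \<open>Factors of a convergent product tend to 1. Applied at the \<open>l\<close>
      integers \<open>2 * i\<close> at once, this is the only information about the roots for large
      \<open>p\<close>.\<close>
    have "f i \<longlonglongrightarrow> 1"
      unfolding f_def using conv[OF that] by (rule convergent_prod_imp_LIMSEQ)
    hence "(\<lambda>p. norm (f i p)) \<longlonglongrightarrow> norm (1 :: complex)" by (rule tendsto_norm)
    thus ?thesis by (rule order_tendstoD) simp
  qed
  hence "eventually (\<lambda>p. \<forall>i\<in>{1..l}. norm (f i p) > 1 / 2) sequentially"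
    by (intro eventually_ball_finite) auto
  then obtain p0 where "\<forall>p\<ge>p0. \<forall>i\<in>{1..l}. norm (f i p) > 1 / 2"
    unfolding eventually_at_top_linorder by blast
  hence p0: "\<And>p i. p \<ge> p0 \<Longrightarrow> i \<in> {1..l} \<Longrightarrow> norm (f i p) > 1 / 2" by blast
  \<comment> \<open>Beyond \<open>2 ^ l + 1\<close> the factor of the exceptional root has size at
    least \<open>p - 1 \<ge> 2 ^ l\<close>, which outweighs the other factors, bounded below by
    \<open>(1 / 2) ^ (l - 1)\<close>.\<close>
  define p1 where "p1 = max p0 (2 ^ l + 1)"
  have large: "norm (A j0 p) \<le> real p ^ (2 * l + 1)" if p: "prime p" "p \<ge> p1" and j0: "j0 \<in> {1..l}" for p j0
  proof (rule ccontr)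
    assume "\<not> ?thesis"
    hence big: "norm (A j0 p) > real p ^ (2 * l + 1)" by simp
    have p2: "real p \<ge> 2" using p by (simp add: prime_ge_2_nat)
    have pl: "real p \<ge> 2 ^ l + 1"
      using of_nat_mono[of "2 ^ l + 1" p, where 'a = real] p by (simp add: p1_def)
    define Bk where "Bk = (\<lambda>i. {j \<in> {1..l} - {j0}. real p ^ (2 * i - 1) < norm (A j p) \<and> norm (A j p) < real p ^ (2 * i + 1)})"
    have "\<exists>i\<in>{1..l}. Bk i = {}"
    proof (rule ccontr)
      assume "\<not> ?thesis"
      hence "\<forall>i\<in>{1..l}. \<exists>j. j \<in> Bk i" by blast
      then obtain g where g: "\<And>i. i \<in> {1..l} \<Longrightarrow> g i \<in> Bk i" by metis
      have *: "g i \<noteq> g i'" if "i \<in> {1..l}" "i' \<in> {1..l}" "i < i'" for i i'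
      proof
        assume eq: "g i = g i'"
        have "real p ^ (2 * i + 1) \<le> real p ^ (2 * i' - 1)" using that p2 by (intro power_increasing) auto
        thus False using g[OF that(1)] g[OF that(2)] unfolding eq Bk_def by auto
      qed
      have "inj_on g {1..l}" by (rule linorder_inj_onI) (use * in auto)
      moreover have "g ` {1..l} \<subseteq> {1..l} - {j0}" using g unfolding Bk_def by blast
      ultimately have "card {1..l} \<le> card ({1..l} - {j0})" by (intro card_inj_on_le) auto
      moreover have "card ({1..l} - {j0}) < card {1..l}" using j0 by (intro card_Diff1_less) auto
      ultimately show False by linarith
    qed
    then obtain i where i: "i \<in> {1..l}" "Bk i = {}" by blast
    \<comment> \<open>At the free point the other roots give \<open>norm (x j) \<le> 1 / p\<close>
      or \<open>norm (x j) \<ge> p\<close>, hence \<open>norm (1 - x j) \<ge> 1 / 2\<close>. The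
      denominator of the Euler factor then has size at least 2, contrary to
      \<open>norm (f i p) > 1 / 2\<close>.\<close>
    define x where "x = (\<lambda>j. A j p / of_nat p ^ (2 * i))"
    have nx: "norm (x j) = norm (A j p) / real p ^ (2 * i)" for j by (simp add: x_def norm_divide norm_power)
    have tri1: "norm (1 - x j) \<ge> norm (x j) - 1" for j using norm_triangle_ineq2[of "x j" 1] by (simp add: norm_minus_commute)
    have tri2: "norm (1 - x j) \<ge> 1 - norm (x j)" for j using norm_triangle_ineq2[of 1 "x j"] by simp
    have up: "norm (x j) \<ge> real p" if "norm (A j p) \<ge> real p ^ (2 * i + 1)" for j
      using that p2 by (simp add: nx field_simps)
    have ge: "norm (1 - x j) \<ge> 1 / 2" if j: "j \<in> {1..l} - {j0}" for j
    proof -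
      have "j \<notin> Bk i" using i by simp
      then consider "norm (A j p) \<le> real p ^ (2 * i - 1)" | "norm (A j p) \<ge> real p ^ (2 * i + 1)"
        using j by (force simp: Bk_def)
      thus ?thesis
      proof cases
        case 1
        have "real p ^ (2 * i) = real p * real p ^ (2 * i - 1)"
          using i by (subst power_Suc[symmetric]) (simp del: power_Suc)
        hence "norm (x j) \<le> 1 / real p" using 1 p2 by (simp add: nx field_simps)
        also have "\<dots> \<le> 1 / 2" using p2 by (simp add: field_simps)
        finally show ?thesis using tri2[of j] by simp
      next
        case 2
        thus ?thesis using up[of j] tri1[of j] p2 by simp
      qed
    qed
    have "real p ^ (2 * i + 1) \<le> real p ^ (2 * l + 1)" using i p2 by (intro power_increasing) auto
    hence ge0: "norm (1 - x j0) \<ge> 2 ^ l" using up[of j0] big tri1[of j0] pl by simp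
    have "(1 / 2 :: real) ^ (l - 1) = (\<Prod>j\<in>{1..l} - {j0}. 1 / 2)" using j0 by simp
    also have "\<dots> \<le> (\<Prod>j\<in>{1..l} - {j0}. norm (1 - x j))" by (intro prod_mono) (use ge in auto)
    finally have "2 ^ l * (1 / 2 :: real) ^ (l - 1) \<le> norm (1 - x j0) * (\<Prod>j\<in>{1..l} - {j0}. norm (1 - x j))"
      using ge0 by (intro mult_mono) auto
    also have "\<dots> = (\<Prod>j\<in>{1..l}. norm (1 - x j))" using j0 by (subst (2) prod.remove[of _ j0]) auto
    also have "2 ^ l * (1 / 2 :: real) ^ (l - 1) = 2"
      using j0 by (cases l) (auto simp: power_divide)
    finally have "2 \<le> (\<Prod>j\<in>{1..l}. norm (1 - x j))" .
    moreover have "norm (f i p) = inverse (\<Prod>j\<in>{1..l}. norm (1 - x j))"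
      using p by (simp add: f_def x_def norm_inverse flip: prod_norm prod_inversef[unfolded o_def])
    ultimately have "norm (f i p) \<le> 1 / 2" by (simp add: field_simps)
    thus False using p0[of p i] p i by (simp add: p1_def)
  qed
  \<comment> \<open>The finitely many primes below \<open>p1\<close> are handled by an exponent
    \<open>k\<close> with \<open>M < 2 ^ k \<le> p ^ k\<close>.\<close>
  define M where "M = (\<Sum>p<p1. \<Sum>j=1..l. norm (A j p))"
  obtain k where k: "M < 2 ^ k" using real_arch_pow[of 2 M] by auto
  show ?thesis
  proof (intro exI[of _ "max k (2 * l + 1)"] allI impI)
    fix p j :: nat assume p: "prime p" and j: "j \<in> {1..l}"
    have p2: "real p \<ge> 2" using p by (simp add: prime_ge_2_nat)
    show "norm (A j p) \<le> real p ^ max k (2 * l + 1)"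
    proof (cases "p < p1")
      case True
      have "norm (A j p) \<le> (\<Sum>j=1..l. norm (A j p))" using j by (intro member_le_sum) auto
      also have "\<dots> \<le> M" unfolding M_def using True
        by (intro member_le_sum[of p "{..<p1}" "\<lambda>p. \<Sum>j=1..l. norm (A j p)"]) (auto intro!: sum_nonneg)
      also have "\<dots> \<le> 2 ^ k" using k by simp
      also have "\<dots> \<le> real p ^ k" using p2 by (intro power_mono) auto
      also have "\<dots> \<le> real p ^ max k (2 * l + 1)" using p2 by (intro power_increasing) auto
      finally show ?thesis .
    next
      case False
      hence "norm (A j p) \<le> real p ^ (2 * l + 1)" using large p j by auto
      also have "\<dots> \<le> real p ^ max k (2 * l + 1)" using p2 by (intro power_increasing) auto
      finally show ?thesis .
    qed
  qed
qed

text \<open>The formal expansion of \<open>1 / (1 - c X)\<close>. Working with formal series gives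
  the coefficients of the Euler factors a meaning before any bound on the roots, and thus
  convergence, is known.\<close>

definition geo_fps :: "complex \<Rightarrow> complex fps" where "geo_fps c = Abs_fps (\<lambda>k. c ^ k)"

lemma geo_fps_inverse: "(1 - fps_const c * fps_X) * geo_fps c = 1"
  by (rule fps_ext) (auto simp: geo_fps_def left_diff_distrib mult.assoc fps_mult_left_const_nth split: nat.splits simp flip: power_Suc)

lemma prod_geo_fps_nth_0: "fps_nth (\<Prod>j\<in>J. geo_fps (A j)) 0 = 1"
  by (induction J rule: infinite_finite_induct) (auto simp: geo_fps_def)

lemma prod_geo_fps_nth_1: "finite J \<Longrightarrow> fps_nth (\<Prod>j\<in>J. geo_fps (A j)) (Suc 0) = (\<Sum>j\<in>J. A j)"
  by (induction J rule: finite_induct) (auto simp: fps_mult_nth prod_geo_fps_nth_0, auto simp: geo_fps_def)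

text \<open>The induction step that adds one root in \<open>prod_geo_fps_bound\<close>, where
  \<open>d\<close> is the number of roots present so far.\<close>

lemma sum_powers_le: "(d :: real) \<ge> 0 \<Longrightarrow> (\<Sum>i=0..k. d ^ (k - i)) \<le> (1 + d) ^ k"
proof (induction k)
  case (Suc k)
  have "(\<Sum>i=0..Suc k. d ^ (Suc k - i)) = d * (\<Sum>i=0..k. d ^ (k - i)) + 1"
    by (simp add: sum_distrib_left Suc_diff_le)
  also have "\<dots> \<le> d * (1 + d) ^ k + (1 + d) ^ k"
    using Suc by (intro add_mono mult_left_mono) (auto intro: one_le_power)
  finally show ?case by (simp add: algebra_simps)
qed auto

lemma prod_geo_fps_bound:
  assumes "finite J" "\<And>j. j \<in> J \<Longrightarrow> norm (A j) \<le> R"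
  shows "norm (fps_nth (\<Prod>j\<in>J. geo_fps (A j)) k) \<le> (real (card J) * R) ^ k"
  using assms
proof (induction J arbitrary: k rule: finite_induct)
  case (insert j J)
  have R: "R \<ge> 0" using order.trans[OF norm_ge_zero insert.prems[of j]] by simp
  have "norm (fps_nth (\<Prod>j\<in>insert j J. geo_fps (A j)) k) = norm (\<Sum>i=0..k. A j ^ i * fps_nth (\<Prod>j\<in>J. geo_fps (A j)) (k - i))"
    using insert.hyps by (simp add: fps_mult_nth geo_fps_def)
  also have "\<dots> \<le> (\<Sum>i=0..k. R ^ i * (real (card J) * R) ^ (k - i))"
    using insert R by (intro sum_norm_le) (auto simp: norm_mult norm_power intro!: mult_mono power_mono)
  also have "\<dots> = R ^ k * (\<Sum>i=0..k. real (card J) ^ (k - i))"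
    unfolding sum_distrib_left by (intro sum.cong) (auto simp: power_mult_distrib simp flip: power_add)
  also have "\<dots> \<le> R ^ k * (1 + real (card J)) ^ k"
    using R by (intro mult_left_mono sum_powers_le) auto
  finally show ?case using insert.hyps by (simp add: power_mult_distrib mult_ac)
qed auto

text \<open>Roots are added one at a time by Cauchy products; the smallness condition is the one
  under which the geometric majorant from \<open>prod_geo_fps_bound\<close> converges.\<close>

lemma prod_geo_fps_sums:
  assumes "finite J" "\<And>j. j \<in> J \<Longrightarrow> norm (A j) \<le> R" "R \<ge> 0" "real (card J) * R * norm X < 1"
  shows "summable (\<lambda>k. norm (fps_nth (\<Prod>j\<in>J. geo_fps (A j)) k * X ^ k)) \<and>
         (\<lambda>k. fps_nth (\<Prod>j\<in>J. geo_fps (A j)) k * X ^ k) sums (\<Prod>j\<in>J. inverse (1 - A j * X))"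
proof -
  have sm: "summable (\<lambda>k. norm (fps_nth (\<Prod>j\<in>J. geo_fps (A j)) k * X ^ k))"
    if "finite J" "\<And>j. j \<in> J \<Longrightarrow> norm (A j) \<le> R" "real (card J) * R * norm X < 1" for J
  proof (rule summable_comparison_test)
    show "summable (\<lambda>k. (real (card J) * R * norm X) ^ k)"
      using that assms(3) by (intro summable_geometric) auto
    show "\<exists>N. \<forall>k\<ge>N. norm (norm (fps_nth (\<Prod>j\<in>J. geo_fps (A j)) k * X ^ k)) \<le> (real (card J) * R * norm X) ^ k"
      using prod_geo_fps_bound[OF that(1,2)]
      by (auto simp: norm_mult norm_power power_mult_distrib[of _ "norm X"] intro!: mult_right_mono exI[of _ 0])
  qed
  have "(\<lambda>k. fps_nth (\<Prod>j\<in>J. geo_fps (A j)) k * X ^ k) sums (\<Prod>j\<in>J. inverse (1 - A j * X))"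
    using assms
  proof (induction J rule: finite_induct)
    case empty
    have "(\<lambda>k. fps_nth 1 k * X ^ k) sums (\<Sum>k\<in>{0}. fps_nth 1 k * X ^ k)"
      by (rule sums_finite) auto
    thus ?case by simp
  next
    case (insert j J)
    have J: "real (card J) * R * norm X < 1"
      using insert.hyps insert.prems by (intro le_less_trans[OF _ insert.prems(3)] mult_right_mono) auto
    have "norm (A j) * norm X \<le> real (card (insert j J)) * R * norm X"
      using insert.prems(1)[of j] insert.hyps insert.prems(2) by (intro mult_right_mono) (auto simp: distrib_right intro: add_increasing2)
    hence jX: "norm (A j * X) < 1" using insert.prems(3) by (simp add: norm_mult)
    have "(\<lambda>k. \<Sum>i\<le>k. (A j * X) ^ i * (fps_nth (\<Prod>j\<in>J. geo_fps (A j)) (k - i) * X ^ (k - i))) sums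
            ((\<Sum>k. (A j * X) ^ k) * (\<Sum>k. fps_nth (\<Prod>j\<in>J. geo_fps (A j)) k * X ^ k))"
      using jX by (intro Cauchy_product_sums sm insert.hyps insert.prems J) (auto simp: norm_power norm_mult intro: summable_geometric)
    also have "(\<lambda>k. \<Sum>i\<le>k. (A j * X) ^ i * (fps_nth (\<Prod>j\<in>J. geo_fps (A j)) (k - i) * X ^ (k - i))) =
       (\<lambda>k. fps_nth (\<Prod>j\<in>insert j J. geo_fps (A j)) k * X ^ k)"
    proof
      fix k
      have "(A j * X) ^ i * (fps_nth (\<Prod>j\<in>J. geo_fps (A j)) (k - i) * X ^ (k - i)) =
            A j ^ i * fps_nth (\<Prod>j\<in>J. geo_fps (A j)) (k - i) * X ^ k" if "i \<in> {..k}" for i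
      proof -
        have "X ^ k = X ^ i * X ^ (k - i)" using that by (simp flip: power_add)
        thus ?thesis by (simp only: power_mult_distrib mult_ac)
      qed
      hence "(\<Sum>i\<le>k. (A j * X) ^ i * (fps_nth (\<Prod>j\<in>J. geo_fps (A j)) (k - i) * X ^ (k - i))) =
         (\<Sum>i\<le>k. A j ^ i * fps_nth (\<Prod>j\<in>J. geo_fps (A j)) (k - i) * X ^ k)"
        by (rule sum.cong[OF refl])
      also have "\<dots> = fps_nth (geo_fps (A j) * (\<Prod>j\<in>J. geo_fps (A j))) k * X ^ k"
        unfolding fps_mult_nth sum_distrib_right atLeast0AtMost by (simp add: geo_fps_def)
      also have "geo_fps (A j) * (\<Prod>j\<in>J. geo_fps (A j)) = (\<Prod>j\<in>insert j J. geo_fps (A j))"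
        using insert.hyps by simp
      finally show "(\<Sum>i\<le>k. (A j * X) ^ i * (fps_nth (\<Prod>j\<in>J. geo_fps (A j)) (k - i) * X ^ (k - i))) =
         fps_nth (\<Prod>j\<in>insert j J. geo_fps (A j)) k * X ^ k" .
    qed
    also have "(\<Sum>k. (A j * X) ^ k) = inverse (1 - A j * X)"
      using jX by (simp add: suminf_geometric inverse_eq_divide)
    also have "(\<Sum>k. fps_nth (\<Prod>j\<in>J. geo_fps (A j)) k * X ^ k) = (\<Prod>j\<in>J. inverse (1 - A j * X))"
      using insert J by (intro sums_unique[symmetric] insert.IH) auto
    finally show ?case using insert.hyps by simp
  qed
  thus ?thesis using sm assms by blast
qed

lemma mult_ext_bound:
  assumes "\<And>p k. prime p \<Longrightarrow> norm (g p k) \<le> (real p ^ \<kappa>) ^ k" "m > 0"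
  shows "norm (mult_ext g m) \<le> real m ^ \<kappa>"
proof -
  have "norm (mult_ext g m) \<le> (\<Prod>p\<in>prime_factors m. (real p ^ \<kappa>) ^ multiplicity p m)"
    using assms by (auto simp: mult_ext_def simp flip: prod_norm intro!: prod_mono)
  also have "\<dots> = real (\<Prod>p\<in>prime_factors m. p ^ multiplicity p m) ^ \<kappa>"
    by (simp add: prod_power_distrib power_mult[symmetric] mult.commute)
  also have "(\<Prod>p\<in>prime_factors m. p ^ multiplicity p m) = m"
    using assms by (intro prime_factorization_nat[symmetric]) auto
  finally show ?thesis .
qed

lemma mult_ext_scale:
  assumes "m > 0"
  shows "mult_ext (\<lambda>p k. g p k / of_nat (p ^ k) ^ n) m = mult_ext g m / of_nat m ^ n"
proof -
  have "mult_ext (\<lambda>p k. g p k / of_nat (p ^ k) ^ n) m = mult_ext g m / of_nat (\<Prod>p\<in>prime_factors m. p ^ multiplicity p m) ^ n"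
    using assms by (simp add: mult_ext_def prod_dividef prod_power_distrib)
  also have "(\<Prod>p\<in>prime_factors m. p ^ multiplicity p m) = m"
    using assms by (intro prime_factorization_nat[symmetric]) auto
  finally show ?thesis .
qed

text \<open>A partial product over the primes below \<open>M\<close> is the sum over the integers
  composed of these primes. Each \<open>m < M\<close> with \<open>m > 0\<close> is among them, and
  absolute summability is the majorant for exchanging limit and sum.\<close>

lemma euler_product_sums:
  fixes G :: "nat \<Rightarrow> nat \<Rightarrow> complex"
  assumes G0: "\<And>p. G p 0 = 1"
  assumes sm: "\<And>p. prime p \<Longrightarrow> summable (\<lambda>k. norm (G p k))"
  assumes sm': "summable (\<lambda>m. norm (mult_ext G m))"
  shows "(\<lambda>M. \<Prod>p<M. if prime p then \<Sum>k. G p k else 1) \<longlonglongrightarrow> (\<Sum>m. mult_ext G m)"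
proof -
  define S where "S = (\<lambda>M. {p. p < M \<and> prime (p :: nat)})"
  define a where "a = (\<lambda>m M. if m \<in> smooth (S M) then mult_ext G m else 0)"
  have "(\<lambda>m. a m M) sums (\<Prod>p\<in>S M. \<Sum>k. G p k)" for M
  proof -
    have "(mult_ext G has_sum (\<Prod>p\<in>S M. \<Sum>k. G p k)) (smooth (S M))"
      by (rule conjunct2[OF has_sum_smooth[of G "S M"]]) (auto simp: S_def G0 sm)
    also have "(mult_ext G has_sum (\<Prod>p\<in>S M. \<Sum>k. G p k)) (smooth (S M)) \<longleftrightarrow>
               ((\<lambda>m. a m M) has_sum (\<Prod>p\<in>S M. \<Sum>k. G p k)) UNIV"
      by (rule has_sum_cong_neutral) (auto simp: a_def)
    finally show ?thesis by (rule has_sum_imp_sums)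
  qed
  hence "(\<Sum>m. a m M) = (\<Prod>p\<in>S M. \<Sum>k. G p k)" for M by (rule sums_unique[symmetric])
  also have "(\<Prod>p\<in>S M. \<Sum>k. G p k) = (\<Prod>p<M. if prime p then \<Sum>k. G p k else 1)" for M
    by (subst prod.inter_filter[symmetric]) (auto simp: S_def intro!: prod.cong)
  finally have eq: "(\<Sum>m. a m M) = (\<Prod>p<M. if prime p then \<Sum>k. G p k else 1)" for M .
  have "((\<lambda>M. a m M) \<longlongrightarrow> mult_ext G m) sequentially" for m
  proof (rule tendsto_eventually)
    show "eventually (\<lambda>M. a m M = mult_ext G m) sequentially"
      using eventually_gt_at_top[of m]
    proof eventually_elim
      case (elim M)
      show ?case
      proof (cases "m = 0")
        case False
        hence "prime_factors m \<subseteq> S M"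
          using elim by (auto simp: S_def prime_factors_dvd dest!: dvd_imp_le)
        thus ?thesis using False by (simp add: a_def smooth_def)
      qed (simp add: a_def mult_ext_def)
    qed
  qed
  moreover have "eventually (\<lambda>(m, M). norm (a m M) \<le> norm (mult_ext G m)) (at_top \<times>\<^sub>F sequentially)"
    by (intro always_eventually) (auto simp: a_def)
  ultimately have "(\<lambda>M. \<Sum>m. a m M) \<longlonglongrightarrow> (\<Sum>m. mult_ext G m)"
    using tannerys_theorem[OF _ _ sm', of a "mult_ext G" sequentially] by simp
  thus ?thesis unfolding eq .
qed

text \<open>The hypotheses are stated at integer points only, which is enough to identify the coefficients.\<close>

lemma euler_product_coeffs:
  fixes a :: "nat \<Rightarrow> complex" and A :: "nat \<Rightarrow> nat \<Rightarrow> complex" and \<phi> :: "nat \<Rightarrow> complex"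
  assumes bd: "\<And>m. m > 0 \<Longrightarrow> norm (a m) \<le> C * real m ^ K"
  assumes sums: "\<And>n. n \<ge> 2 \<Longrightarrow> (\<lambda>m. a (Suc m) / of_nat (Suc m) ^ n) sums \<phi> n"
  assumes prod: "\<And>n. n \<ge> 2 \<Longrightarrow>
     (\<lambda>p. if prime p then \<Prod>j=1..l. inverse (1 - A j p / of_nat p ^ n) else 1) has_prod \<phi> n"
  assumes m: "m > 0"
  shows "a m = mult_ext (\<lambda>p k. fps_nth (\<Prod>j=1..l. geo_fps (A j p)) k) m"
proof -
  define g where "g = (\<lambda>p k. fps_nth (\<Prod>j=1..l. geo_fps (A j p)) k)"
  have "\<exists>\<kappa>. \<forall>p j. prime p \<longrightarrow> j \<in> {1..l} \<longrightarrow> norm (A j p) \<le> real p ^ \<kappa>"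
  proof (rule euler_roots_polynomially_bounded)
    show "convergent_prod (\<lambda>p. if prime p then \<Prod>j=1..l. inverse (1 - A j p / of_nat p ^ (2 * i)) else 1)"
      if "i \<in> {1..l}" for i
      using prod[of "2 * i"] that unfolding has_prod_def convergent_prod_def by auto
  qed
  then obtain \<kappa>0 where \<kappa>0: "\<And>p j. prime p \<Longrightarrow> j \<in> {1..l} \<Longrightarrow> norm (A j p) \<le> real p ^ \<kappa>0" by blast
  \<comment> \<open>The number \<open>l\<close> of roots, which enters through
    \<open>prod_geo_fps_bound\<close>, is absorbed by
    \<open>l \<le> 2 ^ l \<le> p ^ l\<close>.\<close>
  define \<kappa> where "\<kappa> = \<kappa>0 + l"
  have lp: "real l * real p ^ \<kappa>0 \<le> real p ^ \<kappa>" if "prime p" for p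
  proof -
    have "real l \<le> 2 ^ l" using of_nat_less_two_power[of l, where 'a = real] by simp
    also have "\<dots> \<le> real p ^ l" using prime_ge_2_nat[OF that] by (intro power_mono) auto
    finally have "real l * real p ^ \<kappa>0 \<le> real p ^ l * real p ^ \<kappa>0" by (intro mult_right_mono) auto
    thus ?thesis by (simp only: \<kappa>_def power_add mult.commute)
  qed
  have g_bd: "norm (g p k) \<le> (real p ^ \<kappa>) ^ k" if "prime p" for p k
  proof -
    have "norm (g p k) \<le> (real (card {1..l}) * real p ^ \<kappa>0) ^ k"
      unfolding g_def by (rule prod_geo_fps_bound) (use \<kappa>0 that in auto)
    also have "\<dots> \<le> (real p ^ \<kappa>) ^ k" using lp[OF that] by (intro power_mono) auto
    finally show ?thesis .
  qed
  have g_bd': "norm (mult_ext g m) \<le> real m ^ \<kappa>" if "m > 0" for m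
    by (rule mult_ext_bound) (use g_bd that in auto)
  \<comment> \<open>For these \<open>n\<close> the local series converge at every prime because
    \<open>p ^ \<kappa> < p ^ n\<close>, and the global one is dominated by
    \<open>1 / m ^ 2\<close>.\<close>
  have eq: "\<phi> n = (\<Sum>m. mult_ext g (Suc m) / of_nat (Suc m) ^ n) \<and> summable (\<lambda>m. mult_ext g (Suc m) / of_nat (Suc m) ^ n)"
    if n: "n \<ge> \<kappa> + 2" for n
  proof -
    define G where "G = (\<lambda>p k. g p k / of_nat (p ^ k) ^ n)"
    have G0: "G p 0 = 1" for p by (simp add: G_def g_def prod_geo_fps_nth_0)
    have GX: "G p k = g p k * (1 / of_nat p ^ n) ^ k" for p k
      by (simp add: G_def power_divide mult.commute flip: power_mult)
    have loc: "summable (\<lambda>k. norm (G p k)) \<and> G p sums (\<Prod>j=1..l. inverse (1 - A j p * (1 / of_nat p ^ n)))"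
      if p: "prime p" for p
      unfolding GX g_def
    proof (rule prod_geo_fps_sums[where R = "real p ^ \<kappa>0"])
      have "real (card {1..l}) * real p ^ \<kappa>0 * norm (1 / of_nat p ^ n :: complex) \<le> real p ^ \<kappa> / real p ^ n"
        using lp[OF p] by (simp add: norm_divide norm_power divide_right_mono)
      also have "\<dots> < 1" using n prime_ge_2_nat[OF p] by (simp add: power_strict_increasing)
      finally show "real (card {1..l}) * real p ^ \<kappa>0 * norm (1 / of_nat p ^ n :: complex) < 1" .
    qed (use \<kappa>0 p in auto)
    have sc: "mult_ext G m = mult_ext g m / of_nat m ^ n" for m
      unfolding G_def using mult_ext_scale[of m g n] by (cases "m = 0") (auto simp: mult_ext_def)
    have sm: "summable (\<lambda>m. norm (mult_ext G m))"
    proof (rule summable_comparison_test)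
      show "summable (\<lambda>m. inverse (real m ^ 2))" by (rule inverse_power_summable) auto
      have "norm (mult_ext G m) \<le> inverse (real m ^ 2)" for m
      proof (cases "m = 0")
        case False
        have "norm (mult_ext G m) \<le> real m ^ \<kappa> / real m ^ n"
          unfolding sc using g_bd'[of m] False by (simp add: norm_divide norm_power divide_right_mono)
        also have "\<dots> \<le> real m ^ \<kappa> / real m ^ (\<kappa> + 2)"
          using n False by (intro divide_left_mono power_increasing) auto
        also have "\<dots> = inverse (real m ^ 2)" using False by (simp add: power_add field_simps power2_eq_square)
        finally show ?thesis .
      qed (simp add: mult_ext_def)
      thus "\<exists>N. \<forall>m\<ge>N. norm (norm (mult_ext G m)) \<le> inverse (real m ^ 2)" by simp
    qed
    have "(\<lambda>M. \<Prod>p<M. if prime p then \<Sum>k. G p k else 1) \<longlonglongrightarrow> (\<Sum>m. mult_ext G m)"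
      by (rule euler_product_sums[OF G0 _ sm]) (use loc in blast)
    also have "(\<lambda>p. if prime p then \<Sum>k. G p k else 1) = (\<lambda>p. if prime p then \<Prod>j=1..l. inverse (1 - A j p / of_nat p ^ n) else 1)"
      using loc by (intro ext if_cong refl) (auto dest!: sums_unique[symmetric])
    finally have "(\<lambda>M. \<Prod>p<M. if prime p then \<Prod>j=1..l. inverse (1 - A j p / of_nat p ^ n) else 1) \<longlonglongrightarrow> (\<Sum>m. mult_ext G m)" .
    moreover have "(\<lambda>M. \<Prod>p<M. if prime p then \<Prod>j=1..l. inverse (1 - A j p / of_nat p ^ n) else 1) \<longlonglongrightarrow> \<phi> n"
      using prod[of n] n by (intro has_prod_imp_tendsto') auto
    ultimately have "\<phi> n = (\<Sum>m. mult_ext G m)" using LIMSEQ_unique by blast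
    moreover have "summable (mult_ext G)" using sm by (rule summable_norm_cancel)
    moreover from this have "summable (\<lambda>m. mult_ext G (Suc m))" by (simp only: summable_Suc_iff)
    moreover have "mult_ext G 0 = 0" by (simp add: mult_ext_def)
    ultimately have "\<phi> n = (\<Sum>m. mult_ext G (Suc m)) \<and> summable (\<lambda>m. mult_ext G (Suc m))"
      using suminf_split_head[of "mult_ext G"] by simp
    thus ?thesis unfolding sc .
  qed
  define d where "d = (\<lambda>m. a m - mult_ext g m)"
  have "d m = 0"
  proof (rule dirichlet_coeffs_zero[OF _ _ m])
    fix m :: nat assume m: "m > 0"
    have "norm (d m) \<le> norm (a m) + norm (mult_ext g m)" unfolding d_def by (rule norm_triangle_ineq4)
    also have "\<dots> \<le> C * real m ^ K + 1 * real m ^ \<kappa>" using bd[OF m] g_bd'[OF m] by simp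
    also have "\<dots> \<le> \<bar>C\<bar> * real m ^ (K + \<kappa>) + 1 * real m ^ (K + \<kappa>)"
      using m by (intro add_mono mult_mono power_increasing) auto
    finally show "norm (d m) \<le> (\<bar>C\<bar> + 1) * real m ^ (K + \<kappa>)" by (simp add: distrib_right)
  next
    fix n assume n: "n \<ge> \<kappa> + 2"
    have "(\<lambda>m. a (Suc m) / of_nat (Suc m) ^ n - mult_ext g (Suc m) / of_nat (Suc m) ^ n) sums (\<phi> n - \<phi> n)"
      using sums[of n] eq[OF n] n by (intro sums_diff) (auto simp: summable_sums)
    thus "(\<lambda>m. d (Suc m) / of_nat (Suc m) ^ n) sums 0" by (simp add: d_def diff_divide_distrib del: of_nat_Suc)
  qed
  thus ?thesis by (simp add: d_def g_def)
qed

text \<open>A root with \<open>\<bar>A j0\<bar> > 1\<close> would be a pole of the local factor in the open unit disc,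
  on which its power series converges.\<close>

lemma euler_root_le_1:
  fixes A :: "nat \<Rightarrow> complex"
  assumes p: "p \<ge> (2 :: real)" and J: "finite J" "j0 \<in> J"
  assumes bd: "\<And>\<epsilon>. \<epsilon> > 0 \<Longrightarrow> \<exists>C. \<forall>k. norm (fps_nth (\<Prod>j\<in>J. geo_fps (A j)) k) \<le> C * (p ^ k) powr \<epsilon>"
  shows "norm (A j0) \<le> 1"
proof (rule ccontr)
  assume *: "\<not> ?thesis"
  \<comment> \<open>The square root separates two radii: the root gives a pole at distance
    \<open>1 / B ^ 2\<close> from 0, strictly inside the radius \<open>1 / B\<close> on which
    convergence is shown.\<close>
  define B where "B = sqrt (norm (A j0))"
  have B: "B > 1" using * by (simp add: B_def)
  have BA: "norm (A j0) = B ^ 2" by (simp add: B_def)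
  define F where "F = (\<Prod>j\<in>J. geo_fps (A j))"
  define q where "q = (\<Prod>j\<in>J. [:1, - A j:])"
  define X where "X = 1 / A j0"
  have A0: "A j0 \<noteq> 0" using BA B by auto
  \<comment> \<open>Chosen so that \<open>p powr \<epsilon> = sqrt B\<close>; at radius
    \<open>1 / B\<close> the terms are then bounded by a geometric sequence with ratio
    \<open>1 / sqrt B\<close>.\<close>
  define \<epsilon> where "\<epsilon> = ln B / (2 * ln p)"
  have \<epsilon>: "\<epsilon> > 0" using B p by (simp add: \<epsilon>_def)
  obtain C where C: "\<And>k. norm (fps_nth F k) \<le> C * (p ^ k) powr \<epsilon>" using bd[OF \<epsilon>] unfolding F_def by blast
  have pk: "(p ^ k) powr \<epsilon> = sqrt B ^ k" for k
  proof -
    have "p powr \<epsilon> = sqrt B" using p B by (simp add: \<epsilon>_def powr_def ln_sqrt[symmetric])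
    moreover have "(p ^ k) powr \<epsilon> = (p powr \<epsilon>) ^ k"
      using p by (simp add: powr_powr mult.commute flip: powr_realpow)
    ultimately show ?thesis by simp
  qed
  have "summable (\<lambda>k. fps_nth F k * of_real (1 / B) ^ k)"
  proof (rule summable_comparison_test)
    show "summable (\<lambda>k. C * (1 / sqrt B) ^ k)"
      using B by (intro summable_mult summable_geometric) auto
    have "norm (fps_nth F k * of_real (1 / B) ^ k) \<le> C * (1 / sqrt B) ^ k" for k
    proof -
      have "norm (fps_nth F k * of_real (1 / B) ^ k) = norm (fps_nth F k) * (1 / B) ^ k"
        using B by (simp add: norm_mult norm_power norm_divide)
      also have "\<dots> \<le> (C * sqrt B ^ k) * (1 / B) ^ k"
        using C[of k] B unfolding pk by (intro mult_right_mono) auto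
      also have "\<dots> = C * (sqrt B * (1 / B)) ^ k" by (simp only: power_mult_distrib mult.assoc)
      also have "sqrt B * (1 / B) = 1 / sqrt B" using B by (simp add: real_div_sqrt field_simps)
      finally show ?thesis .
    qed
    thus "\<exists>N. \<forall>k\<ge>N. norm (fps_nth F k * of_real (1 / B) ^ k) \<le> C * (1 / sqrt B) ^ k" by blast
  qed
  hence "fps_conv_radius F \<ge> norm (of_real (1 / B) :: complex)"
    unfolding fps_conv_radius_def by (rule conv_radius_geI)
  moreover have "norm X < norm (of_real (1 / B) :: complex)"
  proof -
    have "B < B ^ 2" using B power_strict_increasing[of 1 2 B] by simp
    thus ?thesis using B by (simp add: X_def norm_divide BA field_simps)
  qed
  ultimately have rad: "ereal (norm X) < fps_conv_radius F"
    by (metis less_ereal.simps(1) less_le_trans)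
  \<comment> \<open>The polynomial \<open>q\<close> is the reciprocal of the local factor and
    vanishes at \<open>X\<close>, so evaluating this identity at \<open>X\<close> turns it into
    \<open>1 = 0\<close>.\<close>
  have "fps_of_poly q * F = 1"
  proof -
    have "fps_of_poly q = (\<Prod>j\<in>J. 1 - fps_const (A j) * fps_X)"
      unfolding q_def fps_of_poly_prod by (intro prod.cong refl) (simp add: fps_of_poly_pCons)
    thus ?thesis unfolding F_def by (simp add: geo_fps_inverse flip: prod.distrib)
  qed
  hence "1 = eval_fps (fps_of_poly q * F) X" by simp
  also have "\<dots> = poly q X * eval_fps F X"
    using rad by (subst eval_fps_mult) auto
  also have "poly q X = 0"
    using J A0 by (auto simp: q_def poly_prod X_def)
  finally show False by simp
qed

lemma bigo_powr_imp_bound: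
  fixes a :: "nat \<Rightarrow> complex"
  assumes "(\<lambda>m. norm (a m)) \<in> O(\<lambda>m. real m powr \<epsilon>)" "\<epsilon> \<ge> 0"
  shows "\<exists>C. \<forall>m>0. norm (a m) \<le> C * real m powr \<epsilon>"
proof -
  obtain c where c: "c > 0" "eventually (\<lambda>m. norm (norm (a m)) \<le> c * norm (real m powr \<epsilon>)) sequentially"
    using landau_o.bigE[OF assms(1)] by blast
  then obtain M where M: "\<And>m. m \<ge> M \<Longrightarrow> norm (a m) \<le> c * real m powr \<epsilon>"
    unfolding eventually_at_top_linorder by auto
  define C where "C = c + (\<Sum>m<M. norm (a m))"
  have C: "C \<ge> c" unfolding C_def by (simp add: sum_nonneg)
  have "norm (a m) \<le> C * real m powr \<epsilon>" if "m > 0" for m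
  proof (cases "m < M")
    case True
    have "norm (a m) \<le> (\<Sum>m<M. norm (a m))" using True by (intro member_le_sum) auto
    also have "\<dots> \<le> C * 1" using c by (simp add: C_def)
    also have "\<dots> \<le> C * real m powr \<epsilon>"
      using that assms(2) C c(1) by (intro mult_left_mono ge_one_powr_ge_zero) auto
    finally show ?thesis .
  next
    case False
    hence "norm (a m) \<le> c * real m powr \<epsilon>" by (intro M) auto
    also have "\<dots> \<le> C * real m powr \<epsilon>" using C by (intro mult_right_mono) auto
    finally show ?thesis .
  qed
  thus ?thesis by blast
qed

text \<open>At a fixed prime the numbers \<open>a (p ^ k)\<close> are the coefficients of the local
  factor. Their growth in \<open>k\<close>, slower than every \<open>p ^ (k * \<epsilon>)\<close>,
  bounds the roots, and the case \<open>k = 1\<close> gives their sum.\<close>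

lemma euler_product_roots:
  fixes a :: "nat \<Rightarrow> complex" and A :: "nat \<Rightarrow> nat \<Rightarrow> complex" and \<phi> :: "nat \<Rightarrow> complex"
  assumes bigo: "\<And>\<epsilon>. \<epsilon> > 0 \<Longrightarrow> (\<lambda>m. norm (a m)) \<in> O(\<lambda>m. real m powr \<epsilon>)"
  assumes sums: "\<And>n. n \<ge> 2 \<Longrightarrow> (\<lambda>m. a (Suc m) / of_nat (Suc m) ^ n) sums \<phi> n"
  assumes prod: "\<And>n. n \<ge> 2 \<Longrightarrow>
     (\<lambda>p. if prime p then \<Prod>j=1..l. inverse (1 - A j p / of_nat p ^ n) else 1) has_prod \<phi> n"
  assumes p: "prime p"
  shows "j \<in> {1..l} \<Longrightarrow> norm (A j p) \<le> 1" and "a p = (\<Sum>j=1..l. A j p)"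
proof -
  define g where "g = (\<lambda>p k. fps_nth (\<Prod>j=1..l. geo_fps (A j p)) k)"
  obtain C where C: "\<And>m. m > 0 \<Longrightarrow> norm (a m) \<le> C * real m powr 1"
    using bigo_powr_imp_bound[OF bigo[of 1]] by auto
  have a: "a m = mult_ext g m" if "m > 0" for m
    unfolding g_def by (rule euler_product_coeffs[OF _ sums prod that, where C = C and K = 1]) (use C in auto)
  have ap: "a (p ^ k) = g p k" for k
    using a[of "p ^ k"] p mult_ext_prime_power[of p g k] by (simp add: prime_gt_0_nat g_def prod_geo_fps_nth_0)
  show "a p = (\<Sum>j=1..l. A j p)"
    using ap[of 1] by (simp add: g_def prod_geo_fps_nth_1)
  assume j: "j \<in> {1..l}"
  show "norm (A j p) \<le> 1"
  proof (rule euler_root_le_1[where p = "real p" and J = "{1..l}" and A = "\<lambda>j. A j p"])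
    show "\<exists>C. \<forall>k. norm (fps_nth (\<Prod>j\<in>{1..l}. geo_fps (A j p)) k) \<le> C * (real p ^ k) powr \<epsilon>" if e: "\<epsilon> > 0" for \<epsilon>
    proof -
      obtain C where C: "\<And>m. m > 0 \<Longrightarrow> norm (a m) \<le> C * real m powr \<epsilon>"
        using bigo_powr_imp_bound[OF bigo[OF e]] e by auto
      have "norm (a (p ^ k)) \<le> C * real (p ^ k) powr \<epsilon>" for k
        using C[of "p ^ k"] p by (simp only: zero_less_power prime_gt_0_nat)
      thus ?thesis unfolding ap g_def by auto
    qed
  qed (use p j prime_ge_2_nat[of p] in auto)
qed

subsection \<open>Sums over primes and prime powers\<close>

text \<open>The product \<open>(1 - x) * (1 + 2 * x)\<close> equals
  \<open>1 + x * (1 - 2 * x)\<close>. The range suits \<open>x = 1 / p\<close> for every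
  prime.\<close>

lemma inverse_one_minus_le_exp:
  assumes "0 \<le> x" "x \<le> (1 / 2 :: real)"
  shows "1 / (1 - x) \<le> exp (2 * x)"
proof -
  have "1 \<le> (1 - x) * (1 + 2 * x)"
    using assms mult_left_mono[of x "1 / 2" x] by (simp add: algebra_simps)
  also have "\<dots> \<le> (1 - x) * exp (2 * x)"
    using assms exp_ge_add_one_self[of "2 * x"] by (intro mult_left_mono) auto
  finally show ?thesis using assms by (simp add: field_simps)
qed

text \<open>Euler's argument: the finite product of the \<open>1 / (1 - 1 / p)\<close> over
  \<open>p < M\<close> dominates the harmonic sum up to \<open>M\<close>, and it would stay
  bounded.\<close>

lemma not_summable_prime_reciprocals: "\<not> summable (\<lambda>p. if prime p then 1 / real p else 0)"
proof
  assume sm: "summable (\<lambda>p. if prime p then 1 / real p else 0)"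
  define B where "B = exp (2 * (\<Sum>p. if prime p then 1 / real p else 0))"
  define G :: "nat \<Rightarrow> nat \<Rightarrow> complex" where "G = (\<lambda>p k. 1 / of_nat (p ^ k) ^ 1)"
  have Gm: "mult_ext G m = of_real (1 / real m)" if "m > 0" for m
    using mult_ext_scale[of m "\<lambda>_ _. 1" 1] that by (simp add: G_def mult_ext_def)
  have Gs: "G p sums of_real (1 / (1 - 1 / real p)) \<and> summable (\<lambda>k. norm (G p k))" if p: "prime p" for p
  proof -
    have n: "norm (1 / of_nat p :: complex) < 1" using prime_gt_1_nat[OF p] by (simp add: norm_divide)
    have "G p = (\<lambda>k. (1 / of_nat p) ^ k)" by (rule ext) (simp add: G_def power_divide)
    thus ?thesis using geometric_sums[OF n] n by (auto simp: norm_power intro!: summable_geometric)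
  qed
  have "(\<Sum>m<M. inverse (real m)) \<le> B" for M
  proof -
    define S where "S = {p. p < M \<and> prime p}"
    have S: "finite S" "\<And>p. p \<in> S \<Longrightarrow> prime p" by (auto simp: S_def)
    have "(mult_ext G has_sum (\<Prod>p\<in>S. \<Sum>k. G p k)) (smooth S)"
      by (rule conjunct2[OF has_sum_smooth]) (use S Gs in \<open>auto simp: G_def\<close>)
    also have "(\<Prod>p\<in>S. \<Sum>k. G p k) = of_real (\<Prod>p\<in>S. 1 / (1 - 1 / real p))"
      unfolding of_real_prod using S Gs by (intro prod.cong refl sums_unique[symmetric]) auto
    finally have "((\<lambda>m. Re (mult_ext G m)) has_sum Re (of_real (\<Prod>p\<in>S. 1 / (1 - 1 / real p)))) (smooth S)"
      by (rule has_sum_Re)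
    hence hs: "((\<lambda>m. Re (mult_ext G m)) has_sum (\<Prod>p\<in>S. 1 / (1 - 1 / real p))) (smooth S)" by (simp only: Re_complex_of_real)
    have "(\<Sum>m<M. inverse (real m)) = (\<Sum>m\<in>{1..<M}. inverse (real m))"
      by (intro sum.mono_neutral_right) auto
    also have "\<dots> = (\<Sum>m\<in>{1..<M}. Re (mult_ext G m))"
      by (intro sum.cong refl) (auto simp: Gm inverse_eq_divide)
    also have "\<dots> \<le> (\<Prod>p\<in>S. 1 / (1 - 1 / real p))"
    proof (rule finite_sum_le_has_sum[OF hs])
      show "{1..<M} \<subseteq> smooth S"
        by (auto simp: S_def smooth_def prime_factors_dvd dest!: dvd_imp_le)
      show "0 \<le> Re (mult_ext G m)" if "m \<in> smooth S - {1..<M}" for m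
        using that by (auto simp: smooth_def Gm)
    qed auto
    also have "\<dots> \<le> (\<Prod>p\<in>S. exp (2 * (1 / real p)))"
    proof (intro prod_mono conjI)
      fix p assume "p \<in> S"
      hence p: "real p \<ge> 2" using S(2)[of p] prime_ge_2_nat[of p] by simp
      thus "0 \<le> 1 / (1 - 1 / real p)" by (simp add: field_simps)
      show "1 / (1 - 1 / real p) \<le> exp (2 * (1 / real p))"
        using p by (intro inverse_one_minus_le_exp) (auto simp: field_simps)
    qed
    also have "\<dots> = exp (2 * (\<Sum>p\<in>S. 1 / real p))" using S by (simp add: exp_sum sum_distrib_left)
    also have "(\<Sum>p\<in>S. 1 / real p) = (\<Sum>p<M. if prime p then 1 / real p else 0)"
      unfolding S_def by (subst sum.inter_filter[symmetric]) (auto intro!: sum.cong)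
    also have "exp (2 * \<dots>) \<le> B"
      unfolding B_def using sum_le_suminf[OF sm, of "{..<M}"] by simp
    finally show ?thesis .
  qed
  note bnd = this
  have "summable (\<lambda>m. inverse (real m))"
  proof (rule bounded_imp_summable)
    show "(\<Sum>m\<le>M. inverse (real m)) \<le> B" for M
      using bnd[of "Suc M"] by (simp only: lessThan_Suc_atMost)
  qed auto
  thus False using not_summable_harmonic by blast
qed

text \<open>Abel summation with nonnegative decreasing weights; a one-sided bound on the partial
  sums passes to the weighted sums.\<close>

lemma sum_by_parts_lower_bound:
  fixes d w :: "nat \<Rightarrow> real"
  assumes D: "\<And>n. - K \<le> (\<Sum>k<n. d k)" and w: "\<And>n. w (Suc n) \<le> w n" "\<And>n. w n \<ge> 0"
  shows "- K * w 0 \<le> (\<Sum>k<n. d k * w k)"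
proof -
  define D where "D = (\<lambda>n. \<Sum>k<n. d k)"
  have "(\<Sum>k<n. d k * w k) = D n * w n + (\<Sum>k<n. D (Suc k) * (w k - w (Suc k)))"
    by (induction n) (auto simp: D_def algebra_simps)
  moreover have "D n * w n \<ge> - K * w n" using D w unfolding D_def by (intro mult_right_mono) auto
  moreover have "(\<Sum>k<n. D (Suc k) * (w k - w (Suc k))) \<ge> (\<Sum>k<n. - K * (w k - w (Suc k)))"
    using D w unfolding D_def by (intro sum_mono mult_right_mono) (auto simp del: sum.lessThan_Suc)
  moreover have "(\<Sum>k<n. - K * (w k - w (Suc k))) = - K * (w 0 - w n)"
    by (simp only: sum_distrib_left[symmetric] sum_lessThan_telescope')
  ultimately show ?thesis by (simp add: algebra_simps)
qed

text \<open>As \<open>(norm (a p))\<^sup>2 \<le> L * norm (a p)\<close>, it is enough to treat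
  squares. For any \<open>c\<close> below \<open>\<kappa>\<close> the sums of
  \<open>(norm (a p))\<^sup>2 - c\<close> over primes are bounded below, so summation by parts
  compares the series with \<open>c\<close> times the sum of \<open>1 / p\<close>.\<close>

lemma not_summable_prime_coeffs:
  fixes a :: "nat \<Rightarrow> complex"
  assumes lim: "((\<lambda>x::real. (\<Sum>p | prime p \<and> real p \<le> x. (norm (a p))\<^sup>2)
                  / real (card {p::nat. prime p \<and> real p \<le> x})) \<longlongrightarrow> \<kappa>) at_top" and \<kappa>: "\<kappa> > 0"
  assumes bd: "\<And>p. prime p \<Longrightarrow> norm (a p) \<le> L"
  shows "\<not> summable (\<lambda>n. if prime n then norm (a n) / real n else 0)"
proof
  assume sm: "summable (\<lambda>n. if prime n then norm (a n) / real n else 0)" (is "summable ?f")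
  define c where "c = \<kappa> / 2"
  have c: "c > 0" "c < \<kappa>" using \<kappa> by (auto simp: c_def)
  define P where "P = (\<lambda>n. {p. prime p \<and> p \<le> (n :: nat)})"
  have fin: "finite (P n)" for n unfolding P_def by (rule finite_subset[of _ "{..n}"]) auto
  have "eventually (\<lambda>n. c < (\<Sum>p | prime p \<and> real p \<le> real n. (norm (a p))\<^sup>2)
                  / real (card {p::nat. prime p \<and> real p \<le> real n})) sequentially"
    using filterlim_compose[OF lim filterlim_real_sequentially] c(2) by (rule order_tendstoD)
  then obtain n0 where n0: "\<And>n. n \<ge> n0 \<Longrightarrow> c < (\<Sum>p\<in>P n. (norm (a p))\<^sup>2) / real (card (P n))"
    unfolding eventually_at_top_linorder P_def by auto
  \<comment> \<open>Position \<open>k\<close> stands for the integer \<open>Suc k\<close>, which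
    keeps the weights \<open>1 / real (Suc k)\<close> decreasing from the start.\<close>
  define d where "d = (\<lambda>k. if prime (Suc k) then (norm (a (Suc k)))\<^sup>2 - c else 0)"
  have L: "L \<ge> 0" using order.trans[OF norm_ge_zero bd[of 2]] by simp
  have dsum: "(\<Sum>k<n. d k) = (\<Sum>p\<in>P n. (norm (a p))\<^sup>2) - c * card (P n)" for n
  proof -
    have "(\<Sum>k<n. d k) = (\<Sum>p=1..n. if prime p then (norm (a p))\<^sup>2 - c else 0)"
      unfolding d_def by (rule sum.reindex_bij_witness[of _ "\<lambda>p. p - 1" Suc]) auto
    also have "\<dots> = (\<Sum>p\<in>P n. (norm (a p))\<^sup>2 - c)"
      by (subst sum.inter_filter[symmetric]) (auto simp: P_def prime_gt_0_nat Suc_le_eq intro!: sum.cong)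
    finally show ?thesis by (simp add: sum_subtractf)
  qed
  have D: "- (c * n0) \<le> (\<Sum>k<n. d k)" for n
  proof (cases "n \<ge> n0")
    case True
    \<comment> \<open>Division by zero yields 0, which is not above \<open>c\<close>.\<close>
    have "card (P n) \<noteq> 0" using n0[OF True] c by (auto intro: ccontr)
    hence "(\<Sum>k<n. d k) \<ge> 0" using n0[OF True] by (simp add: dsum field_simps)
    moreover have "- (c * n0) \<le> 0" using c by simp
    ultimately show ?thesis by linarith
  next
    case False
    have "- (c * n0) \<le> - (c * n)" using False c by simp
    also have "\<dots> = (\<Sum>k<n. - c)" by simp
    also have "\<dots> \<le> (\<Sum>k<n. d k)" using c by (intro sum_mono) (auto simp: d_def)
    finally show ?thesis .
  qed
  have bnd: "(\<Sum>p<n. if prime p then 1 / real p else 0) \<le> (L * suminf ?f + c * n0) / c" for n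
  proof -
    have "- (c * n0) * (1 / real (Suc 0)) \<le> (\<Sum>k<n. d k * (1 / real (Suc k)))"
      by (rule sum_by_parts_lower_bound[where w = "\<lambda>k. 1 / real (Suc k)"]) (use D in \<open>auto simp: field_simps\<close>)
    also have "\<dots> \<le> (\<Sum>k<n. L * ?f (Suc k) - c * (if prime (Suc k) then 1 / real (Suc k) else 0))"
    proof (rule sum_mono)
      fix k
      show "d k * (1 / real (Suc k)) \<le> L * ?f (Suc k) - c * (if prime (Suc k) then 1 / real (Suc k) else 0)"
      proof (cases "prime (Suc k)")
        case True
        have "(norm (a (Suc k)))\<^sup>2 \<le> L * norm (a (Suc k))"
          using bd[OF True] by (simp add: power2_eq_square mult_right_mono)
        hence "((norm (a (Suc k)))\<^sup>2 - c) / real (Suc k) \<le> (L * norm (a (Suc k)) - c) / real (Suc k)"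
          by (intro divide_right_mono) auto
        thus ?thesis using True by (simp add: d_def diff_divide_distrib)
      qed (simp add: d_def)
    qed
    also have "\<dots> = L * (\<Sum>k<n. ?f (Suc k)) - c * (\<Sum>k<n. if prime (Suc k) then 1 / real (Suc k) else 0)"
      by (simp only: sum_subtractf sum_distrib_left)
    also have "(\<Sum>k<n. ?f (Suc k)) = (\<Sum>k<Suc n. ?f k)"
      by (simp only: sum.lessThan_Suc_shift) simp
    also have "(\<Sum>k<n. if prime (Suc k) then 1 / real (Suc k) else 0) = (\<Sum>k<Suc n. if prime k then 1 / real k else 0)"
      by (simp only: sum.lessThan_Suc_shift) simp
    finally have *: "c * (\<Sum>k<Suc n. if prime k then 1 / real k else 0) \<le> L * (\<Sum>k<Suc n. ?f k) + c * n0" by simp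
    also have "(\<Sum>k<Suc n. ?f k) \<le> suminf ?f" by (intro sum_le_suminf sm) auto
    finally have "c * (\<Sum>k<Suc n. if prime k then 1 / real k else 0) \<le> L * suminf ?f + c * n0"
      using L by (simp add: mult_left_mono)
    moreover have "(\<Sum>p<n. if prime p then 1 / real p else 0) \<le> (\<Sum>k<Suc n. if prime k then 1 / real k else 0)"
      by (intro sum_mono2) auto
    ultimately have "c * (\<Sum>p<n. if prime p then 1 / real p else 0) \<le> L * suminf ?f + c * n0"
      using c by (meson less_imp_le mult_left_mono order.trans)
    thus ?thesis using c by (simp add: field_simps)
  qed
  have "summable (\<lambda>p. if prime p then 1 / real p else 0)"
  proof (rule bounded_imp_summable)
    show "(\<Sum>p\<le>n. if prime p then 1 / real p else 0) \<le> (L * suminf ?f + c * n0) / c" for n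
      using bnd[of "Suc n"] by (simp only: lessThan_Suc_atMost)
  qed auto
  thus False using not_summable_prime_reciprocals by blast
qed

text \<open>A quarter of the exponent absorbs the powers of the logarithm, at the price
  \<open>4 ^ j\<close>. The remaining exponent 3/4 exceeds 1/2, so \<open>p ^ (k + 2)\<close>
  contributes at most \<open>p powr (- 3 / 2)\<close> times a geometric term in
  \<open>k\<close>.\<close>

lemma summable_proper_prime_powers:
  "summable (\<lambda>n. if primepow n \<and> \<not> prime n then \<bar>ln (real n)\<bar> ^ j * exp (- ln (real n)) else 0)"
proof (rule summable_comparison_test_ev)
  define h where "h = (\<lambda>(p, k). p ^ Suc (Suc k) :: nat)"
  define PP where "PP = {n :: nat. primepow n \<and> \<not> prime n}"
  define f where "f = (\<lambda>n. exp (- (3 / 4) * ln (real n)))"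
  have inj: "inj_on h (Collect prime \<times> UNIV)"
  proof (rule inj_onI, clarify)
    fix p k q i :: nat assume *: "prime p" "prime q" "h (p, k) = h (q, i)"
    have "inj_on (\<lambda>(p, k). p ^ Suc k :: nat) (Collect prime \<times> UNIV)"
      using bij_betw_primepows[where 'a = nat] by (rule bij_betw_imp_inj_on)
    from inj_onD[OF this, of "(p, Suc k)" "(q, Suc i)"] * show "p = q \<and> k = i" by (auto simp: h_def)
  qed
  have sub: "PP \<subseteq> h ` (Collect prime \<times> UNIV)"
  proof
    fix n assume n: "n \<in> PP"
    hence "n \<in> (\<lambda>(p, k). p ^ Suc k) ` (Collect prime \<times> UNIV)"
      using bij_betw_primepows[where 'a = nat] by (auto simp: PP_def bij_betw_def)
    then obtain p k where pk: "n = p ^ Suc k" "prime p" by auto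
    then obtain i where "k = Suc i" using n by (cases k) (auto simp: PP_def)
    hence "n = h (p, i)" using pk by (simp add: h_def)
    thus "n \<in> h ` (Collect prime \<times> UNIV)" using pk(2) by blast
  qed
  define u where "u = (\<lambda>p. if p = 0 then 0 else real p powr (- (3 / 2)))"
  define v where "v = (\<lambda>k::nat. (2 powr (- (3 / 4)) :: real) ^ k)"
  have u: "(\<lambda>p. norm (u p)) summable_on Collect prime"
  proof -
    have "summable (\<lambda>p. real p powr (- (3 / 2)))" by (simp add: summable_real_powr_iff)
    hence "summable (\<lambda>p. norm (u p))" by (rule summable_comparison_test[rotated]) (auto simp: u_def)
    hence "(\<lambda>p. norm (u p)) summable_on UNIV" by (intro norm_summable_imp_summable_on) simp
    thus ?thesis by (rule summable_on_subset) auto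
  qed
  have v: "(\<lambda>k. norm (v k)) summable_on UNIV"
  proof (rule norm_summable_imp_summable_on)
    have "(2 powr (- (3 / 4)) :: real) < 1" by (rule powr_less_one) auto
    thus "summable (\<lambda>k. norm (norm (v k)))" by (simp add: v_def norm_power summable_geometric)
  qed
  have "(\<lambda>z. norm (f (h z))) summable_on (Collect prime \<times> UNIV)"
  proof (rule summable_on_comparison_test[OF abs_summable_on_times[OF u v]])
    fix z assume "z \<in> (Collect prime :: nat set) \<times> (UNIV :: nat set)"
    then obtain p k where z: "z = (p, k)" "prime p" by auto
    have p: "real p \<ge> 2" using prime_ge_2_nat[OF z(2)] by simp
    have "f (h z) = (real p powr (- (3 / 4))) ^ k * real p powr (- (3 / 2))"
    proof -
      have "real (h z) = real p powr (real k + 2)"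
        using p by (simp add: h_def z powr_add powr_realpow mult.commute power2_eq_square)
      hence "f (h z) = (real p powr (real k + 2)) powr (- (3 / 4))"
        using p by (simp add: f_def powr_def)
      also have "\<dots> = real p powr (real k * (- (3 / 4)) + (- (3 / 2)))"
        unfolding powr_powr by (rule arg_cong[of _ _ "(powr) (real p)"]) (simp add: field_simps)
      also have "\<dots> = (real p powr (- (3 / 4))) ^ k * real p powr (- (3 / 2))"
        using p by (simp only: powr_add) (simp add: powr_powr mult.commute flip: powr_realpow)
      finally show ?thesis .
    qed
    also have "\<dots> \<le> v k * u p"
      unfolding u_def v_def using p by (auto intro!: mult_right_mono power_mono powr_mono2')
    finally show "norm (f (h z)) \<le> norm (case z of (p, k) \<Rightarrow> u p * v k)"
      by (simp add: z f_def mult.commute u_def v_def split: if_splits)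
  qed auto
  hence "((\<lambda>n. norm (f n)) \<circ> h) summable_on (Collect prime \<times> UNIV)" by (simp add: o_def)
  hence "(\<lambda>n. norm (f n)) summable_on h ` (Collect prime \<times> UNIV)" by (subst summable_on_reindex[OF inj])
  hence "(\<lambda>n. norm (f n)) summable_on PP" by (rule summable_on_subset[OF _ sub])
  also have "(\<lambda>n. norm (f n)) summable_on PP \<longleftrightarrow> (\<lambda>n. if n \<in> PP then f n else 0) summable_on UNIV"
    by (rule summable_on_cong_neutral) (auto simp: f_def)
  finally have "summable (\<lambda>n. if n \<in> PP then f n else 0)" by (rule summable_on_imp_summable)
  thus "summable (\<lambda>n. 4 ^ j * (if n \<in> PP then f n else 0))" by (rule summable_mult)
  have "filterlim (\<lambda>n. ln (real n)) at_top sequentially"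
    by (rule filterlim_compose[OF ln_at_top filterlim_real_sequentially])
  from eventually_power_exp_le[OF this, of "1 / 4" j 1]
  have "eventually (\<lambda>n. \<bar>ln (real n)\<bar> ^ j * exp (- ln (real n)) \<le> 4 ^ j * f n) sequentially"
    by (simp add: f_def)
  thus "eventually (\<lambda>n. norm (if primepow n \<and> \<not> prime n then \<bar>ln (real n)\<bar> ^ j * exp (- ln (real n)) else 0)
        \<le> 4 ^ j * (if n \<in> PP then f n else 0)) sequentially"
    by eventually_elim (auto simp: PP_def)
qed

text \<open>The coefficients of the logarithm of the Euler product:
  \<open>\<Sum>j. A j p ^ k / k\<close> at \<open>n = p ^ k\<close>. Indexing by \<open>n\<close>
  instead of by pairs makes the logarithm a \<open>gen_dirichlet\<close> with frequencies
  \<open>ln n\<close>.\<close>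

definition log_euler_coeff :: "nat \<Rightarrow> (nat \<Rightarrow> nat \<Rightarrow> complex) \<Rightarrow> nat \<Rightarrow> complex" where
  "log_euler_coeff l A n = (if primepow n then
     (\<Sum>j=1..l. A j (aprimedivisor n) ^ multiplicity (aprimedivisor n) n) / of_nat (multiplicity (aprimedivisor n) n) else 0)"

lemma log_euler_coeff_prime_power:
  assumes "prime p"
  shows "log_euler_coeff l A (p ^ Suc k) = (\<Sum>j=1..l. A j p ^ Suc k) / of_nat (Suc k)"
  using assms aprimedivisor_prime_power[of p "Suc k"]
  by (simp add: log_euler_coeff_def multiplicity_same_power del: power_Suc of_nat_Suc)

lemma log_euler_coeff_prime: "prime p \<Longrightarrow> log_euler_coeff l A p = (\<Sum>j=1..l. A j p)"
  using log_euler_coeff_prime_power[of p l A 0] by simp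

lemma norm_log_euler_coeff_le:
  assumes "\<And>p j. prime p \<Longrightarrow> j \<in> {1..l} \<Longrightarrow> norm (A j p) \<le> 1"
  shows "norm (log_euler_coeff l A n) \<le> real l"
proof (cases "primepow n")
  case True
  hence "n \<in> (\<lambda>(p, k). p ^ Suc k) ` (Collect prime \<times> UNIV)"
    using bij_betw_primepows[where 'a = nat] by (auto simp: bij_betw_def)
  then obtain p k where pk: "n = p ^ Suc k" "prime p" by auto
  have "norm (\<Sum>j=1..l. A j p ^ Suc k) \<le> (\<Sum>j=1..l. 1)"
    by (rule sum_norm_le) (use assms[OF pk(2)] in \<open>auto simp: norm_power norm_mult intro!: mult_le_one power_le_one\<close>)
  hence "norm (\<Sum>j=1..l. A j p ^ Suc k) / real (Suc k) \<le> real l / 1"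
    by (intro frac_le) auto
  thus ?thesis unfolding pk log_euler_coeff_prime_power[OF pk(2)]
    by (simp add: norm_divide del: power_Suc of_nat_Suc)
qed (simp add: log_euler_coeff_def)

lemma has_sum_finite_sum:
  fixes f :: "'j \<Rightarrow> 'i \<Rightarrow> complex"
  assumes "finite J" "\<And>j. j \<in> J \<Longrightarrow> (f j has_sum S j) A"
  shows "((\<lambda>x. \<Sum>j\<in>J. f j x) has_sum (\<Sum>j\<in>J. S j)) A"
  using assms by (induction J rule: finite_induct) (auto intro!: has_sum_add)

text \<open>Absolute convergence permits grouping the prime powers by primes, where the inner sums
  are logarithmic series. The resulting partial sums, once exponentiated, are the partial products
  of the given product in its own order; the choice of branch disappears under
  \<open>exp\<close>.\<close>

lemma exp_log_euler_series:
  fixes \<phi> :: complex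
  assumes A: "\<And>p j. prime p \<Longrightarrow> j \<in> {1..l} \<Longrightarrow> norm (A j p) \<le> 1" and s: "Re s > 1"
  assumes prod: "(\<lambda>p. if prime p then \<Prod>j=1..l. inverse (1 - A j p * of_nat p powr (- s)) else 1) has_prod \<phi>"
  assumes sm: "summable (\<lambda>n. norm (log_euler_coeff l A n * of_real (- ln (real n)) ^ 0 * exp (- of_real (ln (real n)) * s)))"
  shows "exp (gen_dirichlet (log_euler_coeff l A) (\<lambda>n. ln (real n)) 0 s) = \<phi>"
proof -
  define f where "f = (\<lambda>n. log_euler_coeff l A n * exp (- of_real (ln (real n)) * s))"
  define F where "F = (\<lambda>(p, k). f (p ^ Suc k))"
  define h where "h = (\<lambda>p. \<Sum>j=1..l. - ln (1 - A j p * of_nat p powr (- s)))"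
  have sf: "summable (\<lambda>n. norm (f n))" using sm by (simp add: f_def)
  have "(f has_sum suminf f) UNIV"
    by (rule norm_summable_imp_has_sum[OF sf summable_sums[OF summable_norm_cancel[OF sf]]])
  also have "(f has_sum suminf f) UNIV \<longleftrightarrow> (f has_sum suminf f) (Collect primepow)"
    by (rule has_sum_cong_neutral) (auto simp: f_def log_euler_coeff_def)
  finally have "((\<lambda>x. f ((\<lambda>(p, k). p ^ Suc k) x)) has_sum suminf f) (Collect prime \<times> UNIV)"
    by (subst has_sum_reindex_bij_betw[OF bij_betw_primepows])
  hence "(F has_sum suminf f) (Collect prime \<times> UNIV)" by (simp add: F_def case_prod_unfold)
  hence "(h has_sum suminf f) (Collect prime)"
  proof (rule has_sum_SigmaD)
    fix p :: nat assume "p \<in> Collect prime"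
    hence p: "prime p" by simp
    define X where "X = of_nat p powr (- s)"
    have "norm X = real p powr (- Re s)" using p by (simp add: X_def norm_powr_real_powr prime_gt_0_nat)
    also have "\<dots> < 1" using s prime_gt_1_nat[OF p] by (intro powr_less_one) auto
    finally have nX: "norm X < 1" .
    have "((\<lambda>k. (A j p * X) ^ Suc k / of_nat (Suc k)) has_sum - ln (1 - A j p * X)) UNIV" if j: "j \<in> {1..l}" for j
    proof -
      have "norm (A j p * X) \<le> 1 * norm X" unfolding norm_mult by (intro mult_right_mono A p j) auto
      hence n: "norm (A j p * X) < 1" using nX by simp
      have "(\<lambda>k. - ((- (- (A j p * X))) ^ k) / of_nat k) sums ln (1 + - (A j p * X))"
        by (rule Ln_series') (use n in simp)
      hence "(\<lambda>k. (A j p * X) ^ k / of_nat k) sums - ln (1 - A j p * X)"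
        using sums_minus by fastforce
      hence s1: "(\<lambda>k. (A j p * X) ^ Suc k / of_nat (Suc k)) sums - ln (1 - A j p * X)"
        by (subst sums_Suc_iff) simp
      have "summable (\<lambda>k. norm ((A j p * X) ^ Suc k / of_nat (Suc k)))"
      proof (rule summable_comparison_test)
        show "summable (\<lambda>k. norm (A j p * X) ^ k)" using n by (intro summable_geometric) auto
        have "norm ((A j p * X) ^ Suc k / of_nat (Suc k)) \<le> norm (A j p * X) ^ k" for k
        proof -
          have "norm ((A j p * X) ^ Suc k / of_nat (Suc k)) = norm (A j p * X) ^ Suc k / real (Suc k)"
            by (simp only: norm_divide norm_power norm_of_nat)
          also have "\<dots> \<le> norm (A j p * X) ^ k / 1"
            using n by (intro frac_le power_decreasing) auto
          finally show ?thesis by simp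
        qed
        thus "\<exists>N. \<forall>k\<ge>N. norm (norm ((A j p * X) ^ Suc k / of_nat (Suc k))) \<le> norm (A j p * X) ^ k" by simp
      qed
      thus ?thesis using s1 by (rule norm_summable_imp_has_sum)
    qed
    hence "((\<lambda>k. \<Sum>j=1..l. (A j p * X) ^ Suc k / of_nat (Suc k)) has_sum (\<Sum>j=1..l. - ln (1 - A j p * X))) UNIV"
      by (intro has_sum_finite_sum) auto
    also have "(\<lambda>k. \<Sum>j=1..l. (A j p * X) ^ Suc k / of_nat (Suc k)) = (\<lambda>k. F (p, k))"
    proof
      fix k
      have "exp (- of_real (ln (real (p ^ Suc k))) * s) = X ^ Suc k"
      proof -
        have "exp (- of_real (ln (real (p ^ Suc k))) * s) = exp (of_nat (Suc k) * (- s * of_real (ln (real p))))"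
          using p by (simp only: of_nat_power ln_realpow prime_gt_0_nat of_nat_0_less_iff) (simp add: mult_ac)
        also have "\<dots> = exp (- s * of_real (ln (real p))) ^ Suc k" by (rule exp_of_nat_mult)
        also have "exp (- s * of_real (ln (real p))) = X"
          using p by (simp add: X_def powr_def prime_gt_0_nat Ln_of_nat)
        finally show ?thesis .
      qed
      thus "(\<Sum>j=1..l. (A j p * X) ^ Suc k / of_nat (Suc k)) = F (p, k)"
        unfolding F_def prod.case f_def log_euler_coeff_prime_power[OF p]
        by (simp add: power_mult_distrib sum_divide_distrib sum_distrib_right del: power_Suc of_nat_Suc)
    qed
    finally show "((\<lambda>k. F (p, k)) has_sum h p) UNIV" by (simp add: h_def X_def)
  qed
  also have "(h has_sum suminf f) (Collect prime) \<longleftrightarrow> ((\<lambda>p. if prime p then h p else 0) has_sum suminf f) UNIV"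
    by (rule has_sum_cong_neutral) auto
  finally have "(\<lambda>p. if prime p then h p else 0) sums suminf f" by (rule has_sum_imp_sums)
  hence "(\<lambda>n. exp (\<Sum>p<n. if prime p then h p else 0)) \<longlonglongrightarrow> exp (suminf f)"
    unfolding sums_def by (rule tendsto_exp)
  moreover have "exp (\<Sum>p<n. if prime p then h p else 0) =
      (\<Prod>p<n. if prime p then \<Prod>j=1..l. inverse (1 - A j p * of_nat p powr (- s)) else 1)" for n
  proof -
    have "exp (h p) = (\<Prod>j=1..l. inverse (1 - A j p * of_nat p powr (- s)))" if p: "prime p" for p
      unfolding h_def exp_sum[OF finite_atLeastAtMost]
    proof (intro prod.cong refl)
      fix j assume j: "j \<in> {1..l}"
      have "norm (A j p * of_nat p powr (- s)) \<le> 1 * norm (of_nat p powr (- s))"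
        unfolding norm_mult by (intro mult_right_mono A p j) auto
      also have "\<dots> = real p powr (- Re s)" using p by (simp add: norm_powr_real_powr prime_gt_0_nat)
      also have "\<dots> < 1" using s prime_gt_1_nat[OF p] by (intro powr_less_one) auto
      finally have "1 - A j p * of_nat p powr (- s) \<noteq> 0" by auto
      thus "exp (- ln (1 - A j p * of_nat p powr (- s))) = inverse (1 - A j p * of_nat p powr (- s))"
        by (simp add: exp_minus)
    qed
    thus ?thesis by (simp add: exp_sum if_distrib[of exp] cong: if_cong)
  qed
  ultimately have "(\<lambda>n. \<Prod>p<n. if prime p then \<Prod>j=1..l. inverse (1 - A j p * of_nat p powr (- s)) else 1) \<longlonglongrightarrow> exp (suminf f)"
    by simp
  with has_prod_imp_tendsto'[OF prod] have "exp (suminf f) = \<phi>" by (rule LIMSEQ_unique[symmetric])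
  thus ?thesis by (simp add: gen_dirichlet_def f_def)
qed

subsection \<open>Joint approximation\<close>

text \<open>On the indices outside \<open>P\<close> no freedom of phase is needed: the first few are controlled by those in
  \<open>P\<close>, and the others contribute little. Below \<open>P\<close> is the set of primes or all of \<open>\<nat>\<close>.\<close>

lemma gen_dirichlet_approximation:
  fixes c :: "nat \<Rightarrow> complex" and x :: "nat \<Rightarrow> real" and g :: "nat \<Rightarrow> complex"
  assumes B: "\<And>n. norm (c n) \<le> B"
  assumes lim: "filterlim x at_top sequentially"
  assumes summ: "\<And>\<sigma>. \<sigma> > 1 \<Longrightarrow> summable (\<lambda>n. exp (- \<sigma> * x n))"
  assumes div: "\<not> summable (\<lambda>n. if P n then norm (c n) * exp (- x n) else 0)"
  assumes small: "\<And>k. summable (\<lambda>n. if P n then 0 else norm (c n) * (\<bar>x n\<bar> ^ k * exp (- x n)))"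
  assumes base: "\<And>M \<eta>. \<eta> > 0 \<Longrightarrow> \<exists>\<eta>'>0. \<forall>t. (\<forall>n<M. P n \<longrightarrow> norm (cis (- t * x n) - 1) < \<eta>') \<longrightarrow>
                     (\<forall>n<M. c n \<noteq> 0 \<longrightarrow> norm (cis (- t * x n) - 1) < \<eta>)"
  assumes \<epsilon>: "\<epsilon> > 0"
  shows "\<exists>\<delta>>0. \<forall>\<sigma>. 1 < \<sigma> \<longrightarrow> \<sigma> \<le> 1 + \<delta> \<longrightarrow> (\<exists>Y0. \<forall>Y\<ge>Y0. \<exists>u \<eta>. (\<forall>n. norm (u n) = 1) \<and> \<eta> > 0 \<and>
           (\<forall>t. (\<forall>n<Y. P n \<longrightarrow> norm (cis (- t * x n) - u n) < \<eta>) \<longrightarrow>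
                (\<forall>k<N. norm (gen_dirichlet c x k (Complex \<sigma> t) - g k) < \<epsilon>)))"
proof -
  \<comment> \<open>Four errors: truncation, deviation of the phases (\<open>S1\<close> and
    \<open>S2\<close>), indices outside \<open>P\<close> (\<open>S3\<close>), and the least squares
    residual (\<open>S4\<close>).\<close>
  define e where "e = \<epsilon> / 4"
  have e: "e > 0" using \<epsilon> by (simp add: e_def)
  \<comment> \<open>Coefficients outside \<open>P\<close> are erased, so that only indices whose
    phases are free take part in the least squares argument.\<close>
  define w where "w = (\<lambda>n. if P n then c n else 0)"
  have wB: "norm (w n) \<le> B" for n using B[of n] order.trans[OF norm_ge_zero B[of n]] by (simp add: w_def)
  have "(\<lambda>n. if P n then norm (c n) * exp (- x n) else 0) = (\<lambda>n. norm (w n) * exp (- x n))"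
    by (auto simp: w_def)
  with div have wdiv: "\<not> summable (\<lambda>n. norm (w n) * exp (- x n))" by simp
  obtain M0 where M0: "\<forall>M\<ge>M0. \<forall>R. \<exists>M' \<delta>. \<delta> > 0 \<and> (\<forall>\<sigma> M'' z. 1 \<le> \<sigma> \<longrightarrow> \<sigma> \<le> 1 + \<delta> \<longrightarrow> M' \<le> M'' \<longrightarrow>
           (\<forall>k<N. norm (z k) \<le> R) \<longrightarrow> (\<exists>\<psi>. (\<forall>n. norm (\<psi> n) = 1) \<and>
             (\<forall>k<N. norm (z k - (\<Sum>n=M..<M''. \<psi> n * (w n * of_real (- x n) ^ k * of_real (exp (- \<sigma> * x n))))) \<le> e)))"
    by (rule exE[OF twisted_sums_dense[OF wB lim _ wdiv e, of N]]) (rule summ, assumption, rule that)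
  define H where "H = (\<lambda>n. \<Sum>k<N. if P n then 0 else norm (c n) * (\<bar>x n\<bar> ^ k * exp (- x n)))"
  have "summable H" unfolding H_def by (intro summable_sum small)
  then obtain M1 where M1: "\<And>m n. m \<ge> M1 \<Longrightarrow> norm (\<Sum>i=m..<n. H i) < e"
    unfolding summable_Cauchy using e by meson
  have "eventually (\<lambda>n. x n \<ge> 0) sequentially" using lim by (auto simp: filterlim_at_top)
  then obtain M2 where M2: "\<And>n. n \<ge> M2 \<Longrightarrow> x n \<ge> 0" by (auto simp: eventually_at_top_linorder)
  define M where "M = max M0 (max M1 M2)"
  define T where "T = (\<lambda>\<sigma> k n. c n * of_real (- x n) ^ k * complex_of_real (exp (- \<sigma> * x n)))"
  \<comment> \<open>Bounds the corrected target \<open>g'\<close> for every \<open>\<sigma>\<close>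
    in question, since \<open>\<sigma> \<le> 2\<close> gives
    \<open>exp (- \<sigma> * x n) \<le> exp (2 * \<bar>x n\<bar>)\<close> also for negative
    \<open>x n\<close>. It has to be known before \<open>\<delta>\<close>, hence before
    \<open>\<sigma>\<close>.\<close>
  define R where "R = (\<Sum>k<N. norm (g k) + (\<Sum>n<M. norm (c n) * \<bar>x n\<bar> ^ k * exp (2 * \<bar>x n\<bar>)))"
  have "M \<ge> M0" by (simp add: M_def)
  from M0[THEN spec, THEN mp, OF this, THEN spec, of R]
  obtain M' \<delta> where \<delta>: "\<delta> > 0" and M': "\<forall>\<sigma> M'' z. 1 \<le> \<sigma> \<longrightarrow> \<sigma> \<le> 1 + \<delta> \<longrightarrow> M' \<le> M'' \<longrightarrow>
           (\<forall>k<N. norm (z k) \<le> R) \<longrightarrow> (\<exists>\<psi>. (\<forall>n. norm (\<psi> n) = 1) \<and>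
             (\<forall>k<N. norm (z k - (\<Sum>n=M..<M''. \<psi> n * (w n * of_real (- x n) ^ k * of_real (exp (- \<sigma> * x n))))) \<le> e))"
    by (elim exE conjE)
  show ?thesis
  proof (intro exI[of _ "min \<delta> 1"] conjI allI impI)
    show "min \<delta> 1 > 0" using \<delta> by simp
    fix \<sigma> assume "1 < \<sigma>" "\<sigma> \<le> 1 + min \<delta> 1"
    hence \<sigma>: "1 < \<sigma>" "\<sigma> \<le> 1 + \<delta>" "\<sigma> \<le> 2" by auto
    have "\<exists>Y1. \<forall>Y\<ge>Y1. \<forall>t. \<forall>k<N. norm (gen_dirichlet c x k (Complex \<sigma> t) - (\<Sum>n<Y. T \<sigma> k n * cis (- t * x n))) < e"
      unfolding T_def by (rule gen_dirichlet_truncation[of c B]) (fact B, fact lim, erule summ, fact, fact)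
    then obtain Y1 where Y1: "\<forall>Y\<ge>Y1. \<forall>t. \<forall>k<N. norm (gen_dirichlet c x k (Complex \<sigma> t) - (\<Sum>n<Y. T \<sigma> k n * cis (- t * x n))) < e"
      by (elim exE)
    \<comment> \<open>What the block from \<open>M\<close> on must produce once the first
      \<open>M\<close> terms are taken with phase 1.\<close>
    define g' where "g' = (\<lambda>k. g k - (\<Sum>n<M. T \<sigma> k n))"
    have g': "norm (g' k) \<le> R" if k: "k < N" for k
    proof -
      have "norm (g' k) \<le> norm (g k) + norm (\<Sum>n<M. T \<sigma> k n)" unfolding g'_def by (rule norm_triangle_ineq4)
      also have "norm (\<Sum>n<M. T \<sigma> k n) \<le> (\<Sum>n<M. norm (c n) * \<bar>x n\<bar> ^ k * exp (2 * \<bar>x n\<bar>))"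
      proof (rule sum_norm_le)
        fix n
        have "- \<sigma> * x n \<le> \<sigma> * \<bar>x n\<bar>" using \<sigma> by (simp add: abs_if mult_nonneg_nonpos)
        also have "\<dots> \<le> 2 * \<bar>x n\<bar>" using \<sigma> by (intro mult_right_mono) auto
        finally show "norm (T \<sigma> k n) \<le> norm (c n) * \<bar>x n\<bar> ^ k * exp (2 * \<bar>x n\<bar>)"
          unfolding T_def by (auto simp: norm_mult norm_power intro!: mult_left_mono)
      qed
      also have "norm (g k) + (\<Sum>n<M. norm (c n) * \<bar>x n\<bar> ^ k * exp (2 * \<bar>x n\<bar>)) \<le> R"
        unfolding R_def using k by (intro member_le_sum[of k "{..<N}" "\<lambda>k. norm (g k) + (\<Sum>n<M. norm (c n) * \<bar>x n\<bar> ^ k * exp (2 * \<bar>x n\<bar>))"]) (auto intro!: add_nonneg_nonneg sum_nonneg)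
      finally show ?thesis by simp
    qed
    show "\<exists>Y0. \<forall>Y\<ge>Y0. \<exists>u \<eta>. (\<forall>n. norm (u n) = 1) \<and> \<eta> > 0 \<and>
           (\<forall>t. (\<forall>n<Y. P n \<longrightarrow> norm (cis (- t * x n) - u n) < \<eta>) \<longrightarrow>
                (\<forall>k<N. norm (gen_dirichlet c x k (Complex \<sigma> t) - g k) < \<epsilon>))"
    proof (rule exI[of _ "max M (max M' Y1)"], intro allI impI)
      fix Y assume "Y \<ge> max M (max M' Y1)"
      hence Y: "Y \<ge> M" "Y \<ge> M'" "Y \<ge> Y1" by auto
      have "1 \<le> \<sigma>" "\<forall>k<N. norm (g' k) \<le> R" using \<sigma> g' by auto
      from M'[THEN spec[of _ \<sigma>], THEN spec[of _ Y], THEN spec[of _ g'], THEN mp, OF this(1), THEN mp, OF \<sigma>(2), THEN mp, OF Y(2), THEN mp, OF this(2)]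
      obtain \<psi> where \<psi>: "\<forall>n. norm (\<psi> n) = 1" and \<psi>': "\<forall>k<N.
          norm (g' k - (\<Sum>n=M..<Y. \<psi> n * (w n * of_real (- x n) ^ k * of_real (exp (- \<sigma> * x n))))) \<le> e"
        by (elim exE conjE)
      define u where "u = (\<lambda>n. if n < M then 1 else \<psi> n)"
      \<comment> \<open>Dominates the total size of the terms for every \<open>k\<close>, so phase
        errors of \<open>e / Q\<close> add up to at most \<open>e\<close>; the added 1 keeps it
        positive.\<close>
      define Q where "Q = (\<Sum>k<N. \<Sum>n<Y. norm (T \<sigma> k n)) + 1"
      have Q: "Q \<ge> 1" unfolding Q_def by (simp add: sum_nonneg)
      have eQ: "e / Q > 0" using e Q by simp
      from base[OF eQ, of M] obtain \<eta>' where \<eta>': "\<eta>' > 0" "\<forall>t. (\<forall>n<M. P n \<longrightarrow> norm (cis (- t * x n) - 1) < \<eta>') \<longrightarrow>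
                     (\<forall>n<M. c n \<noteq> 0 \<longrightarrow> norm (cis (- t * x n) - 1) < e / Q)"
        by (elim exE conjE)
      define \<eta> where "\<eta> = min \<eta>' (e / Q)"
      have \<eta>: "\<eta> > 0" using \<eta>' eQ by (simp add: \<eta>_def)
      have "norm (gen_dirichlet c x k (Complex \<sigma> t) - g k) < \<epsilon>"
        if t: "\<And>n. n < Y \<Longrightarrow> P n \<Longrightarrow> norm (cis (- t * x n) - u n) < \<eta>" and k: "k < N" for t k
      proof -
        define z where "z = (\<lambda>n. cis (- t * x n))"
        have lowM: "norm (z n - 1) \<le> e / Q" if "n < M" "c n \<noteq> 0" for n
        proof -
          have "norm (cis (- t * x n) - 1) < \<eta>'" if "n < M" "P n" for n
            using t[of n] that Y by (simp add: u_def \<eta>_def)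
          with \<eta>'(2) have "norm (cis (- t * x n) - 1) < e / Q" using that by blast
          thus ?thesis by (simp add: z_def)
        qed
        define S1 where "S1 = (\<Sum>n<M. T \<sigma> k n * (z n - 1))"
        define S2 where "S2 = (\<Sum>n=M..<Y. (if P n then T \<sigma> k n * (z n - \<psi> n) else 0))"
        define S3 where "S3 = (\<Sum>n=M..<Y. (if P n then 0 else T \<sigma> k n * z n))"
        define S4 where "S4 = g' k - (\<Sum>n=M..<Y. \<psi> n * (w n * of_real (- x n) ^ k * of_real (exp (- \<sigma> * x n))))"
        have "(\<Sum>n<Y. T \<sigma> k n * z n) = (\<Sum>n<M. T \<sigma> k n * z n) + (\<Sum>n=M..<Y. T \<sigma> k n * z n)"
          using Y(1) by (subst sum.union_disjoint[symmetric]) (auto intro!: sum.cong)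
        also have "(\<Sum>n<M. T \<sigma> k n * z n) = S1 + (\<Sum>n<M. T \<sigma> k n)"
          by (simp add: S1_def right_diff_distrib sum_subtractf)
        also have "(\<Sum>n=M..<Y. T \<sigma> k n * z n) = S2 + S3 + (\<Sum>n=M..<Y. \<psi> n * (w n * of_real (- x n) ^ k * of_real (exp (- \<sigma> * x n))))"
          unfolding S2_def S3_def sum.distrib[symmetric]
          by (intro sum.cong refl) (auto simp: w_def T_def algebra_simps)
        finally have split: "(\<Sum>n<Y. T \<sigma> k n * z n) - g k = S1 + S2 + S3 - S4"
          by (simp add: S4_def g'_def)
        have S12: "norm (S1 + S2) \<le> e"
        proof -
          have "norm S1 \<le> (\<Sum>n<M. norm (T \<sigma> k n) * (e / Q))"
            unfolding S1_def
          proof (rule sum_norm_le)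
            fix n assume n: "n \<in> {..<M}"
            show "norm (T \<sigma> k n * (z n - 1)) \<le> norm (T \<sigma> k n) * (e / Q)"
            proof (cases "c n = 0")
              case False
              thus ?thesis using lowM[of n] n unfolding norm_mult by (intro mult_left_mono) auto
            qed (simp add: T_def)
          qed
          moreover have "norm S2 \<le> (\<Sum>n=M..<Y. norm (T \<sigma> k n) * (e / Q))"
            unfolding S2_def
          proof (rule sum_norm_le)
            fix n assume n: "n \<in> {M..<Y}"
            have "norm (z n - \<psi> n) \<le> e / Q" if "P n"
              using t[of n] n that by (auto simp: z_def u_def \<eta>_def)
            thus "norm (if P n then T \<sigma> k n * (z n - \<psi> n) else 0) \<le> norm (T \<sigma> k n) * (e / Q)"
              using eQ by (auto simp: norm_mult intro!: mult_left_mono mult_nonneg_nonneg simp del: times_divide_eq_right)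
          qed
          ultimately have "norm S1 + norm S2 \<le> (\<Sum>n<Y. norm (T \<sigma> k n) * (e / Q))"
          proof -
            assume "norm S1 \<le> (\<Sum>n<M. norm (T \<sigma> k n) * (e / Q))" "norm S2 \<le> (\<Sum>n=M..<Y. norm (T \<sigma> k n) * (e / Q))"
            moreover have "(\<Sum>n<Y. norm (T \<sigma> k n) * (e / Q)) = (\<Sum>n<M. norm (T \<sigma> k n) * (e / Q)) + (\<Sum>n=M..<Y. norm (T \<sigma> k n) * (e / Q))"
              using Y(1) by (subst sum.union_disjoint[symmetric]) (auto intro!: sum.cong)
            ultimately show ?thesis by simp
          qed
          also have "\<dots> = (\<Sum>n<Y. norm (T \<sigma> k n)) * (e / Q)" by (rule sum_distrib_right[symmetric])
          also have "\<dots> \<le> Q * (e / Q)"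
          proof (rule mult_right_mono)
            have "(\<Sum>n<Y. norm (T \<sigma> k n)) \<le> (\<Sum>k<N. \<Sum>n<Y. norm (T \<sigma> k n))"
              using k by (intro member_le_sum[of k "{..<N}" "\<lambda>k. \<Sum>n<Y. norm (T \<sigma> k n)"]) (auto intro!: sum_nonneg)
            thus "(\<Sum>n<Y. norm (T \<sigma> k n)) \<le> Q" by (simp add: Q_def)
          qed (use eQ in simp)
          also have "\<dots> = e" using Q by simp
          finally show ?thesis using norm_triangle_ineq[of S1 S2] by linarith
        qed
        have S3: "norm S3 \<le> e"
        proof -
          have "norm S3 \<le> (\<Sum>n=M..<Y. H n)"
            unfolding S3_def
          proof (rule sum_norm_le)
            fix n assume n: "n \<in> {M..<Y}"
            hence x: "x n \<ge> 0" using M2[of n] by (simp add: M_def)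
            hence "exp (- \<sigma> * x n) \<le> exp (- x n)" using \<sigma> mult_right_mono[of 1 \<sigma> "x n"] by simp
            hence "norm (if P n then 0 else T \<sigma> k n * z n) \<le> (if P n then 0 else norm (c n) * (\<bar>x n\<bar> ^ k * exp (- x n)))"
              by (auto simp: T_def z_def norm_mult norm_power mult.assoc intro!: mult_left_mono)
            also have "\<dots> \<le> H n"
              unfolding H_def using k by (intro member_le_sum[of k "{..<N}" "\<lambda>k. if P n then 0 else norm (c n) * (\<bar>x n\<bar> ^ k * exp (- x n))"]) auto
            finally show "norm (if P n then 0 else T \<sigma> k n * z n) \<le> H n" .
          qed
          also have "\<dots> \<le> norm (\<Sum>n=M..<Y. H n)" by simp
          also have "\<dots> \<le> e" by (rule less_imp_le, rule M1) (simp add: M_def)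
          finally show ?thesis .
        qed
        have S4: "norm S4 \<le> e" unfolding S4_def by (rule \<psi>'[rule_format, OF k])
        have "norm (gen_dirichlet c x k (Complex \<sigma> t) - g k) \<le> norm (gen_dirichlet c x k (Complex \<sigma> t) - (\<Sum>n<Y. T \<sigma> k n * z n)) + norm ((\<Sum>n<Y. T \<sigma> k n * z n) - g k)"
          by (rule norm_triangle_sub[of _ "gen_dirichlet c x k (Complex \<sigma> t) - (\<Sum>n<Y. T \<sigma> k n * z n)", THEN order.trans]) (simp add: add.commute)
        also have "norm ((\<Sum>n<Y. T \<sigma> k n * z n) - g k) \<le> 3 * e"
          unfolding split using S12 S3 S4 norm_triangle_ineq4[of "S1 + S2 + S3" S4] norm_triangle_ineq[of "S1 + S2" S3] by linarith
        also have "norm (gen_dirichlet c x k (Complex \<sigma> t) - (\<Sum>n<Y. T \<sigma> k n * z n)) < e"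
          unfolding z_def by (rule Y1[rule_format, OF Y(3) k])
        finally show ?thesis by (simp add: e_def)
      qed
      moreover have "norm (u n) = 1" for n using \<psi> by (simp add: u_def)
      ultimately show "\<exists>u \<eta>. (\<forall>n. norm (u n) = 1) \<and> \<eta> > 0 \<and>
           (\<forall>t. (\<forall>n<Y. P n \<longrightarrow> norm (cis (- t * x n) - u n) < \<eta>) \<longrightarrow>
                (\<forall>k<N. norm (gen_dirichlet c x k (Complex \<sigma> t) - g k) < \<epsilon>))"
        using \<eta> by (intro exI[of _ u] exI[of _ \<eta>]) auto
    qed
  qed
qed

section \<open>Frequencies \<open>ln (m + \<alpha>)\<close> and periodic coefficients\<close>

lemma summable_shifted_logs:
  assumes "\<alpha> \<ge> 0" "\<sigma> > 1"
  shows "summable (\<lambda>n. exp (- \<sigma> * ln (real n + \<alpha>)))"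
proof (rule summable_comparison_test_ev)
  show "summable (\<lambda>n. real n powr (- \<sigma>))" using assms by (simp add: summable_real_powr_iff)
  show "eventually (\<lambda>n. norm (exp (- \<sigma> * ln (real n + \<alpha>))) \<le> real n powr (- \<sigma>)) sequentially"
    using eventually_gt_at_top[of 0]
    by eventually_elim (use assms in \<open>auto simp: powr_def intro!: mult_left_mono\<close>)
qed

lemma filterlim_shifted_logs: "filterlim (\<lambda>n. ln (real n + \<alpha>)) at_top sequentially"
proof (rule filterlim_compose[OF ln_at_top])
  have "filterlim (\<lambda>n. \<alpha> + real n) at_top sequentially"
    by (rule filterlim_tendsto_add_at_top[OF tendsto_const filterlim_real_sequentially])
  thus "filterlim (\<lambda>n. real n + \<alpha>) at_top sequentially" by (simp add: add.commute)
qed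

text \<open>Along the progression \<open>m0 + i * k\<close> the coefficients keep the nonzero value
  \<open>b m0\<close>, which leaves a series comparable with the harmonic one.\<close>

lemma not_summable_periodic:
  fixes b :: "nat \<Rightarrow> complex" and \<alpha> :: real
  assumes per: "\<And>m. b (m + k) = b m" and k: "k > 0" and b: "b m0 \<noteq> 0" and \<alpha>: "0 < \<alpha>"
  shows "\<not> summable (\<lambda>m. norm (b m) * exp (- ln (real m + \<alpha>)))"
proof
  assume sm: "summable (\<lambda>m. norm (b m) * exp (- ln (real m + \<alpha>)))" (is "summable ?f")
  define h where "h = (\<lambda>i. m0 + i * k)"
  have bh: "b (h i) = b m0" for i
  proof (induction i)
    case (Suc i)
    have "h (Suc i) = h i + k" by (simp add: h_def)
    thus ?case using per[of "h i"] Suc by simp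
  qed (simp add: h_def)
  have inj: "inj h" using k by (auto simp: h_def inj_on_def)
  have "summable (?f \<circ> h)"
    by (rule summable_reindex[OF sm inj]) simp
  hence "summable (\<lambda>i. norm (b m0) * exp (- ln (real (h i) + \<alpha>)))" by (simp add: o_def bh)
  hence "summable (\<lambda>i. (1 / norm (b m0)) * (norm (b m0) * exp (- ln (real (h i) + \<alpha>))))" by (rule summable_mult)
  hence "summable (\<lambda>i. inverse (real m0 + real i * real k + \<alpha>))"
    using b \<alpha> by (simp add: exp_minus h_def add_nonneg_pos)
  \<comment> \<open>The constant is chosen such that
    \<open>m0 + i * k + \<alpha> \<le> (m0 + k + \<alpha>) * i\<close> for
    \<open>i \<ge> 1\<close>.\<close>
  hence "summable (\<lambda>i. (real m0 + real k + \<alpha>) * inverse (real m0 + real i * real k + \<alpha>))" by (rule summable_mult)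
  hence "summable (\<lambda>i. inverse (real i))"
  proof (rule summable_comparison_test_ev[rotated])
    show "eventually (\<lambda>i. norm (inverse (real i)) \<le> (real m0 + real k + \<alpha>) * inverse (real m0 + real i * real k + \<alpha>)) sequentially"
      using eventually_ge_at_top[of 1]
    proof eventually_elim
      case (elim i)
      have "real m0 \<le> real m0 * real i" "\<alpha> \<le> \<alpha> * real i" using elim \<alpha> by (auto simp: mult_le_cancel_left1)
      hence "real m0 + real i * real k + \<alpha> \<le> (real m0 + real k + \<alpha>) * real i" by (simp add: algebra_simps)
      moreover have "real m0 + real i * real k + \<alpha> > 0" using \<alpha> by (simp add: add_nonneg_pos)
      ultimately have "real i * (real m0 + real k + \<alpha>) / (real m0 + real i * real k + \<alpha>) \<ge> 1"
        by (simp add: mult.commute)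
      hence "inverse (real i) * 1 \<le> inverse (real i) * (real i * (real m0 + real k + \<alpha>) / (real m0 + real i * real k + \<alpha>))"
        by (intro mult_left_mono) auto
      also have "\<dots> = (real m0 + real k + \<alpha>) * inverse (real m0 + real i * real k + \<alpha>)"
        using elim by (simp only: divide_inverse mult.assoc[symmetric]) simp
      finally show ?case by simp
    qed
  qed
  thus False using not_summable_harmonic by blast
qed

text \<open>Each series is approximable for all \<open>\<sigma>\<close> close to 1 and all large
  \<open>Y\<close>, so both can share one \<open>\<sigma>\<close> and one \<open>Y\<close>. The
  remaining conditions concern the phases at primes and at shifts below \<open>Y\<close>, which
  \<open>joint_phases\<close> meets simultaneously.\<close>

lemma joint_density:
  fixes \<alpha> :: real and b c :: "nat \<Rightarrow> complex"
  assumes \<alpha>: "\<alpha> > 0" "\<not> algebraic \<alpha>"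
  assumes b: "\<And>n. norm (b n) \<le> B" "\<not> summable (\<lambda>m. norm (b m) * exp (- ln (real m + \<alpha>)))"
  assumes c: "\<And>n. norm (c n) \<le> C" "\<not> summable (\<lambda>n. if prime n then norm (c n) / real n else 0)"
    "\<And>n. c n \<noteq> 0 \<Longrightarrow> primepow n"
  assumes \<epsilon>: "\<epsilon> > 0"
  shows "\<exists>\<sigma> t. 1 < \<sigma> \<and> \<sigma> \<le> 2 \<and> t \<ge> T \<and> (\<forall>k<N. norm (gen_dirichlet c (\<lambda>n. ln (real n)) k (Complex \<sigma> t) - g k) < \<epsilon> \<and>
             norm (gen_dirichlet b (\<lambda>n. ln (real n + \<alpha>)) k (Complex \<sigma> t) - z k) < \<epsilon>)"
proof -
  have "\<exists>\<delta>>0. \<forall>\<sigma>. 1 < \<sigma> \<longrightarrow> \<sigma> \<le> 1 + \<delta> \<longrightarrow> (\<exists>Y0. \<forall>Y\<ge>Y0. \<exists>u \<eta>. (\<forall>n. norm (u n) = 1) \<and> \<eta> > 0 \<and>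
           (\<forall>t. (\<forall>n<Y. prime n \<longrightarrow> norm (cis (- t * ln (real n)) - u n) < \<eta>) \<longrightarrow>
                (\<forall>k<N. norm (gen_dirichlet c (\<lambda>n. ln (real n)) k (Complex \<sigma> t) - g k) < \<epsilon>)))"
  proof (rule gen_dirichlet_approximation[OF c(1) _ _ _ _ _ \<epsilon>])
    show "filterlim (\<lambda>n. ln (real n)) at_top sequentially" using filterlim_shifted_logs[of 0] by simp
    show "summable (\<lambda>n. exp (- \<sigma> * ln (real n)))" if "\<sigma> > 1" for \<sigma>
      using summable_shifted_logs[of 0 \<sigma>] that by simp
    have "(\<lambda>n. if prime n then norm (c n) / real n else 0) = (\<lambda>n. if prime n then norm (c n) * exp (- ln (real n)) else 0)"
      by (auto simp: exp_minus prime_gt_0_nat inverse_eq_divide)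
    thus "\<not> summable (\<lambda>n. if prime n then norm (c n) * exp (- ln (real n)) else 0)" using c(2) by simp
    show "summable (\<lambda>n. if prime n then 0 else norm (c n) * (\<bar>ln (real n)\<bar> ^ k * exp (- ln (real n))))" for k
    proof (rule summable_comparison_test)
      show "summable (\<lambda>n. C * (if primepow n \<and> \<not> prime n then \<bar>ln (real n)\<bar> ^ k * exp (- ln (real n)) else 0))"
        by (intro summable_mult summable_proper_prime_powers)
      have "norm (if prime n then 0 else norm (c n) * (\<bar>ln (real n)\<bar> ^ k * exp (- ln (real n))))
         \<le> C * (if primepow n \<and> \<not> prime n then \<bar>ln (real n)\<bar> ^ k * exp (- ln (real n)) else 0)" for n
        using c(1)[of n] c(3)[of n] by (cases "c n = 0") (auto intro!: mult_right_mono)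
      thus "\<exists>N. \<forall>n\<ge>N. norm (if prime n then 0 else norm (c n) * (\<bar>ln (real n)\<bar> ^ k * exp (- ln (real n))))
         \<le> C * (if primepow n \<and> \<not> prime n then \<bar>ln (real n)\<bar> ^ k * exp (- ln (real n)) else 0)" by blast
    qed
    fix M and \<eta> :: real assume \<eta>: "\<eta> > 0"
    show "\<exists>\<eta>'>0. \<forall>t. (\<forall>n<M. prime n \<longrightarrow> norm (cis (- t * ln (real n)) - 1) < \<eta>') \<longrightarrow>
                     (\<forall>n<M. c n \<noteq> 0 \<longrightarrow> norm (cis (- t * ln (real n)) - 1) < \<eta>)"
    \<comment> \<open>A prime power \<open>n = p ^ r\<close> below \<open>M\<close> has
      \<open>r < 2 ^ r \<le> n\<close>, and its phase is the \<open>r\<close>-th power of the phase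
      of \<open>p\<close>; taking this power enlarges the distance to 1 at most by the factor
      \<open>r \<le> M\<close>.\<close>
    proof (intro exI[of _ "\<eta> / (real M + 1)"] conjI allI impI)
      fix t n assume t: "\<forall>n<M. prime n \<longrightarrow> norm (cis (- t * ln (real n)) - 1) < \<eta> / (real M + 1)"
        and n: "n < M" "c n \<noteq> 0"
      obtain p r where pr: "prime p" "r > 0" "n = p ^ r" using c(3)[OF n(2)] by (auto simp: primepow_def)
      have "p ^ 1 \<le> n" unfolding pr(3) using pr prime_gt_1_nat[OF pr(1)] by (intro power_increasing) auto
      hence tp: "norm (cis (- t * ln (real p)) - 1) < \<eta> / (real M + 1)" using t pr n by simp
      have "r < 2 ^ r" by (rule less_exp)
      also have "2 ^ r \<le> n" unfolding pr(3) using prime_ge_2_nat[OF pr(1)] by (intro power_mono) auto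
      finally have r: "r \<le> M" using n by simp
      have "cis (- t * ln (real n)) = cis (- t * ln (real p)) ^ r"
        using pr by (simp add: Complex.DeMoivre ln_realpow prime_gt_0_nat mult_ac)
      hence "norm (cis (- t * ln (real n)) - 1) = norm (cis (- t * ln (real p)) ^ r - 1 ^ r)" by simp
      also have "\<dots> \<le> real r * norm (cis (- t * ln (real p)) - 1)" by (rule norm_power_diff) auto
      also have "\<dots> \<le> real r * (\<eta> / (real M + 1))" using tp by (intro mult_left_mono) auto
      also have "\<dots> \<le> real M * (\<eta> / (real M + 1))" using r \<eta> by (intro mult_right_mono) auto
      also have "\<dots> < \<eta>" using \<eta> by (simp add: field_simps)
      finally show "norm (cis (- t * ln (real n)) - 1) < \<eta>" .
    qed (use \<eta> in \<open>simp add: divide_pos_pos\<close>)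
  qed
  then obtain \<delta>1 where \<delta>1: "\<delta>1 > 0" "\<And>\<sigma>. 1 < \<sigma> \<Longrightarrow> \<sigma> \<le> 1 + \<delta>1 \<Longrightarrow> \<exists>Y0. \<forall>Y\<ge>Y0. \<exists>u \<eta>. (\<forall>n. norm (u n) = 1) \<and> \<eta> > 0 \<and>
           (\<forall>t. (\<forall>n<Y. prime n \<longrightarrow> norm (cis (- t * ln (real n)) - u n) < \<eta>) \<longrightarrow>
                (\<forall>k<N. norm (gen_dirichlet c (\<lambda>n. ln (real n)) k (Complex \<sigma> t) - g k) < \<epsilon>))" by blast
  have "\<exists>\<delta>>0. \<forall>\<sigma>. 1 < \<sigma> \<longrightarrow> \<sigma> \<le> 1 + \<delta> \<longrightarrow> (\<exists>Y0. \<forall>Y\<ge>Y0. \<exists>u \<eta>. (\<forall>n. norm (u n) = 1) \<and> \<eta> > 0 \<and>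
           (\<forall>t. (\<forall>n<Y. True \<longrightarrow> norm (cis (- t * ln (real n + \<alpha>)) - u n) < \<eta>) \<longrightarrow>
                (\<forall>k<N. norm (gen_dirichlet b (\<lambda>n. ln (real n + \<alpha>)) k (Complex \<sigma> t) - z k) < \<epsilon>)))"
    by (rule gen_dirichlet_approximation[OF b(1) filterlim_shifted_logs _ _ _ _ \<epsilon>])
       (use b(2) \<alpha>(1) summable_shifted_logs[of \<alpha>] in auto)
  then obtain \<delta>2 where \<delta>2: "\<delta>2 > 0" "\<And>\<sigma>. 1 < \<sigma> \<Longrightarrow> \<sigma> \<le> 1 + \<delta>2 \<Longrightarrow> \<exists>Y0. \<forall>Y\<ge>Y0. \<exists>u \<eta>. (\<forall>n. norm (u n) = 1) \<and> \<eta> > 0 \<and>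
           (\<forall>t. (\<forall>n<Y. norm (cis (- t * ln (real n + \<alpha>)) - u n) < \<eta>) \<longrightarrow>
                (\<forall>k<N. norm (gen_dirichlet b (\<lambda>n. ln (real n + \<alpha>)) k (Complex \<sigma> t) - z k) < \<epsilon>))" by auto
  define \<sigma> where "\<sigma> = 1 + min 1 (min \<delta>1 \<delta>2)"
  have \<sigma>: "1 < \<sigma>" "\<sigma> \<le> 1 + \<delta>1" "\<sigma> \<le> 1 + \<delta>2" "\<sigma> \<le> 2" using \<delta>1(1) \<delta>2(1) by (auto simp: \<sigma>_def)
  obtain Y1 where Y1: "\<And>Y. Y \<ge> Y1 \<Longrightarrow> \<exists>u \<eta>. (\<forall>n. norm (u n) = 1) \<and> \<eta> > 0 \<and>
           (\<forall>t. (\<forall>n<Y. prime n \<longrightarrow> norm (cis (- t * ln (real n)) - u n) < \<eta>) \<longrightarrow>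
                (\<forall>k<N. norm (gen_dirichlet c (\<lambda>n. ln (real n)) k (Complex \<sigma> t) - g k) < \<epsilon>))"
    using \<delta>1(2)[OF \<sigma>(1,2)] by blast
  obtain Y2 where Y2: "\<And>Y. Y \<ge> Y2 \<Longrightarrow> \<exists>u \<eta>. (\<forall>n. norm (u n) = 1) \<and> \<eta> > 0 \<and>
           (\<forall>t. (\<forall>n<Y. norm (cis (- t * ln (real n + \<alpha>)) - u n) < \<eta>) \<longrightarrow>
                (\<forall>k<N. norm (gen_dirichlet b (\<lambda>n. ln (real n + \<alpha>)) k (Complex \<sigma> t) - z k) < \<epsilon>))"
    using \<delta>2(2)[OF \<sigma>(1,3)] by blast
  define Y where "Y = max Y1 Y2"
  obtain u \<eta>1 where u: "\<And>n. norm (u n) = 1" "\<eta>1 > 0" "\<And>t. (\<forall>n<Y. prime n \<longrightarrow> norm (cis (- t * ln (real n)) - u n) < \<eta>1) \<Longrightarrow>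
                (\<forall>k<N. norm (gen_dirichlet c (\<lambda>n. ln (real n)) k (Complex \<sigma> t) - g k) < \<epsilon>)"
    using Y1[of Y] by (auto simp: Y_def)
  obtain v \<eta>2 where v: "\<And>n. norm (v n) = 1" "\<eta>2 > 0" "\<And>t. (\<forall>n<Y. norm (cis (- t * ln (real n + \<alpha>)) - v n) < \<eta>2) \<Longrightarrow>
                (\<forall>k<N. norm (gen_dirichlet b (\<lambda>n. ln (real n + \<alpha>)) k (Complex \<sigma> t) - z k) < \<epsilon>)"
    using Y2[of Y] by (auto simp: Y_def)
  have "min \<eta>1 \<eta>2 > 0" using u v by simp
  hence "\<exists>t\<ge>T. (\<forall>p<Y. prime p \<longrightarrow> norm (cis (- t * ln (real p)) - u p) < min \<eta>1 \<eta>2) \<and>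
    (\<forall>m<Y. norm (cis (- t * ln (real m + \<alpha>)) - v m) < min \<eta>1 \<eta>2)"
    by (intro joint_phases \<alpha> u(1) v(1))
  then obtain t where t: "t \<ge> T"
    "\<forall>p<Y. prime p \<longrightarrow> norm (cis (- t * ln (real p)) - u p) < min \<eta>1 \<eta>2"
    "\<forall>m<Y. norm (cis (- t * ln (real m + \<alpha>)) - v m) < min \<eta>1 \<eta>2" by (elim exE conjE)
  have "\<forall>k<N. norm (gen_dirichlet c (\<lambda>n. ln (real n)) k (Complex \<sigma> t) - g k) < \<epsilon>" by (rule u(3)) (use t(2) in simp)
  moreover have "\<forall>k<N. norm (gen_dirichlet b (\<lambda>n. ln (real n + \<alpha>)) k (Complex \<sigma> t) - z k) < \<epsilon>" by (rule v(3)) (use t(3) in simp)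
  ultimately show ?thesis using t(1) \<sigma>(1,4) by (intro exI[of _ \<sigma>] exI[of _ t] conjI allI impI) simp_all
qed

subsection \<open>Functional independence\<close>

text \<open>Leibniz' rule applied to \<open>deriv \<phi> = deriv L * \<phi>\<close>. The form of the
  recursion allows it to be solved both for the derivatives of \<open>\<phi>\<close> and for those
  of \<open>L\<close>.\<close>

lemma higher_deriv_exp_rec:
  assumes L: "L holomorphic_on S" and S: "open S" "s \<in> S" and eq: "\<And>s. s \<in> S \<Longrightarrow> \<phi> s = exp (L s)"
  shows "(deriv ^^ Suc k) \<phi> s = (\<Sum>i=0..k. of_nat (k choose i) * (deriv ^^ Suc i) L s * (deriv ^^ (k - i)) \<phi> s)"
proof -
  have \<phi>: "\<phi> holomorphic_on S"
    by (rule holomorphic_transform[of "\<lambda>s. exp (L s)"]) (auto intro!: holomorphic_intros L eq[symmetric])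
  have dL: "deriv L holomorphic_on S" and d\<phi>: "deriv \<phi> holomorphic_on S"
    using L \<phi> S by (auto intro: holomorphic_deriv)
  have *: "deriv \<phi> w = deriv L w * \<phi> w" if w: "w \<in> S" for w
  proof -
    have "(L has_field_derivative deriv L w) (at w)" using L S(1) w by (rule holomorphic_derivI)
    hence "((\<lambda>s. exp (L s)) has_field_derivative exp (L w) * deriv L w) (at w)" by (rule DERIV_fun_exp)
    hence "(\<phi> has_field_derivative exp (L w) * deriv L w) (at w)"
      by (rule has_field_derivative_transform_within_open[OF _ S(1) w]) (simp add: eq)
    thus ?thesis using eq[OF w] by (simp add: DERIV_imp_deriv)
  qed
  have "(deriv ^^ Suc k) \<phi> s = (deriv ^^ k) (deriv \<phi>) s" by (simp only: funpow_Suc_right o_def)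
  also have "\<dots> = (deriv ^^ k) (\<lambda>w. deriv L w * \<phi> w) s"
    by (rule higher_deriv_transform_within_open[OF d\<phi> _ S]) (auto intro!: holomorphic_intros dL \<phi> *)
  also have "\<dots> = (\<Sum>i=0..k. of_nat (k choose i) * (deriv ^^ i) (deriv L) s * (deriv ^^ (k - i)) \<phi> s)"
    by (rule higher_deriv_mult[OF dL \<phi> S])
  also have "(\<lambda>i. (deriv ^^ i) (deriv L)) = (\<lambda>i. (deriv ^^ Suc i) L)" by (simp only: funpow_Suc_right o_def)
  finally show ?thesis .
qed

text \<open>The recursion is triangular: the new unknown \<open>g (Suc k)\<close> enters the
  equation for \<open>z (Suc k)\<close> with coefficient \<open>z 0\<close>. This is where a
  nonvanishing first coordinate is used.\<close>

lemma log_derivs_ex: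
  fixes z :: "nat \<Rightarrow> complex"
  assumes "z 0 \<noteq> 0"
  shows "\<exists>g. exp (g 0) = z 0 \<and> (\<forall>k<N. z (Suc k) = (\<Sum>i=0..k. of_nat (k choose i) * g (Suc i) * z (k - i)))"
proof (induction N)
  case 0
  show ?case using assms by (intro exI[of _ "\<lambda>_. ln (z 0)"]) simp
next
  case (Suc N)
  then obtain g where g: "exp (g 0) = z 0" "\<And>k. k < N \<Longrightarrow> z (Suc k) = (\<Sum>i=0..k. of_nat (k choose i) * g (Suc i) * z (k - i))"
    by blast
  define S where "S = (\<Sum>i=0..<N. of_nat (N choose i) * g (Suc i) * z (N - i))"
  define g' where "g' = g(Suc N := (z (Suc N) - S) / z 0)"
  have "z (Suc k) = (\<Sum>i=0..k. of_nat (k choose i) * g' (Suc i) * z (k - i))" if k: "k < Suc N" for k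
  proof (cases "k = N")
    case True
    have "(\<Sum>i=0..N. of_nat (N choose i) * g' (Suc i) * z (N - i)) =
          (\<Sum>i=0..<N. of_nat (N choose i) * g' (Suc i) * z (N - i)) + g' (Suc N) * z 0"
      by (simp add: atLeastLessThanSuc_atLeastAtMost[symmetric])
    also have "(\<Sum>i=0..<N. of_nat (N choose i) * g' (Suc i) * z (N - i)) = S"
      unfolding S_def by (intro sum.cong) (auto simp: g'_def)
    finally show ?thesis using True assms by (simp add: g'_def)
  next
    case False
    hence "z (Suc k) = (\<Sum>i=0..k. of_nat (k choose i) * g (Suc i) * z (k - i))" using k by (intro g) auto
    also have "\<dots> = (\<Sum>i=0..k. of_nat (k choose i) * g' (Suc i) * z (k - i))"
      using k False by (intro sum.cong) (auto simp: g'_def)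
    finally show ?thesis .
  qed
  moreover have "exp (g' 0) = z 0" using g by (simp add: g'_def)
  ultimately show ?case by blast
qed

text \<open>The recursion expresses each derivative of \<open>\<phi>\<close> by derivatives of
  \<open>L\<close> and lower derivatives of \<open>\<phi>\<close>, so limits pass through it
  inductively and satisfy the same equations as \<open>z\<close>.\<close>

lemma tendsto_derivs_of_log_derivs:
  fixes s :: "nat \<Rightarrow> complex"
  assumes L: "L holomorphic_on S" and S: "open S" "\<And>n. s n \<in> S" and eq: "\<And>s. s \<in> S \<Longrightarrow> \<phi> s = exp (L s)"
  assumes lim: "\<And>k. k < N \<Longrightarrow> (\<lambda>n. (deriv ^^ k) L (s n)) \<longlonglongrightarrow> g k"
  assumes g0: "exp (g 0) = z 0"
  assumes g: "\<And>k. k < N \<Longrightarrow> z (Suc k) = (\<Sum>i=0..k. of_nat (k choose i) * g (Suc i) * z (k - i))"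
  shows "k < N \<Longrightarrow> (\<lambda>n. (deriv ^^ k) \<phi> (s n)) \<longlonglongrightarrow> z k"
proof (induction k rule: less_induct)
  case (less k)
  show ?case
  proof (cases k)
    case 0
    have "(\<lambda>n. exp (L (s n))) \<longlonglongrightarrow> exp (g 0)" using lim[of 0] less.prems 0 by (intro tendsto_exp) auto
    thus ?thesis using 0 g0 eq S(2) by simp
  next
    case (Suc j)
    have "(\<lambda>n. \<Sum>i=0..j. of_nat (j choose i) * (deriv ^^ Suc i) L (s n) * (deriv ^^ (j - i)) \<phi> (s n)) \<longlonglongrightarrow>
          (\<Sum>i=0..j. of_nat (j choose i) * g (Suc i) * z (j - i))"
      using less Suc by (intro tendsto_sum tendsto_mult tendsto_const lim less.IH) auto
    also have "(\<lambda>n. \<Sum>i=0..j. of_nat (j choose i) * (deriv ^^ Suc i) L (s n) * (deriv ^^ (j - i)) \<phi> (s n)) =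
               (\<lambda>n. (deriv ^^ Suc j) \<phi> (s n))"
      by (intro ext higher_deriv_exp_rec[OF L S(1) S(2) eq, symmetric])
    also have "(\<Sum>i=0..j. of_nat (j choose i) * g (Suc i) * z (j - i)) = z (Suc j)"
      using g[of j] less.prems Suc by simp
    finally show ?thesis using Suc by simp
  qed
qed

section \<open>Vanishing of the coefficient functions\<close>

lemma leading_coeff_limit_zero:
  fixes s :: "nat \<Rightarrow> complex" and f :: "nat \<Rightarrow> nat \<Rightarrow> complex"
  assumes s: "filterlim s at_infinity sequentially"
  assumes f: "\<And>j. j \<le> m \<Longrightarrow> (\<lambda>n. f j n) \<longlonglongrightarrow> y j"
  assumes zero: "\<And>n. (\<Sum>j\<le>m. s n ^ j * f j n) = 0"
  shows "y m = 0"
proof -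
  have inv: "(\<lambda>n. inverse (s n)) \<longlonglongrightarrow> 0"
    by (rule filterlim_compose[OF tendsto_inverse_0 s])
  have "(\<lambda>n. - (\<Sum>j<m. inverse (s n) ^ (m - j) * f j n)) \<longlonglongrightarrow> - (\<Sum>j<m. 0 ^ (m - j) * y j)"
    by (intro tendsto_minus tendsto_sum tendsto_mult tendsto_power inv f) auto
  also have "(\<Sum>j<m. 0 ^ (m - j) * y j) = 0" by (rule sum.neutral) (auto simp: power_0_left)
  finally have lim: "(\<lambda>n. - (\<Sum>j<m. inverse (s n) ^ (m - j) * f j n)) \<longlonglongrightarrow> 0" by simp
  have "eventually (\<lambda>n. s n \<noteq> 0) sequentially"
    using s by (rule filterlim_at_infinity_imp_eventually_ne)
  hence "eventually (\<lambda>n. - (\<Sum>j<m. inverse (s n) ^ (m - j) * f j n) = f m n) sequentially"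
  proof eventually_elim
    case (elim n)
    have "0 = inverse (s n) ^ m * (\<Sum>j\<le>m. s n ^ j * f j n)" using zero by simp
    also have "\<dots> = (\<Sum>j\<le>m. inverse (s n) ^ (m - j) * f j n)"
      unfolding sum_distrib_left
    proof (rule sum.cong[OF refl])
      fix j assume "j \<in> {..m}"
      hence "inverse (s n) ^ m = inverse (s n) ^ (m - j) * inverse (s n) ^ j" by (simp flip: power_add)
      thus "inverse (s n) ^ m * (s n ^ j * f j n) = inverse (s n) ^ (m - j) * f j n"
        using elim by (simp add: power_inverse)
    qed
    also have "\<dots> = (\<Sum>j<m. inverse (s n) ^ (m - j) * f j n) + f m n"
      by (simp flip: lessThan_Suc_atMost)
    finally show ?case by (intro minus_unique) (rule sym)
  qed
  from Lim_transform_eventually[OF lim this] f[of m] show ?thesis using LIMSEQ_unique by blast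
qed

lemma tendsto_continuous_map_complex_space:
  assumes F: "continuous_map (complex_space d) euclidean F"
  assumes y: "\<And>n. y n \<in> topspace (complex_space d)" and x: "x \<in> topspace (complex_space d)"
  assumes lim: "\<And>i. i < d \<Longrightarrow> (\<lambda>n. y n i) \<longlonglongrightarrow> x i"
  shows "(\<lambda>n. F (y n)) \<longlonglongrightarrow> F x"
proof -
  have "limitin (complex_space d) y x sequentially"
    unfolding limitin_componentwise using x y lim by (auto simp: PiE_iff)
  from continuous_map_limit[OF F this] show ?thesis by (simp add: o_def)
qed

lemma topspace_complex_space: "topspace (complex_space d) = extensional {..<d}"
  by (simp add: set_eq_iff PiE_iff)

lemma vanishing_of_dense_sequences:
  fixes F :: "nat \<Rightarrow> (nat \<Rightarrow> complex) \<Rightarrow> complex" and V :: "complex \<Rightarrow> nat \<Rightarrow> complex"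
  assumes d: "d > 0"
  assumes V: "\<And>s. V s \<in> topspace (complex_space d)"
  assumes dense: "\<And>x. x \<in> topspace (complex_space d) \<Longrightarrow> x 0 \<noteq> 0 \<Longrightarrow>
     \<exists>s. (\<forall>n. s n \<in> D) \<and> filterlim s at_infinity sequentially \<and> (\<forall>i<d. (\<lambda>n. V (s n) i) \<longlonglongrightarrow> x i)"
  assumes F: "\<And>j. j \<le> n \<Longrightarrow> continuous_map (complex_space d) euclidean (F j)"
  assumes zero: "\<And>s. s \<in> D \<Longrightarrow> (\<Sum>j\<le>n. s ^ j * F j (V s)) = 0"
  shows "\<forall>j\<le>n. \<forall>x\<in>topspace (complex_space d). F j x = 0"
  using F zero
proof (induction n)
  \<comment> \<open>Both the base case and the induction step remove a top coefficient, so the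
    argument is stated for an arbitrary \<open>n\<close> before the cases are split.\<close>
  have main: "F n x = 0" if F: "\<And>j. j \<le> n \<Longrightarrow> continuous_map (complex_space d) euclidean (F j)"
     and zero: "\<And>s. s \<in> D \<Longrightarrow> (\<Sum>j\<le>n. s ^ j * F j (V s)) = 0" and x: "x \<in> topspace (complex_space d)" for n x
  proof -
    have nz: "F n x = 0" if x: "x \<in> topspace (complex_space d)" "x 0 \<noteq> 0" for x
    proof -
      obtain s where s: "\<And>n. s n \<in> D" "filterlim s at_infinity sequentially" "\<And>i. i < d \<Longrightarrow> (\<lambda>n. V (s n) i) \<longlonglongrightarrow> x i"
        using dense[OF x] by blast
      show ?thesis
      proof (rule leading_coeff_limit_zero[OF s(2), where y = "\<lambda>j. F j x"])
        show "(\<lambda>n. F j (V (s n))) \<longlonglongrightarrow> F j x" if "j \<le> n" for j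
          by (rule tendsto_continuous_map_complex_space[OF F[OF that] V x(1) s(3)])
        show "(\<Sum>j\<le>n. s m ^ j * F j (V (s m))) = 0" for m using zero[OF s(1)] .
      qed
    qed
    show ?thesis
    proof (cases "x 0 = 0")
      case True
      \<comment> \<open>The excluded vectors are limits of admissible ones: only the zeroth
        coordinate is moved away from 0, and \<open>F n\<close> is continuous.\<close>
      define y where "y = (\<lambda>m. x(0 := complex_of_real (1 / real (Suc m))))"
      have y: "y m \<in> topspace (complex_space d)" for m
        using x d by (auto simp: y_def topspace_complex_space extensional_def)
      have "(\<lambda>m. 1 / real (Suc m)) \<longlonglongrightarrow> 0" by (rule LIMSEQ_Suc[OF lim_1_over_n])
      hence "(\<lambda>m. complex_of_real (1 / real (Suc m))) \<longlonglongrightarrow> complex_of_real 0" by (rule tendsto_of_real)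
      hence "(\<lambda>m. y m i) \<longlonglongrightarrow> x i" for i using True by (cases "i = 0") (simp_all add: y_def)
      hence "(\<lambda>m. F n (y m)) \<longlonglongrightarrow> F n x"
        by (intro tendsto_continuous_map_complex_space[OF F[OF order_refl] y x])
      moreover have "F n (y m) = 0" for m by (rule nz[OF y]) (simp add: y_def del: of_nat_Suc)
      ultimately show ?thesis by (simp add: LIMSEQ_const_iff)
    qed (rule nz[OF x])
  qed
  {
    case 0
    show ?case using main[of 0] 0 by simp
  next
    case (Suc n)
    have Sn: "F (Suc n) x = 0" if "x \<in> topspace (complex_space d)" for x
      by (rule main[OF Suc.prems that])
    have "\<forall>j\<le>n. \<forall>x\<in>topspace (complex_space d). F j x = 0"
    proof (rule Suc.IH)
      show "(\<Sum>j\<le>n. s ^ j * F j (V s)) = 0" if "s \<in> D" for s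
        using Suc.prems(2)[OF that] Sn[OF V] by simp
    qed (use Suc.prems in auto)
    thus ?case using Sn by (auto simp: le_Suc_eq)
  }
qed

section \<open>The two given functions as general Dirichlet series\<close>

lemma powr_minus_of_nat:
  assumes "m > 0"
  shows "(of_nat m :: complex) powr (- of_nat n) = 1 / of_nat m ^ n"
proof -
  have "(of_nat m :: complex) powr of_nat n = of_nat m ^ n" using assms by (intro powr_nat') simp
  thus ?thesis by (simp only: powr_minus inverse_eq_divide)
qed

text \<open>Specialising \<open>s\<close> to integers feeds \<open>euler_product_roots\<close>. With
  roots of size at most 1 the logarithmic coefficients are bounded by \<open>l\<close>, and at
  primes they agree with \<open>a\<close>, so divergence is inherited from the mean value
  condition.\<close>

lemma S_tilde_log_series:
  assumes "\<phi> \<in> S_tilde \<sigma>0"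
  obtains c C where "\<And>n. norm (c n) \<le> C" "\<not> summable (\<lambda>n. if prime n then norm (c n) / real n else 0)"
    "\<And>n. c n \<noteq> 0 \<Longrightarrow> primepow n" "\<And>s. Re s > 1 \<Longrightarrow> \<phi> s = exp (gen_dirichlet c (\<lambda>n. ln (real n)) 0 s)"
proof -
  from assms obtain a \<kappa> where bigo: "\<forall>\<epsilon>>0. (\<lambda>m. norm (a m)) \<in> O(\<lambda>m. real m powr \<epsilon>)"
    and sums: "\<forall>s. Re s > 1 \<longrightarrow> (\<lambda>m. a (Suc m) * of_nat (Suc m) powr (-s)) sums \<phi> s"
    and \<kappa>: "\<kappa> > 0" "((\<lambda>x::real. (\<Sum>p | prime p \<and> real p \<le> x. (norm (a p))\<^sup>2)
                  / real (card {p::nat. prime p \<and> real p \<le> x})) \<longlongrightarrow> \<kappa>) at_top"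
    unfolding S_tilde_def mem_Collect_eq by (elim conjE exE) (rule that)
  from assms obtain l :: nat and A where prod: "\<forall>s. Re s > 1 \<longrightarrow>
        (\<lambda>p. if prime p then \<Prod>j=1..l. inverse (1 - A j p * of_nat p powr (-s)) else 1) has_prod \<phi> s"
    unfolding S_tilde_def mem_Collect_eq by (elim conjE exE) (rule that)
  have sums': "(\<lambda>m. a (Suc m) / of_nat (Suc m) ^ n) sums \<phi> (of_nat n)" if "n \<ge> 2" for n
    using sums[rule_format, of "of_nat n"] that by (simp add: powr_minus_of_nat del: of_nat_Suc)
  have prod': "(\<lambda>p. if prime p then \<Prod>j=1..l. inverse (1 - A j p / of_nat p ^ n) else 1) has_prod \<phi> (of_nat n)" if "n \<ge> 2" for n
  proof -
    have "(\<lambda>p. if prime p then \<Prod>j=1..l. inverse (1 - A j p * of_nat p powr (- of_nat n)) else 1) =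
          (\<lambda>p. if prime p then \<Prod>j=1..l. inverse (1 - A j p / of_nat p ^ n) else 1)"
      by (intro ext) (simp add: powr_minus_of_nat prime_gt_0_nat)
    thus ?thesis using prod[rule_format, of "of_nat n"] that by simp
  qed
  note roots = euler_product_roots[OF bigo[rule_format] sums' prod']
  define c where "c = log_euler_coeff l A"
  have A1: "norm (A j p) \<le> 1" if "prime p" "j \<in> {1..l}" for p j using roots(1) that by blast
  have cp: "c p = a p" if "prime p" for p using roots(2)[OF _ _ _ that] that by (simp add: c_def log_euler_coeff_prime)
  have cl: "norm (c n) \<le> real l" for n unfolding c_def by (rule norm_log_euler_coeff_le) (rule A1)
  show ?thesis
  proof (rule that[of c "real l"])
    show "norm (c n) \<le> real l" for n by (rule cl)
    have "\<not> summable (\<lambda>n. if prime n then norm (a n) / real n else 0)"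
    proof (rule not_summable_prime_coeffs[OF \<kappa>(2,1)])
      show "norm (a p) \<le> real l" if "prime p" for p using cl[of p] cp[OF that] by simp
    qed
    also have "(\<lambda>n. if prime n then norm (a n) / real n else 0) = (\<lambda>n. if prime n then norm (c n) / real n else 0)"
      using cp by (intro ext) simp
    finally show "\<not> summable (\<lambda>n. if prime n then norm (c n) / real n else 0)" .
    show "primepow n" if "c n \<noteq> 0" for n using that by (auto simp: c_def log_euler_coeff_def split: if_splits)
    show "\<phi> s = exp (gen_dirichlet c (\<lambda>n. ln (real n)) 0 s)" if s: "Re s > 1" for s
      unfolding c_def
    proof (rule exp_log_euler_series[symmetric])
      show "norm (A j p) \<le> 1" if "prime p" "j \<in> {1..l}" for p j using A1 that .
      show "summable (\<lambda>n. norm (log_euler_coeff l A n * of_real (- ln (real n)) ^ 0 * exp (- of_real (ln (real n)) * s)))"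
        using filterlim_shifted_logs[of 0] summable_shifted_logs[of 0] cl s unfolding c_def
        by (intro summable_gen_dirichlet[where B = "real l"]) auto
    qed (use s prod in auto)
  qed
qed

lemma periodic_hurwitz_zeta_eq_gen_dirichlet:
  assumes "\<alpha> > 0" "periodic_seq b" "Re s > 1"
  shows "periodic_hurwitz_zeta \<alpha> b s = gen_dirichlet b (\<lambda>n. ln (real n + \<alpha>)) 0 s"
proof -
  have "complex_of_real (real m + \<alpha>) powr (- s) = exp (- of_real (ln (real m + \<alpha>)) * s)" for m
  proof -
    have "real m + \<alpha> > 0" using assms(1) by simp
    hence "complex_of_real (real m + \<alpha>) \<noteq> 0" "Ln (complex_of_real (real m + \<alpha>)) = of_real (ln (real m + \<alpha>))"
      by (auto simp: Ln_of_real simp del: of_real_add)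
    thus ?thesis by (simp add: powr_def mult.commute)
  qed
  thus ?thesis using periodic_hurwitz_zeta(2)[OF assms] by (simp add: gen_dirichlet_def sums_iff)
qed

lemma dense_sequences:
  fixes \<alpha> \<sigma>0 :: real and b :: "nat \<Rightarrow> complex" and \<phi> :: "complex \<Rightarrow> complex"
  assumes \<alpha>: "0 < \<alpha>" "\<not> algebraic \<alpha>" and b: "periodic_seq b" "\<exists>m. b m \<noteq> 0"
    and \<phi>: "\<phi> \<in> S_tilde \<sigma>0" and N: "N \<ge> 1" and x0: "x 0 \<noteq> 0"
  shows "\<exists>s. (\<forall>n. s n \<in> {s. Re s > 1 \<and> \<not> is_pole \<phi> s \<and> \<not> is_pole (periodic_hurwitz_zeta \<alpha> b) s}) \<and>
             filterlim s at_infinity sequentially \<and>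
             (\<forall>i<2*N. (\<lambda>n. joint_derivs N \<phi> (periodic_hurwitz_zeta \<alpha> b) (s n) i) \<longlonglongrightarrow> x i)"
proof -
  define Z where "Z = periodic_hurwitz_zeta \<alpha> b"
  obtain c C where c: "\<And>n. norm (c n) \<le> C" "\<not> summable (\<lambda>n. if prime n then norm (c n) / real n else 0)"
    "\<And>n. c n \<noteq> 0 \<Longrightarrow> primepow n" and \<phi>L: "\<And>s. Re s > 1 \<Longrightarrow> \<phi> s = exp (gen_dirichlet c (\<lambda>n. ln (real n)) 0 s)"
    using S_tilde_log_series[OF \<phi>] by blast
  define L where "L = gen_dirichlet c (\<lambda>n. ln (real n)) 0"
  have lim0: "filterlim (\<lambda>n. ln (real n)) at_top sequentially" using filterlim_shifted_logs[of 0] by simp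
  have summ0: "summable (\<lambda>n. exp (- \<sigma> * ln (real n)))" if "\<sigma> > 1" for \<sigma>
    using summable_shifted_logs[of 0 \<sigma>] that by simp
  have summ\<alpha>: "summable (\<lambda>n. exp (- \<sigma> * ln (real n + \<alpha>)))" if "\<sigma> > 1" for \<sigma>
    using summable_shifted_logs[of \<alpha> \<sigma>] that \<alpha> by simp
  obtain k where k: "k > 0" "\<And>m. b (m + k) = b m" using b(1) by (auto simp: periodic_seq_def)
  have bB: "norm (b m) \<le> (\<Sum>l<k. norm (b l))" for m
  proof -
    have "norm (b (m mod k)) \<le> (\<Sum>l<k. norm (b l))" using k by (intro member_le_sum) auto
    thus ?thesis using periodic_mod[of b k m] k by simp
  qed
  have bdiv: "\<not> summable (\<lambda>m. norm (b m) * exp (- ln (real m + \<alpha>)))"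
    using b(2) not_summable_periodic[of b k _ \<alpha>] k \<alpha> by blast
  define S where "S = {s. Re s > 1}"
  have S: "open S" unfolding S_def by (rule open_halfspace_Re_gt)
  have "(gen_dirichlet c (\<lambda>n. ln (real n)) 0 has_field_derivative gen_dirichlet c (\<lambda>n. ln (real n)) (Suc 0) s) (at s)" if "Re s > 1" for s
    by (rule has_field_derivative_gen_dirichlet[where B = C]) (rule c(1), rule lim0, erule summ0, fact)
  hence L: "L holomorphic_on S"
    unfolding L_def by (subst holomorphic_on_open[OF S]) (auto simp: S_def)
  have ZS: "Z s = gen_dirichlet b (\<lambda>n. ln (real n + \<alpha>)) 0 s" if "s \<in> S" for s
    using periodic_hurwitz_zeta_eq_gen_dirichlet[OF \<alpha>(1) b(1)] that by (simp add: Z_def S_def)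
  have "(gen_dirichlet b (\<lambda>n. ln (real n + \<alpha>)) 0 has_field_derivative gen_dirichlet b (\<lambda>n. ln (real n + \<alpha>)) (Suc 0) s) (at s)" if "Re s > 1" for s
    by (rule has_field_derivative_gen_dirichlet[where B = "\<Sum>l<k. norm (b l)"]) (rule bB, rule filterlim_shifted_logs, erule summ\<alpha>, fact)
  hence "gen_dirichlet b (\<lambda>n. ln (real n + \<alpha>)) 0 holomorphic_on S"
    by (subst holomorphic_on_open[OF S]) (auto simp: S_def)
  hence Z: "Z holomorphic_on S" by (rule holomorphic_transform) (simp add: ZS)
  have \<phi>S: "\<phi> s = exp (L s)" if "s \<in> S" for s using \<phi>L that by (simp add: L_def S_def)
  have "\<phi> holomorphic_on S"
    by (rule holomorphic_transform[of "\<lambda>s. exp (L s)"]) (auto intro!: holomorphic_intros L \<phi>S[symmetric])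
  \<comment> \<open>On \<open>Re s > 1\<close> both functions are holomorphic, so every
    approximating point also satisfies the pole conditions.\<close>
  hence np: "\<not> is_pole \<phi> s" "\<not> is_pole Z s" if "s \<in> S" for s
    using not_is_pole_holomorphic[OF S that] Z by auto
  \<comment> \<open>The first half of \<open>x\<close> prescribes derivatives of
    \<open>\<phi>\<close>; it is translated into prescribed derivatives of \<open>L\<close>. The
    second half is prescribed to the zeta-function directly.\<close>
  obtain g where g: "exp (g 0) = x 0" "\<And>k. k < N \<Longrightarrow> x (Suc k) = (\<Sum>i=0..k. of_nat (k choose i) * g (Suc i) * x (k - i))"
    using log_derivs_ex[where z = x and N = N, OF x0] by blast
  \<comment> \<open>The same \<open>n\<close> governs accuracy, through
    \<open>1 / real (Suc n)\<close>, and height, through \<open>t \<ge> real n\<close>; the latter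
    drives the points to infinity.\<close>
  have "\<exists>\<sigma> t. 1 < \<sigma> \<and> \<sigma> \<le> 2 \<and> t \<ge> real n \<and> (\<forall>k<N. norm (gen_dirichlet c (\<lambda>n. ln (real n)) k (Complex \<sigma> t) - g k) < 1 / real (Suc n) \<and>
             norm (gen_dirichlet b (\<lambda>n. ln (real n + \<alpha>)) k (Complex \<sigma> t) - x (N + k)) < 1 / real (Suc n))" for n
    by (rule joint_density[OF \<alpha> bB bdiv c]) auto
  then obtain \<sigma> t where st: "\<And>n. 1 < \<sigma> n" "\<And>n. t n \<ge> real n"
    and lims: "\<And>n k. k < N \<Longrightarrow> norm (gen_dirichlet c (\<lambda>n. ln (real n)) k (Complex (\<sigma> n) (t n)) - g k) < 1 / real (Suc n)"
      "\<And>n k. k < N \<Longrightarrow> norm (gen_dirichlet b (\<lambda>n. ln (real n + \<alpha>)) k (Complex (\<sigma> n) (t n)) - x (N + k)) < 1 / real (Suc n)"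
    by metis
  define s where "s = (\<lambda>n. Complex (\<sigma> n) (t n))"
  have sS: "s n \<in> S" for n using st by (simp add: s_def S_def)
  have one: "(\<lambda>n. 1 / real (Suc n)) \<longlonglongrightarrow> 0" by (rule LIMSEQ_Suc[OF lim_1_over_n])
  have squeeze: "f \<longlonglongrightarrow> y" if "\<And>n. norm (f n - y) < 1 / real (Suc n)" for f :: "nat \<Rightarrow> complex" and y
  proof -
    have "(\<lambda>n. f n - y) \<longlonglongrightarrow> 0"
      by (rule Lim_null_comparison[OF _ one]) (use that in \<open>auto intro!: always_eventually less_imp_le\<close>)
    thus ?thesis by (simp add: LIM_zero_iff)
  qed
  have dL: "(deriv ^^ k) L (s n) = gen_dirichlet c (\<lambda>n. ln (real n)) k (s n)" for k n
    by (rule higher_deriv_gen_dirichlet[where B = C])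
       (rule c(1), rule lim0, erule summ0, simp add: L_def, use sS in \<open>simp add: S_def\<close>)
  have dZ: "(deriv ^^ i) Z (s n) = gen_dirichlet b (\<lambda>n. ln (real n + \<alpha>)) i (s n)" for i n
    by (rule higher_deriv_gen_dirichlet[where B = "\<Sum>l<k. norm (b l)"])
       (rule bB, rule filterlim_shifted_logs, erule summ\<alpha>, use ZS in \<open>simp add: S_def\<close>, use sS in \<open>simp add: S_def\<close>)
  have lim\<phi>: "(\<lambda>n. (deriv ^^ k) \<phi> (s n)) \<longlonglongrightarrow> x k" if "k < N" for k
  proof (rule tendsto_derivs_of_log_derivs[OF L S sS \<phi>S _ g that])
    show "(\<lambda>n. (deriv ^^ k) L (s n)) \<longlonglongrightarrow> g k" if "k < N" for k
      unfolding dL using lims(1)[OF that] by (intro squeeze) (simp add: s_def)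
  qed
  have limZ: "(\<lambda>n. (deriv ^^ k) Z (s n)) \<longlonglongrightarrow> x (N + k)" if "k < N" for k
    unfolding dZ using lims(2)[OF that] by (intro squeeze) (simp add: s_def)
  have "filterlim (\<lambda>n. norm (s n)) at_top sequentially"
  proof (rule filterlim_at_top_mono[OF filterlim_real_sequentially])
    have "real n \<le> norm (s n)" for n
      using st(2)[of n] abs_Im_le_cmod[of "s n"] by (simp add: s_def)
    thus "eventually (\<lambda>n. real n \<le> norm (s n)) sequentially" by simp
  qed
  hence s_lim: "filterlim s at_infinity sequentially" by (simp add: filterlim_at_infinity_conv_norm_at_top)
  have V_lim: "(\<lambda>n. joint_derivs N \<phi> Z (s n) i) \<longlonglongrightarrow> x i" if "i < 2 * N" for i
  proof (cases "i < N")
    case True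
    thus ?thesis using lim\<phi>[of i] that by (simp add: joint_derivs_def)
  next
    case False
    thus ?thesis using limZ[of "i - N"] that by (simp add: joint_derivs_def)
  qed
  have s_D: "s n \<in> {s. Re s > 1 \<and> \<not> is_pole \<phi> s \<and> \<not> is_pole Z s}" for n
    using sS[of n] np[OF sS[of n]] by (simp add: S_def)
  show ?thesis unfolding Z_def[symmetric]
    by (rule exI[of _ s], intro conjI allI impI) (fact s_D, fact s_lim, erule V_lim)
qed

theorem theorem1:
  fixes \<alpha> \<sigma>0 :: real and b :: "nat \<Rightarrow> complex" and \<phi> :: "complex \<Rightarrow> complex"
    and N n :: nat and F :: "nat \<Rightarrow> (nat \<Rightarrow> complex) \<Rightarrow> complex"
  assumes "0 < \<alpha>" and "\<alpha> \<le> 1" and "\<not> algebraic \<alpha>"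
    and "periodic_seq b" and "\<exists>m. b m \<noteq> 0"
    and "\<phi> \<in> S_tilde \<sigma>0"
    and "N \<ge> 1"
    and "\<And>j. j \<le> n \<Longrightarrow> continuous_map (complex_space (2 * N)) euclidean (F j)"
    and "\<And>s. Re s > \<sigma>0 \<Longrightarrow> \<not> is_pole \<phi> s \<Longrightarrow> \<not> is_pole (periodic_hurwitz_zeta \<alpha> b) s \<Longrightarrow>
           (\<Sum>j\<le>n. s ^ j * F j (joint_derivs N \<phi> (periodic_hurwitz_zeta \<alpha> b) s)) = 0"
  shows "\<forall>j\<le>n. \<forall>x\<in>topspace (complex_space (2 * N)). F j x = 0"
proof -
  \<comment> \<open>As \<open>\<sigma>0 < 1\<close>, these points lie in the region where the
    relation is assumed.\<close>
  define D where "D = {s. Re s > 1 \<and> \<not> is_pole \<phi> s \<and> \<not> is_pole (periodic_hurwitz_zeta \<alpha> b) s}"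
  define V where "V = joint_derivs N \<phi> (periodic_hurwitz_zeta \<alpha> b)"
  have "\<sigma>0 < 1" using assms(6) by (simp add: S_tilde_def)
  show ?thesis
  proof (rule vanishing_of_dense_sequences[where V = V and D = D])
    show "2 * N > 0" using assms(7) by simp
    show "V s \<in> topspace (complex_space (2 * N))" for s
      by (simp add: V_def joint_derivs_def)
    show "\<exists>s. (\<forall>n. s n \<in> D) \<and> filterlim s at_infinity sequentially \<and> (\<forall>i<2*N. (\<lambda>n. V (s n) i) \<longlonglongrightarrow> x i)"
      if "x \<in> topspace (complex_space (2 * N))" "x 0 \<noteq> 0" for x
      unfolding D_def V_def using assms that by (intro dense_sequences) auto
    show "continuous_map (complex_space (2 * N)) euclidean (F j)" if "j \<le> n" for j
      using assms(8) that .
    show "(\<Sum>j\<le>n. s ^ j * F j (V s)) = 0" if "s \<in> D" for s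
      using assms(9)[of s] that \<open>\<sigma>0 < 1\<close> by (auto simp: D_def V_def)
  qed
qed

end
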